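(* Let $V,H$ be separable Hilbert spaces with $V$ continuously and densely embedded into $H$, let $T>0$, and let $a:[0,T]\times V\times V\to\mathbb{C}$ be such that each $a(t,\cdot,\cdot)$ is a sesquilinear form and: (H1) $a(\cdot,u,v)$ is strongly measurable for all $u,v\in V$; (H2) there is $M>0$ with $|a(t,u,v)|\le M\|u\|_V\|v\|_V$ for all $t\in[0,T]$, $u,v\in V$; (H3) there is $\alpha>0$ with $\mathrm{Re}\,a(t,u,u)\ge\alpha\|u\|_V^2$ for all $t\in[0,T]$, $u\in V$; (H4) $|a(t,u,v)-a(s,u,v)|\le\omega(|t-s|)\|u\|_V\|v\|_V$ for all $t,s\in[0,T]$ and $u,v\in V$, for some nondecreasing $\omega:[0,T]\to[0,+\infty)$ with $\int_0^T\omega(t)t^{-3/2}\,dt<\infty$ and $\int_0^T(\omega(t)/t)^2\,dt<\infty$. Let $\{\varphi_n\}_{n\in\mathbb{N}}$ be a Schauder basis of $V$ and of $H$, orthogonal with respect to $\langle\cdot,\cdot\rangle_H$, let $\mathbb{P}_m\big(\sum_{j=1}^\infty v_j\varphi_j\big):=\sum_{j=1}^m v_j\varphi_j$, and let $V_m:=\mathrm{span}_{\mathbb{C}}\{\varphi_1,\dots,\varphi_m\}$. For fixed $m\in\mathbb{N}$ let $$a_m(t,u,v):=a(t,\mathbb{P}_mu,\mathbb{P}_mv)+\alpha\langle(I-\mathbb{P}_m)u,(I-\mathbb{P}_m)v\rangle_V\qquad(t\in[0,T],\ u,v\in V),$$ and let $A_m(t)$ be the operator on $H$ associated with $a_m(t,\cdot,\cdot)$.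 Then, for every $m\in\mathbb{N}$, the family $A_m(t)$, $t\in[0,T]$, generates an evolution system $\{E_m(t,s)\}_{0\le s<t\le T}\subset\mathcal{L}(V)$, contractive with respect to the norm of $H$, such that for every $s\in[0,T)$ and $x\in V$ the function $u(t):=E_m(t,s)x$ is the unique solution in $H^1([s,T],H)\cap L^2([s,T],V)$ of $$u'(t)+A_m(t)u(t)=0\ \text{ for a.e. } t\in[s,T],\qquad u(s)=x,$$ and satisfies $$\|u\|_{H^1([s,T],H)}+\|u\|_{L^2([s,T],V)}+\|A_m(\cdot)u(\cdot)\|_{L^2([s,T],H)}\le C\|x\|_V$$ with a constant $C>0$ not depending on $x$. Moreover, if $x\in V_m$, then $u(t)\in V_m$ for every $t\in[s,T]$.
   Context: The operator associated with the form $a_m(t,\cdot,\cdot)$ is defined by $\langle A_m(t)u,v\rangle_H=a_m(t,u,v)$ for all $v\in V$, with domain $\mathcal{D}(A_m(t))=\{u\in V: A_m(t)u\in H\}$ (i.e. those $u\in V$ for which the functional $a_m(t,u,\cdot)$ is represented by an element of $H$). An evolution system (evolution family) is a strongly continuous family of bounded operators $E(t,s)$, $0\le s\le t\le T$, with $E(s,s)=I$ and $E(t,r)E(r,s)=E(t,s)$ for $s\le r\le t$. Contractive with respect to the norm of $H$ means $\|E_m(t,s)x\|_H\le\|x\|_H$. A solution satisfies $u(t)\in\mathcal{D}(A_m(t))$ and the equation for a.e. $t$; the initial value is understood via the continuous representative in $C([s,T],H)$. *)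

theory Defs
  imports "HOL-Analysis.Analysis"
begin

section \<open>Complex Hilbert spaces\<close>

text \<open>
  The underlying real Hilbert space structure is that of the library, so that norm, topology,
  Borel sets and the Bochner integral are the library ones. The complex inner product is linear in
  its first argument; its real part is the real inner product, hence
  \<open>norm x = sqrt (Re (cinner x x))\<close>.
  A separable Hilbert space is a type of sort \<open>{complex_hilbert, second_countable_topology}\<close>
  (for metric spaces, separability and second countability coincide).
\<close>

class complex_hilbert = real_inner + banach +
  fixes scaleC :: "complex \<Rightarrow> 'a \<Rightarrow> 'a" (infixr "*\<^sub>C" 75)
    and cinner :: "'a \<Rightarrow> 'a \<Rightarrow> complex"
  assumes scaleC_add_right: "c *\<^sub>C (x + y) = c *\<^sub>C x + c *\<^sub>C y"
    and scaleC_add_left: "(c + d) *\<^sub>C x = c *\<^sub>C x + d *\<^sub>C x"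
    and scaleC_scaleC: "c *\<^sub>C d *\<^sub>C x = (c * d) *\<^sub>C x"
    and scaleC_of_real: "complex_of_real r *\<^sub>C x = r *\<^sub>R x"
    and cinner_commute: "cinner x y = cnj (cinner y x)"
    and cinner_add_left: "cinner (x + y) z = cinner x z + cinner y z"
    and cinner_scaleC_left: "cinner (c *\<^sub>C x) y = c * cinner x y"
    and Re_cinner: "Re (cinner x y) = inner x y"

interpretation complex_vector: vector_space "scaleC :: complex \<Rightarrow> 'a \<Rightarrow> 'a :: complex_hilbert"
proof
  fix x :: 'a
  show "1 *\<^sub>C x = x"
    using scaleC_of_real[of 1 x] by simp
qed (simp_all add: scaleC_add_right scaleC_add_left scaleC_scaleC)

instantiation complex :: complex_hilbert
begin

definition scaleC_complex :: "complex \<Rightarrow> complex \<Rightarrow> complex"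
  where "scaleC_complex c z = c * z"

definition cinner_complex :: "complex \<Rightarrow> complex \<Rightarrow> complex"
  where "cinner_complex z w = z * cnj w"

instance
  by standard
    (simp_all add: scaleC_complex_def cinner_complex_def algebra_simps scaleR_conv_of_real
      inner_complex_def)

end

definition bounded_clinear :: "('a::complex_hilbert \<Rightarrow> 'b::complex_hilbert) \<Rightarrow> bool"
  where "bounded_clinear f \<longleftrightarrow> bounded_linear f \<and> (\<forall>c x. f (c *\<^sub>C x) = c *\<^sub>C f x)"

definition continuous_dense_embedding :: "('v::complex_hilbert \<Rightarrow> 'h::complex_hilbert) \<Rightarrow> bool"
  where "continuous_dense_embedding \<iota> \<longleftrightarrow>
    bounded_clinear \<iota> \<and> inj \<iota> \<and> closure (range \<iota>) = UNIV"

definition sesquilinear :: "('v::complex_hilbert \<Rightarrow> 'v \<Rightarrow> complex) \<Rightarrow> bool"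
  where "sesquilinear b \<longleftrightarrow>
    (\<forall>u u' v. b (u + u') v = b u v + b u' v) \<and>
    (\<forall>c u v. b (c *\<^sub>C u) v = c * b u v) \<and>
    (\<forall>u v v'. b u (v + v') = b u v + b u v') \<and>
    (\<forall>c u v. b u (c *\<^sub>C v) = cnj c * b u v)"

section \<open>Schauder bases\<close>

definition schauder_basis :: "(nat \<Rightarrow> 'a::complex_hilbert) \<Rightarrow> bool"
  where "schauder_basis \<phi> \<longleftrightarrow> (\<forall>x. \<exists>!c. (\<lambda>j. c j *\<^sub>C \<phi> j) sums x)"

definition basis_coeff :: "(nat \<Rightarrow> 'a::complex_hilbert) \<Rightarrow> 'a \<Rightarrow> nat \<Rightarrow> complex"
  where "basis_coeff \<phi> x = (THE c. (\<lambda>j. c j *\<^sub>C \<phi> j) sums x)"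

text \<open>
  Sequences are indexed from 0, so the first \<open>m\<close> basis vectors are those with index \<open>j < m\<close>.
\<close>

definition basis_proj :: "(nat \<Rightarrow> 'a::complex_hilbert) \<Rightarrow> nat \<Rightarrow> 'a \<Rightarrow> 'a"
  where "basis_proj \<phi> m x = (\<Sum>j<m. basis_coeff \<phi> x j *\<^sub>C \<phi> j)"

definition basis_span :: "(nat \<Rightarrow> 'a::complex_hilbert) \<Rightarrow> nat \<Rightarrow> 'a set"
  where "basis_span \<phi> m = complex_vector.span (\<phi> ` {..<m})"

section \<open>The operator associated with a form\<close>

definition form_domain ::
    "('v::complex_hilbert \<Rightarrow> 'h::complex_hilbert) \<Rightarrow> ('v \<Rightarrow> 'v \<Rightarrow> complex) \<Rightarrow> 'v set"
  where "form_domain \<iota> b = {u. \<exists>f. \<forall>v. b u v = cinner f (\<iota> v)}"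

text \<open>Meaningful on \<open>form_domain \<iota> b\<close> only; unique there by density of the range of \<open>\<iota>\<close>.\<close>

definition form_operator ::
    "('v::complex_hilbert \<Rightarrow> 'h::complex_hilbert) \<Rightarrow> ('v \<Rightarrow> 'v \<Rightarrow> complex) \<Rightarrow> 'v \<Rightarrow> 'h"
  where "form_operator \<iota> b u = (THE f. \<forall>v. b u v = cinner f (\<iota> v))"

definition galerkin_form ::
    "(nat \<Rightarrow> 'v::complex_hilbert) \<Rightarrow> real \<Rightarrow> (real \<Rightarrow> 'v \<Rightarrow> 'v \<Rightarrow> complex) \<Rightarrow> nat
      \<Rightarrow> real \<Rightarrow> 'v \<Rightarrow> 'v \<Rightarrow> complex"
  where "galerkin_form \<phi> \<alpha> a m t u v =
    a t (basis_proj \<phi> m u) (basis_proj \<phi> m v)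
    + complex_of_real \<alpha> * cinner (u - basis_proj \<phi> m u) (v - basis_proj \<phi> m v)"

section \<open>Vector-valued Lebesgue and Sobolev spaces on an interval\<close>

text \<open>
  Elements of these spaces are represented by functions defined everywhere, considered up to
  equality almost everywhere. In the separable spaces at hand, strong measurability is
  (Lebesgue-to-Borel) measurability.
\<close>

definition in_L2 ::
    "real \<Rightarrow> real \<Rightarrow> (real \<Rightarrow> 'a::{complex_hilbert, second_countable_topology}) \<Rightarrow> bool"
  where "in_L2 p q f \<longleftrightarrow>
    f \<in> borel_measurable (lebesgue_on {p..q}) \<and>
    integrable (lebesgue_on {p..q}) (\<lambda>t. (norm (f t))\<^sup>2)"

definition norm_L2 ::
    "real \<Rightarrow> real \<Rightarrow> (real \<Rightarrow> 'a::{complex_hilbert, second_countable_topology}) \<Rightarrow> real"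
  where "norm_L2 p q f = sqrt (LINT t|lebesgue_on {p..q}. (norm (f t))\<^sup>2)"

text \<open>
  Test functions are of class C1 with compact support in the open interval, as is usual for the
  one-dimensional Sobolev spaces; smooth test functions give the same weak derivatives.
\<close>

definition test_function :: "real \<Rightarrow> real \<Rightarrow> (real \<Rightarrow> real) \<Rightarrow> bool"
  where "test_function p q \<psi> \<longleftrightarrow>
    \<psi> C1_differentiable_on UNIV \<and>
    (\<exists>K. compact K \<and> K \<subseteq> {p<..<q} \<and> (\<forall>t. t \<notin> K \<longrightarrow> \<psi> t = 0))"

definition has_L2_weak_deriv ::
    "real \<Rightarrow> real \<Rightarrow> (real \<Rightarrow> 'a::{complex_hilbert, second_countable_topology})
      \<Rightarrow> (real \<Rightarrow> 'a) \<Rightarrow> bool"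
  where "has_L2_weak_deriv p q f g \<longleftrightarrow>
    in_L2 p q g \<and>
    (\<forall>\<psi>. test_function p q \<psi> \<longrightarrow>
      (LINT t|lebesgue_on {p..q}. deriv \<psi> t *\<^sub>R f t)
        = - (LINT t|lebesgue_on {p..q}. \<psi> t *\<^sub>R g t))"

definition in_H1 ::
    "real \<Rightarrow> real \<Rightarrow> (real \<Rightarrow> 'a::{complex_hilbert, second_countable_topology}) \<Rightarrow> bool"
  where "in_H1 p q f \<longleftrightarrow> in_L2 p q f \<and> (\<exists>g. has_L2_weak_deriv p q f g)"

text \<open>For \<open>f\<close> in the Sobolev space, the weak derivative is unique up to a null set.\<close>

definition weak_deriv ::
    "real \<Rightarrow> real \<Rightarrow> (real \<Rightarrow> 'a::{complex_hilbert, second_countable_topology}) \<Rightarrow> real \<Rightarrow> 'a"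
  where "weak_deriv p q f = (SOME g. has_L2_weak_deriv p q f g)"

definition norm_H1 ::
    "real \<Rightarrow> real \<Rightarrow> (real \<Rightarrow> 'a::{complex_hilbert, second_countable_topology}) \<Rightarrow> real"
  where "norm_H1 p q f = sqrt ((norm_L2 p q f)\<^sup>2 + (norm_L2 p q (weak_deriv p q f))\<^sup>2)"

text \<open>The value at the left endpoint of the continuous representative of \<open>f\<close> is \<open>y\<close>.\<close>

definition has_initial_value ::
    "real \<Rightarrow> real \<Rightarrow> (real \<Rightarrow> 'a::complex_hilbert) \<Rightarrow> 'a \<Rightarrow> bool"
  where "has_initial_value p q f y \<longleftrightarrow>
    (\<exists>c. continuous_on {p..q} c \<and> (AE t in lebesgue_on {p..q}. c t = f t) \<and> c p = y)"

section \<open>Evolution systems and solutions\<close>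

definition evolution_system ::
    "real \<Rightarrow> (real \<Rightarrow> real \<Rightarrow> 'v::complex_hilbert \<Rightarrow> 'v) \<Rightarrow> bool"
  where "evolution_system T E \<longleftrightarrow>
    (\<forall>s t. 0 \<le> s \<and> s \<le> t \<and> t \<le> T \<longrightarrow> bounded_clinear (E t s)) \<and>
    (\<forall>x. continuous_on {(t, s). 0 \<le> s \<and> s \<le> t \<and> t \<le> T} (\<lambda>(t, s). E t s x)) \<and>
    (\<forall>s x. 0 \<le> s \<and> s \<le> T \<longrightarrow> E s s x = x) \<and>
    (\<forall>s r t x. 0 \<le> s \<and> s \<le> r \<and> r \<le> t \<and> t \<le> T \<longrightarrow> E t r (E r s x) = E t s x)"

text \<open>
  \<open>u\<close> solves \<open>u' + A u = 0\<close> almost everywhere on \<open>[s, T]\<close>, \<open>u(s) = x\<close>, where \<open>A(t)\<close> is associated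
  with the form \<open>b(t)\<close>.
\<close>

definition cauchy_solution ::
    "('v::{complex_hilbert, second_countable_topology}
        \<Rightarrow> 'h::{complex_hilbert, second_countable_topology})
      \<Rightarrow> (real \<Rightarrow> 'v \<Rightarrow> 'v \<Rightarrow> complex) \<Rightarrow> real \<Rightarrow> real \<Rightarrow> 'v \<Rightarrow> (real \<Rightarrow> 'v) \<Rightarrow> bool"
  where "cauchy_solution \<iota> b s T x u \<longleftrightarrow>
    in_H1 s T (\<lambda>t. \<iota> (u t)) \<and> in_L2 s T u \<and>
    (AE t in lebesgue_on {s..T}.
      u t \<in> form_domain \<iota> (b t) \<and>
      weak_deriv s T (\<lambda>t. \<iota> (u t)) t + form_operator \<iota> (b t) (u t) = 0) \<and>
    has_initial_value s T (\<lambda>t. \<iota> (u t)) (\<iota> x)"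

end

theory Submission
  imports Defs "HOL-Computational_Algebra.Polynomial"
begin

text \<open>
  Since the basis is orthogonal in \<open>H\<close>, the form \<open>a\<^sub>m\<close> decouples along \<open>V = V\<^sub>m \<oplus> W\<close> with
  \<open>W = ker P\<^sub>m\<close>. On \<open>V\<^sub>m\<close> the equation is a linear ordinary differential equation; its
  coefficients are continuous because the integrability of \<open>(\<omega> t / t)\<^sup>2\<close> forces \<open>\<omega> t\<close> to tend to 0.
  On \<open>W\<close> the operator is autonomous and self-adjoint; up to a factor it is the inverse of the
  positive contraction \<open>G\<close> of \<open>W\<close> that represents the inner product of \<open>H\<close>, so that its
  semigroup is \<open>exp (- t / G)\<close>. The functional calculus of \<open>G\<close> rests on the
  inequality \<open>p(G) \<ge> 0\<close> for polynomials \<open>p \<ge> 0\<close> on \<open>[0, 1]\<close>, which follows by writing \<open>p\<close> in the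
  Bernstein basis of high degree, where its coefficients are nearly nonnegative. Uniqueness is the
  energy argument: for \<open>u(t) = \<integral> g\<close>, Fubini's theorem gives \<open>(norm (u t))\<^sup>2 = 2 \<integral> \<langle>g, u\<rangle>\<close>.
\<close>

section \<open>Polynomial calculus of a positive contraction\<close>

text \<open>The inverse of G is never formed: for t > 0 the functions exp (- t / y) and exp (- t /
  y) / y, extended by 0, are continuous on [0, 1], so a calculus for continuous functions suffices
  and no unbounded operator occurs. The price is paid at t = 0, where the symbol is discontinuous:
  strong continuity there holds on the closure of the range of G, which contains W because the
  embedding is injective. Two inner products compete. V_m and W are orthogonal in H but in general
  not in V, so the contraction in H follows by Pythagoras, in V only boundedness results, and the
  V-orthogonal projection onto W is not I - P_m. G links the two products, since (G u, v)_V is a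
  multiple of (u, v)_H on W. Hence positivity of G yields the contraction in H, and on W the
  identity d/dt |u|_V^2 = - (2 / \<alpha>) |A u|_H^2 bounds A u in L2 for initial values merely in
  V. The analysis is real; complex linearity is recovered because the operators involved commute
  with complex scalars.\<close>

text \<open>The representing vector minimises |v|^2 - 2 f v over S. It later yields the orthogonal
  projection onto W, the operator \<open>G\<close>, and the density of the range of
  \<open>G\<close>.\<close>

lemma riesz_subspace:
  fixes f :: "'a::{real_inner, banach} \<Rightarrow> real"
  assumes f: "bounded_linear f" and S: "subspace S" "closed S"
  shows "\<exists>w\<in>S. \<forall>v\<in>S. inner w v = f v"
proof -
  interpret f: bounded_linear f by (rule f)
  define J where "J v = (norm v)\<^sup>2 - 2 * f v" for v
  obtain K where K: "\<And>v. norm (f v) \<le> norm v * K" using f.bounded by blast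
  have J_lower: "J v \<ge> - K\<^sup>2" for v
  proof -
    have "f v \<le> norm v * K" using K[of v] by auto
    moreover have "0 \<le> (norm v - K)\<^sup>2" by simp
    ultimately show ?thesis unfolding J_def by (simp add: power2_diff algebra_simps)
  qed
  define m where "m = Inf (J ` S)"
  have bdd: "bdd_below (J ` S)" using J_lower by (meson bdd_belowI2)
  have S0: "0 \<in> S" using S(1) by (rule subspace_0)
  have m_le: "m \<le> J v" if "v \<in> S" for v
    unfolding m_def using bdd that by (intro cInf_lower) auto
  have "\<exists>v\<in>S. J v < m + 1 / Suc n" for n
  proof -
    have "Inf (J ` S) < m + 1 / Suc n" unfolding m_def by simp
    then show ?thesis using cInf_lessD[of "J ` S"] S0 by blast
  qed
  then obtain X where X: "\<And>n. X n \<in> S" "\<And>n. J (X n) < m + 1 / Suc n" by metis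
  \<comment> \<open>Parallelogram law: the linear terms of \<open>J\<close> cancel, so a minimising
    sequence is Cauchy.\<close>
  have par: "(norm (v - w))\<^sup>2 = 2 * J v + 2 * J w - 4 * J ((1/2) *\<^sub>R (v + w))" for v w
    unfolding J_def
    by (simp add: f.scaleR f.add power2_norm_eq_inner algebra_simps inner_commute)
  have close: "(norm (X i - X j))\<^sup>2 \<le> 2 / Suc i + 2 / Suc j" for i j
  proof -
    have "(1/2) *\<^sub>R (X i + X j) \<in> S" using X S by (intro subspace_mul subspace_add)
    from m_le[OF this] have "(norm (X i - X j))\<^sup>2 \<le> 2 * (1 / Suc i) + 2 * (1 / Suc j)"
      using par[of "X i" "X j"] X(2)[of i] X(2)[of j] by linarith
    then show ?thesis by simp
  qed
  have "Cauchy X"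
  proof (rule metric_CauchyI)
    fix e :: real assume e: "e > 0"
    obtain N where N: "4 / e\<^sup>2 < real (Suc N)" using reals_Archimedean2 lessI less_trans of_nat_less_iff by metis
    have "dist (X i) (X j) < e" if "i \<ge> N" "j \<ge> N" for i j
    proof -
      have "(norm (X i - X j))\<^sup>2 \<le> 2 / Suc i + 2 / Suc j" by (rule close)
      also have "\<dots> \<le> 2 / Suc N + 2 / Suc N" using that by (intro add_mono divide_left_mono) auto
      also have "\<dots> = 4 / Suc N" by simp
      also have "\<dots> < e\<^sup>2" using N e by (simp add: field_simps)
      finally show ?thesis using e by (simp add: dist_norm power2_less_imp_less)
    qed
    then show "\<exists>M. \<forall>i\<ge>M. \<forall>j\<ge>M. dist (X i) (X j) < e" by blast
  qed
  then obtain w where w: "X \<longlonglongrightarrow> w" using Cauchy_convergent convergent_def by blast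
  have wS: "w \<in> S" using closed_sequentially[OF S(2)] X(1) w by blast
  have "(\<lambda>n. J (X n)) \<longlonglongrightarrow> J w"
    unfolding J_def by (intro tendsto_intros w f.tendsto)
  moreover have "(\<lambda>n. m + 1 / Suc n) \<longlonglongrightarrow> m + 0"
    using LIMSEQ_inverse_real_of_nat by (intro tendsto_intros) (simp add: inverse_eq_divide)
  ultimately have "J w \<le> m + 0"
    using X(2) by (intro LIMSEQ_le) (auto intro: less_imp_le)
  then have min: "J w \<le> J v" if "v \<in> S" for v using m_le[OF that] by simp
  have "inner w v = f v" if v: "v \<in> S" for v
  proof -
    define b where "b = inner w v - f v"
    have q: "0 \<le> t\<^sup>2 * (norm v)\<^sup>2 + 2 * t * b" for t
    proof -
      have "w + t *\<^sub>R v \<in> S" using wS v S by (intro subspace_mul subspace_add)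
      from min[OF this] show ?thesis unfolding J_def b_def
        by (simp add: f.scaleR f.add power2_norm_eq_inner algebra_simps inner_commute power2_eq_square[of t])
    qed
    have "b = 0"
    proof (cases "v = 0")
      case True then show ?thesis unfolding b_def by (simp add: f.zero)
    next
      case False
      then have "0 < (norm v)\<^sup>2" by simp
      define N where "N = (norm v)\<^sup>2"
      \<comment> \<open>The value t = - b / N is the minimum point of the quadratic in
        \<open>q\<close>.\<close>
      have "0 \<le> (- b / N)\<^sup>2 * N + 2 * (- b / N) * b" unfolding N_def by (rule q)
      also have "\<dots> = - (b\<^sup>2 / N)" using \<open>0 < (norm v)\<^sup>2\<close> unfolding N_def[symmetric]
        by (simp add: power2_eq_square field_simps)
      finally show ?thesis using \<open>0 < (norm v)\<^sup>2\<close> unfolding N_def[symmetric]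
        by (simp add: divide_le_0_iff)
    qed
    then show ?thesis unfolding b_def by simp
  qed
  with wS show ?thesis by blast
qed

section \<open>Bernstein coefficients of powers\<close>

text \<open>The left quotient is the j-th Bernstein coefficient of y^k in degree n. As long as it is
  nonzero, it is a product of factors (j - i) / (n - i) with i < k, each in [0, 1] and within i / (n
  - i) of j / n, so that the errors add up. The bound does not depend on j.\<close>

lemma binomial_ratio_power:
  assumes "j \<le> n" "k < n"
  shows "\<bar>real (j choose k) / real (n choose k) - (real j / real n) ^ k\<bar> \<le> (real k)\<^sup>2 / (real n - real k)"
  using assms(2)
proof (induction k)
  case 0
  then show ?case by simp
next
  case (Suc k)
  define r where "r = real (j choose k) / real (n choose k)"
  define q where "q = (real j / real n) ^ k"
  have nk: "k < n" using Suc.prems by simp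
  have IH: "\<bar>r - q\<bar> \<le> (real k)\<^sup>2 / (real n - real k)" unfolding r_def q_def using Suc by simp
  have jn: "0 \<le> real j / real n" "real j / real n \<le> 1" using assms nk by auto
  have r01: "0 \<le> r" "r \<le> 1" unfolding r_def using assms nk by (auto simp: binomial_right_mono)
  \<comment> \<open>The accumulated error k^2 plus the new error k stays below (k + 1)^2, and the
    denominators decrease.\<close>
  have mono: "(real k)\<^sup>2 / (real n - real k) + real k / (real n - real k) \<le> (real (Suc k))\<^sup>2 / (real n - real (Suc k))"
  proof -
    have "(real k)\<^sup>2 / (real n - real k) + real k / (real n - real k) = ((real k)\<^sup>2 + real k) / (real n - real k)"
      by (simp add: add_divide_distrib)
    also have "\<dots> \<le> (real (Suc k))\<^sup>2 / (real n - real (Suc k))"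
      using Suc.prems by (intro frac_le) (auto simp: power2_eq_square algebra_simps)
    finally show ?thesis .
  qed
  show ?case
  proof (cases "k \<le> j")
    case True
    have c: "real (i choose Suc k) = real (i choose k) * (real i - real k) / (real k + 1)" if "k \<le> i" for i
    proof -
      have "Suc k * (i choose Suc k) = (i - k) * (i choose k)"
        using binomial_absorption[of k i] binomial_absorb_comp[of i k] by simp
      then have "real (Suc k) * real (i choose Suc k) = real (i - k) * real (i choose k)" by (metis of_nat_mult)
      then show ?thesis using that by (simp add: of_nat_diff field_simps)
    qed
    have nz: "real (n choose k) \<noteq> 0" using nk by simp
    have eq: "real (j choose Suc k) / real (n choose Suc k) = r * ((real j - real k) / (real n - real k))"
      unfolding r_def c[OF True] c[OF less_imp_le[OF nk]] by (simp add: divide_simps)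
    define s where "s = (real j - real k) / (real n - real k)"
    have s: "\<bar>s - real j / real n\<bar> \<le> real k / (real n - real k)"
    proof -
      have "real j / real n - s = (real k / (real n - real k)) * ((real n - real j) / real n)"
        unfolding s_def using nk by (simp add: field_simps)
      moreover have "0 \<le> (real n - real j) / real n" "(real n - real j) / real n \<le> 1" using assms nk by auto
      moreover have "0 \<le> real k / (real n - real k)" using nk by simp
      ultimately have "0 \<le> real j / real n - s" "real j / real n - s \<le> real k / (real n - real k)"
        by (metis mult_nonneg_nonneg, metis mult_left_le)
      then show ?thesis by simp
    qed
    have "\<bar>r * s - q * (real j / real n)\<bar> = \<bar>r * (s - real j / real n) + (r - q) * (real j / real n)\<bar>"
      by (simp only: right_diff_distrib left_diff_distrib)
    also have "\<dots> \<le> \<bar>r\<bar> * \<bar>s - real j / real n\<bar> + \<bar>r - q\<bar> * \<bar>real j / real n\<bar>"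
      by (metis abs_mult abs_triangle_ineq)
    also have "\<dots> \<le> 1 * (real k / (real n - real k)) + ((real k)\<^sup>2 / (real n - real k)) * 1"
      using s IH r01 jn by (intro add_mono mult_mono) auto
    finally show ?thesis using mono unfolding eq s_def[symmetric] q_def by (simp add: mult.commute)
  next
    \<comment> \<open>Here both binomial quotients vanish, so the induction hypothesis already
      bounds the power itself.\<close>
    case False
    then have "r = 0" unfolding r_def by simp
    moreover have "\<bar>q * (real j / real n)\<bar> \<le> \<bar>q\<bar> * 1" unfolding abs_mult using jn by (intro mult_left_mono) auto
    moreover have "0 \<le> real k / (real n - real k)" using nk by simp
    ultimately have "\<bar>q * (real j / real n)\<bar> \<le> (real (Suc k))\<^sup>2 / (real n - real (Suc k))"
      using IH mono by linarith
    moreover have "real (j choose Suc k) = 0" using False by simp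
    ultimately show ?thesis unfolding q_def
      by (simp only: div_0 diff_0 abs_minus_cancel power_Suc2)
  qed
qed

text \<open>The identity C(n,j) C(j,k) = C(n,k) C(n-k,j-k) reduces the sum to x^k times the binomial
  expansion of (x + (1 - x))^(n-k).\<close>

lemma power_Bernstein_expansion:
  fixes x :: real
  assumes "k \<le> n"
  shows "(\<Sum>j\<le>n. (real (j choose k) / real (n choose k)) * real (n choose j) * (x ^ j * (1 - x) ^ (n - j))) = x ^ k"
proof -
  have "(\<Sum>j\<le>n. (real (j choose k) / real (n choose k)) * real (n choose j) * (x ^ j * (1 - x) ^ (n - j)))
    = (\<Sum>j\<in>{k..n}. (real (j choose k) / real (n choose k)) * real (n choose j) * (x ^ j * (1 - x) ^ (n - j)))"
    by (rule sum.mono_neutral_right) auto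
  also have "\<dots> = (\<Sum>j\<in>{k..n}. real (n - k choose (j - k)) * (x ^ j * (1 - x) ^ (n - j)))"
  proof (rule sum.cong)
    fix j assume j: "j \<in> {k..n}"
    have "(n choose j) * (j choose k) = (n choose k) * (n - k choose (j - k))"
      using j by (intro choose_mult) auto
    then have "real (n choose j) * real (j choose k) = real (n choose k) * real (n - k choose (j - k))"
      by (metis of_nat_mult)
    moreover have "real (n choose k) \<noteq> 0" using assms by simp
    ultimately have "(real (j choose k) / real (n choose k)) * real (n choose j) = real (n - k choose (j - k))"
      by (simp add: field_simps)
    then show "(real (j choose k) / real (n choose k)) * real (n choose j) * (x ^ j * (1 - x) ^ (n - j))
      = real (n - k choose (j - k)) * (x ^ j * (1 - x) ^ (n - j))" by simp
  qed simp
  also have "\<dots> = (\<Sum>i\<le>n - k. real (n - k choose i) * (x ^ (i + k) * (1 - x) ^ (n - k - i)))"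
    using assms by (intro sum.reindex_bij_witness[of _ "\<lambda>i. i + k" "\<lambda>j. j - k"]) auto
  also have "\<dots> = x ^ k * (\<Sum>i\<le>n - k. real (n - k choose i) * x ^ i * (1 - x) ^ (n - k - i))"
    by (simp add: sum_distrib_left power_add mult_ac)
  also have "\<dots> = x ^ k * (x + (1 - x)) ^ (n - k)" by (subst binomial_ring) simp
  finally show ?thesis by simp
qed

section \<open>Evaluating polynomials at the operator\<close>

text \<open>This is p(G) by Horner's scheme; the fold makes inductions along \<open>pCons\<close>
  immediate.\<close>

definition op_poly :: "('a::real_vector \<Rightarrow> 'a) \<Rightarrow> real poly \<Rightarrow> 'a \<Rightarrow> 'a"
  where "op_poly G p = fold_coeffs (\<lambda>a F x. a *\<^sub>R x + G (F x)) p (\<lambda>x. 0)"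

locale positive_contraction =
  fixes G :: "'a::{real_inner, banach} \<Rightarrow> 'a"
  assumes bounded: "bounded_linear G"
    and symmetric: "inner (G x) y = inner x (G y)"
    and nonneg: "0 \<le> inner (G x) x"
    and le_one: "inner (G x) x \<le> inner x x"
begin

sublocale G: bounded_linear G by (rule bounded)

lemma op_poly_0 [simp]: "op_poly G 0 x = 0"
  by (simp add: op_poly_def)

lemma op_poly_pCons [simp]: "op_poly G (pCons a p) x = a *\<^sub>R x + G (op_poly G p x)"
  by (cases "p = 0 \<and> a = 0") (auto simp: op_poly_def G.zero)

lemma op_poly_1 [simp]: "op_poly G 1 x = x"
  by (simp add: one_pCons G.zero)

lemma op_poly_add: "op_poly G (p + q) x = op_poly G p x + op_poly G q x"
  by (induction p q rule: poly_induct2) (simp_all add: G.add algebra_simps)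

lemma op_poly_smult: "op_poly G (smult c p) x = c *\<^sub>R op_poly G p x"
  by (induction p) (simp_all add: G.scaleR algebra_simps)

lemma op_poly_minus: "op_poly G (- p) x = - op_poly G p x"
  using op_poly_smult[of "-1" p x] by simp

lemma op_poly_diff: "op_poly G (p - q) x = op_poly G p x - op_poly G q x"
  using op_poly_add[of p "- q" x] by (simp add: op_poly_minus)

lemma op_poly_sum: "op_poly G (\<Sum>i\<in>I. p i) x = (\<Sum>i\<in>I. op_poly G (p i) x)"
  by (induction I rule: infinite_finite_induct) (simp_all add: op_poly_add)

lemma op_poly_mult: "op_poly G (p * q) x = op_poly G p (op_poly G q x)"
  by (induction p) (simp_all add: op_poly_add op_poly_smult)

lemma op_poly_commute:
  assumes "bounded_linear J" "\<And>x. G (J x) = J (G x)"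
  shows "op_poly G p (J x) = J (op_poly G p x)"
proof -
  interpret J: bounded_linear J by fact
  show ?thesis by (induction p) (simp_all add: J.zero J.add J.scaleR assms(2))
qed

lemma op_poly_linear: "bounded_linear (op_poly G p)"
proof (induction p)
  case 0
  have "op_poly G 0 = (\<lambda>x. 0)" by auto
  then show ?case by simp
next
  case (pCons a p)
  have "op_poly G (pCons a p) = (\<lambda>x. a *\<^sub>R x + G (op_poly G p x))" by auto
  then show ?case using bounded_linear_compose[OF bounded pCons(2)]
    by (auto intro!: bounded_linear_add bounded_linear_scaleR_right)
qed

lemma op_poly_symmetric: "inner (op_poly G p x) y = inner x (op_poly G p y)"
proof (induction p arbitrary: x y)
  case (pCons a p)
  have "inner (G (op_poly G p x)) y = inner x (op_poly G p (G y))"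
    by (simp add: symmetric pCons)
  also have "op_poly G p (G y) = G (op_poly G p y)"
    by (rule op_poly_commute) (simp_all add: bounded)
  finally show ?case by (simp add: inner_add_left inner_add_right)
qed simp

text \<open>If both exponents are even, the operator is a square; if one is odd, it is G or I - G
  between two equal symmetric factors. If both are odd, multiplying by G + (I - G) = I splits it
  into two products, each with an even exponent. This avoids a square root of G.\<close>

lemma op_poly_Bernstein_nonneg:
  "0 \<le> inner (op_poly G ([:0, 1:] ^ j * [:1, -1:] ^ l) x) x"
proof -
  define X Y :: "real poly" where "X = [:0, 1:]" and "Y = [:1, -1:]"
  have square: "0 \<le> inner (op_poly G (r * (p * p)) x) x"
    if "\<And>y. 0 \<le> inner (op_poly G r y) y" for r p x
  proof -
    have "r * (p * p) = p * (r * p)" by (simp add: mult_ac)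
    then have "op_poly G (r * (p * p)) x = op_poly G p (op_poly G r (op_poly G p x))"
      by (simp only: op_poly_mult)
    then show ?thesis using that[of "op_poly G p x"] by (simp add: op_poly_symmetric)
  qed
  have X: "0 \<le> inner (op_poly G X y) y" and Y: "0 \<le> inner (op_poly G Y y) y" for y
    unfolding X_def Y_def using nonneg[of y] le_one[of y] by (simp_all add: G.zero G.neg inner_diff_left)
  have base: "0 \<le> inner (op_poly G (X ^ j * Y ^ l) x) x" if jl: "even j \<or> even l" for j l x
  proof -
    have dbl: "X ^ (2 * a) * Y ^ (2 * b) = 1 * ((X ^ a * Y ^ b) * (X ^ a * Y ^ b))" for a b
      unfolding mult_2 power_add by (simp only: mult_1_left mult_ac)
    have "(\<exists>a. j = 2 * a \<or> j = Suc (2 * a)) \<and> (\<exists>b. l = 2 * b \<or> l = Suc (2 * b))" by presburger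
    then consider a b where "j = 2 * a" "l = 2 * b" | a b where "j = Suc (2 * a)" "l = 2 * b"
      | a b where "j = 2 * a" "l = Suc (2 * b)"
      using jl by auto
    then show ?thesis
    proof cases
      case 1
      show ?thesis unfolding 1 dbl by (rule square) simp
    next
      case 2
      have "X ^ j * Y ^ l = X * (X ^ (2 * a) * Y ^ (2 * b))"
        unfolding 2 power_Suc by (simp only: mult_ac)
      also have "\<dots> = X * ((X ^ a * Y ^ b) * (X ^ a * Y ^ b))"
        unfolding dbl mult_1_left ..
      finally have eq: "X ^ j * Y ^ l = X * ((X ^ a * Y ^ b) * (X ^ a * Y ^ b))" .
      show ?thesis unfolding eq by (rule square[OF X])
    next
      case 3
      have "X ^ j * Y ^ l = Y * (X ^ (2 * a) * Y ^ (2 * b))"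
        unfolding 3 power_Suc by (simp only: mult_ac)
      also have "\<dots> = Y * ((X ^ a * Y ^ b) * (X ^ a * Y ^ b))"
        unfolding dbl mult_1_left ..
      finally have eq: "X ^ j * Y ^ l = Y * ((X ^ a * Y ^ b) * (X ^ a * Y ^ b))" .
      show ?thesis unfolding eq by (rule square[OF Y])
    qed
  qed
  have "0 \<le> inner (op_poly G (X ^ j * Y ^ l) x) x"
  proof (cases "even j \<or> even l")
    case False
    have one: "X + Y = 1" by (simp add: X_def Y_def one_pCons)
    have "X ^ j * Y ^ l = (X + Y) * (X ^ j * Y ^ l)"
      unfolding one by simp
    also have "\<dots> = X ^ Suc j * Y ^ l + X ^ j * Y ^ Suc l"
      by (simp only: distrib_right power_Suc mult_ac)
    finally have eq: "X ^ j * Y ^ l = X ^ Suc j * Y ^ l + X ^ j * Y ^ Suc l" .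
    have "even (Suc j)" "even (Suc l)" using False by auto
    then show ?thesis unfolding eq op_poly_add inner_add_left
      by (intro add_nonneg_nonneg base) blast+
  qed (rule base)
  then show ?thesis unfolding X_def Y_def .
qed

text \<open>In high degree n the Bernstein coefficients of p are close to the values p(j / n), which
  are nonnegative. Up to a small multiple of the identity, p(G) is then a nonnegative combination of
  the operators of the preceding lemma.\<close>

lemma op_poly_nonneg:
  assumes p: "\<And>y. 0 \<le> y \<Longrightarrow> y \<le> 1 \<Longrightarrow> 0 \<le> poly p y"
  shows "0 \<le> inner (op_poly G p x) x"
proof (rule field_le_epsilon)
  fix e :: real assume e: "0 < e"
  define d where "d = degree p"
  \<comment> \<open>Scaled so that e' |x|^2 is at most e; the added 1 covers x = 0.\<close>
  define e' where "e' = e / ((norm x)\<^sup>2 + 1)"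
  have e': "e' > 0" unfolding e'_def using e by (simp add: add_nonneg_pos)
  have "(\<lambda>n. \<Sum>k\<le>d. \<bar>coeff p k\<bar> * ((real k)\<^sup>2 / (real n - real k))) \<longlonglongrightarrow> (\<Sum>k\<le>d. \<bar>coeff p k\<bar> * 0)"
  proof (intro tendsto_intros)
    fix k
    show "(\<lambda>n. (real k)\<^sup>2 / (real n - real k)) \<longlonglongrightarrow> 0"
      by (intro tendsto_divide_0[OF tendsto_const] filterlim_at_top_imp_at_infinity
          filterlim_at_top_add_at_top filterlim_real_sequentially
          filterlim_tendsto_add_at_top[OF tendsto_const[of "- real k"] filterlim_real_sequentially, simplified])
  qed
  then have "eventually (\<lambda>n. (\<Sum>k\<le>d. \<bar>coeff p k\<bar> * ((real k)\<^sup>2 / (real n - real k))) < e') sequentially"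
    using e' by (intro order_tendstoD(2)) auto
  then obtain n where n: "(\<Sum>k\<le>d. \<bar>coeff p k\<bar> * ((real k)\<^sup>2 / (real n - real k))) < e'" "n > d"
    using eventually_conj[OF _ eventually_gt_at_top[of d]] eventually_sequentially by (metis (lifting) le_refl)
  \<comment> \<open>The Bernstein coefficients of p, obtained termwise from those of the
    powers.\<close>
  define b where "b j = (\<Sum>k\<le>d. coeff p k * (real (j choose k) / real (n choose k)))" for j
  define B where "B j = smult (real (n choose j)) ([:0, 1:] ^ j * [:1, -1:] ^ (n - j))" for j
  have polyB: "poly (B j) y = real (n choose j) * (y ^ j * (1 - y) ^ (n - j))" for j y
    unfolding B_def by (simp add: poly_power)
  have pB: "p = (\<Sum>j\<le>n. smult (b j) (B j))"
  proof -
    have "poly p y = poly (\<Sum>j\<le>n. smult (b j) (B j)) y" for y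
    proof -
      have "poly (\<Sum>j\<le>n. smult (b j) (B j)) y
        = (\<Sum>j\<le>n. \<Sum>k\<le>d. coeff p k * ((real (j choose k) / real (n choose k)) * real (n choose j) * (y ^ j * (1 - y) ^ (n - j))))"
        unfolding poly_sum poly_smult polyB b_def sum_distrib_right by (simp only: mult_ac)
      also have "\<dots> = (\<Sum>k\<le>d. coeff p k * (\<Sum>j\<le>n. (real (j choose k) / real (n choose k)) * real (n choose j) * (y ^ j * (1 - y) ^ (n - j))))"
        by (subst sum.swap) (simp add: sum_distrib_left)
      also have "\<dots> = (\<Sum>k\<le>d. coeff p k * y ^ k)"
        using n(2) by (intro sum.cong refl arg_cong2[of _ _ _ _ "(*)"] power_Bernstein_expansion) auto
      finally show ?thesis by (simp add: poly_altdef d_def)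
    qed
    then show ?thesis using poly_eq_poly_eq_iff by blast
  qed
  have oneB: "1 = (\<Sum>j\<le>n. B j)"
  proof -
    have "poly 1 y = poly (\<Sum>j\<le>n. B j) y" for y :: real
      using power_Bernstein_expansion[of 0 n y] by (simp add: poly_sum polyB)
    then show ?thesis using poly_eq_poly_eq_iff by blast
  qed
  have b_ge: "b j \<ge> - e'" if j: "j \<le> n" for j
  proof -
    have "poly p (real j / real n) - b j = (\<Sum>k\<le>d. coeff p k * ((real j / real n) ^ k - real (j choose k) / real (n choose k)))"
      by (simp add: poly_altdef d_def b_def sum_subtractf algebra_simps)
    also have "\<dots> \<le> (\<Sum>k\<le>d. \<bar>coeff p k\<bar> * ((real k)\<^sup>2 / (real n - real k)))"
    proof (rule sum_mono)
      fix k assume "k \<in> {..d}"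
      then have "\<bar>real (j choose k) / real (n choose k) - (real j / real n) ^ k\<bar> \<le> (real k)\<^sup>2 / (real n - real k)"
        using j n(2) by (intro binomial_ratio_power) auto
      then have "\<bar>coeff p k\<bar> * \<bar>(real j / real n) ^ k - real (j choose k) / real (n choose k)\<bar> \<le> \<bar>coeff p k\<bar> * ((real k)\<^sup>2 / (real n - real k))"
        by (intro mult_left_mono) (auto simp: abs_minus_commute)
      then show "coeff p k * ((real j / real n) ^ k - real (j choose k) / real (n choose k)) \<le> \<bar>coeff p k\<bar> * ((real k)\<^sup>2 / (real n - real k))"
        unfolding abs_mult[symmetric] by (rule order_trans[OF abs_ge_self])
    qed
    finally have "poly p (real j / real n) - b j < e'" using n(1) by linarith
    moreover have "poly p (real j / real n) \<ge> 0" using j by (intro p) (auto simp: divide_le_eq_1)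
    ultimately show ?thesis by linarith
  qed
  have Bx: "0 \<le> inner (op_poly G (B j) x) x" for j
    unfolding B_def by (simp add: op_poly_smult op_poly_Bernstein_nonneg)
  \<comment> \<open>The Bernstein polynomials sum to 1, so the lower bound - e' on the coefficients
    costs exactly e' |x|^2.\<close>
  have "- e' * inner x x = - e' * inner (op_poly G (\<Sum>j\<le>n. B j) x) x"
    using oneB by (metis op_poly_1)
  also have "\<dots> = (\<Sum>j\<le>n. (- e') * inner (op_poly G (B j) x) x)"
    by (simp only: op_poly_sum inner_sum_left sum_distrib_left)
  also have "\<dots> \<le> (\<Sum>j\<le>n. b j * inner (op_poly G (B j) x) x)"
    using b_ge Bx by (intro sum_mono mult_right_mono) auto
  also have "\<dots> = inner (op_poly G p x) x"
    by (subst pB) (simp add: op_poly_sum op_poly_smult inner_sum_left)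
  finally have "- e' * (norm x)\<^sup>2 \<le> inner (op_poly G p x) x" by (simp add: power2_norm_eq_inner)
  moreover have "e' * (norm x)\<^sup>2 \<le> e"
    unfolding e'_def using e by (simp add: pos_divide_le_eq add_nonneg_pos)
  ultimately show "0 \<le> inner (op_poly G p x) x + e" by simp
qed

text \<open>By symmetry |p(G) x|^2 = (p^2(G) x, x), so positivity of c^2 - p^2 on [0, 1] is what is
  needed. This sup-norm bound is what allows passing from polynomials to continuous
  functions.\<close>

lemma op_poly_norm_le:
  assumes p: "\<And>y. 0 \<le> y \<Longrightarrow> y \<le> 1 \<Longrightarrow> \<bar>poly p y\<bar> \<le> c" and c: "0 \<le> c"
  shows "norm (op_poly G p x) \<le> c * norm x"
proof -
  have "0 \<le> inner (op_poly G ([:c\<^sup>2:] - p * p) x) x"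
    using p by (intro op_poly_nonneg) (simp add: abs_le_square_iff[symmetric] power2_eq_square[symmetric] c)
  then have "(norm (op_poly G p x))\<^sup>2 \<le> (c * norm x)\<^sup>2"
    by (simp add: op_poly_diff op_poly_mult op_poly_symmetric power2_norm_eq_inner inner_diff_left G.zero power_mult_distrib)
  then show ?thesis using c by (simp add: power2_le_iff_abs_le abs_le_iff)
qed

end

section \<open>Continuous functional calculus\<close>

text \<open>The limit is taken vector by vector along chosen polynomial approximants. It is
  meaningful for \<open>f\<close> continuous on [0, 1], where \<open>cfc_approx\<close> shows that
  the choice is immaterial.\<close>

definition continuous_calculus :: "('a::real_normed_vector \<Rightarrow> 'a) \<Rightarrow> (real \<Rightarrow> real) \<Rightarrow> 'a \<Rightarrow> 'a"
  where "continuous_calculus G f x =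
    lim (\<lambda>n. op_poly G (SOME p. \<forall>y\<in>{0..1}. \<bar>f y - poly p y\<bar> \<le> 1 / real (Suc n)) x)"

lemma polynomial_approximation:
  fixes f :: "real \<Rightarrow> real"
  assumes "continuous_on {0..1} f" "0 < e"
  shows "\<exists>p. \<forall>y\<in>{0..1}. \<bar>f y - poly p y\<bar> \<le> e"
proof -
  obtain g where g: "real_polynomial_function g" "\<And>y. y \<in> {0..1} \<Longrightarrow> \<bar>f y - g y\<bar> < e"
    using Stone_Weierstrass_real_polynomial_function[OF compact_Icc assms] by blast
  obtain a n where "g = (\<lambda>x. \<Sum>i\<le>n. a i * x ^ i)"
    using g(1) unfolding real_polynomial_function_iff_sum by blast
  then have "g y = poly (\<Sum>i\<le>n. monom (a i) i) y" for y
    by (simp add: poly_sum poly_monom)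
  then show ?thesis using g(2) by (intro exI[of _ "\<Sum>i\<le>n. monom (a i) i"]) (auto intro: less_imp_le)
qed

lemma continuous_on_unit_interval_bounded:
  fixes f :: "real \<Rightarrow> real"
  assumes "continuous_on {0..1} f"
  shows "\<exists>c. \<forall>y\<in>{0..1}. \<bar>f y\<bar> \<le> c"
  using compact_imp_bounded[OF compact_continuous_image[OF assms compact_Icc]]
  by (auto simp: bounded_iff)

context positive_contraction
begin

abbreviation "cfc \<equiv> continuous_calculus G"

text \<open>The difference of two polynomials close to \<open>f\<close> is uniformly small on
  [0, 1], hence so is the difference of their operators. All properties of the calculus are
  transferred from polynomials through this estimate.\<close>

lemma cfc_approx:
  assumes f: "continuous_on {0..1} f" and q: "\<And>y. y \<in> {0..1} \<Longrightarrow> \<bar>f y - poly q y\<bar> \<le> e"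
  shows "norm (cfc f x - op_poly G q x) \<le> e * norm x"
proof -
  define p where "p n = (SOME p. \<forall>y\<in>{0..1}. \<bar>f y - poly p y\<bar> \<le> 1 / real (Suc n))" for n
  have p: "\<bar>f y - poly (p n) y\<bar> \<le> 1 / real (Suc n)" if "y \<in> {0..1}" for n y
  proof -
    have "\<exists>p. \<forall>y\<in>{0..1}. \<bar>f y - poly p y\<bar> \<le> 1 / real (Suc n)"
      by (rule polynomial_approximation[OF f]) simp
    from someI_ex[OF this] show ?thesis unfolding p_def using that by blast
  qed
  have diff: "norm (op_poly G (p n) x - op_poly G r x) \<le> (1 / real (Suc n) + d) * norm x"
    if r: "\<And>y. y \<in> {0..1} \<Longrightarrow> \<bar>f y - poly r y\<bar> \<le> d" for n r d
  proof -
    have "\<bar>poly (p n - r) y\<bar> \<le> 1 / real (Suc n) + d" if "0 \<le> y" "y \<le> 1" for y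
      using p[of y n] r[of y] that by (simp add: abs_le_iff)
    moreover have "0 \<le> 1 / real (Suc n) + d" using r[of 0] by (simp add: order_trans[OF abs_ge_zero])
    ultimately show ?thesis using op_poly_norm_le[of "p n - r" _ x] by (simp add: op_poly_diff)
  qed
  have lim0: "(\<lambda>n. (1 / real (Suc n) + d) * norm x) \<longlonglongrightarrow> (0 + d) * norm x" for d
    using LIMSEQ_inverse_real_of_nat by (intro tendsto_intros) (simp add: inverse_eq_divide)
  have "Cauchy (\<lambda>n. op_poly G (p n) x)"
  proof (rule CauchyI)
    fix e :: real assume e: "e > 0"
    have "eventually (\<lambda>n. (1 / real (Suc n) + 0) * norm x < e / 2) sequentially"
      using lim0[of 0] e by (intro order_tendstoD(2)) auto
    then obtain N where N: "\<And>n. n \<ge> N \<Longrightarrow> 1 / real (Suc n) * norm x < e / 2"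
      by (auto simp: eventually_sequentially)
    have "norm (op_poly G (p m) x - op_poly G (p n) x) < e" if "m \<ge> N" "n \<ge> N" for m n
      using diff[OF p, of m n] N[OF that(1)] N[OF that(2)] unfolding distrib_right by linarith
    then show "\<exists>M. \<forall>m\<ge>M. \<forall>n\<ge>M. norm (op_poly G (p m) x - op_poly G (p n) x) < e" by blast
  qed
  then have "(\<lambda>n. op_poly G (p n) x) \<longlonglongrightarrow> cfc f x"
    unfolding continuous_calculus_def p_def[symmetric]
    by (simp add: Cauchy_convergent_iff convergent_LIMSEQ_iff)
  then have "(\<lambda>n. norm (op_poly G (p n) x - op_poly G q x)) \<longlonglongrightarrow> norm (cfc f x - op_poly G q x)"
    by (intro tendsto_intros)
  then have "norm (cfc f x - op_poly G q x) \<le> (0 + e) * norm x"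
    using diff[OF q] by (intro LIMSEQ_le[OF _ lim0]) auto
  then show ?thesis by simp
qed

lemma cfc_tendsto:
  assumes f: "continuous_on {0..1} f"
    and p: "\<And>n y. y \<in> {0..1} \<Longrightarrow> \<bar>f y - poly (p n) y\<bar> \<le> e n" and e: "e \<longlonglongrightarrow> 0"
  shows "(\<lambda>n. op_poly G (p n) x) \<longlonglongrightarrow> cfc f x"
proof -
  have "norm (cfc f x - op_poly G (p n) x) \<le> e n * norm x" for n
    using f p by (rule cfc_approx)
  then have "(\<lambda>n. cfc f x - op_poly G (p n) x) \<longlonglongrightarrow> 0"
    using tendsto_mult_left_zero[OF e, of "norm x"] by (rule Lim_null_comparison[OF always_eventually[OF allI]])
  from tendsto_diff[OF tendsto_const[of "cfc f x"] this] show ?thesis by simp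
qed

lemma cfc_approx_sequence:
  assumes "continuous_on {0..1} f"
  shows "\<exists>p. (\<forall>n. \<forall>y\<in>{0..1}. \<bar>f y - poly (p n) y\<bar> \<le> 1 / real (Suc n)) \<and>
    (\<forall>x. (\<lambda>n. op_poly G (p n) x) \<longlonglongrightarrow> cfc f x)"
proof -
  have "\<exists>p. \<forall>n. \<forall>y\<in>{0..1}. \<bar>f y - poly (p n) y\<bar> \<le> 1 / real (Suc n)"
    by (intro choice allI polynomial_approximation assms) auto
  then obtain p where p: "\<And>n y. y \<in> {0..1} \<Longrightarrow> \<bar>f y - poly (p n) y\<bar> \<le> 1 / real (Suc n)" by blast
  have "(\<lambda>n. 1 / real (Suc n)) \<longlonglongrightarrow> 0"
    using LIMSEQ_inverse_real_of_nat by (simp add: inverse_eq_divide)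
  from cfc_tendsto[OF assms p this] p show ?thesis by blast
qed

lemma cfc_poly: "cfc (poly p) x = op_poly G p x"
  using cfc_approx[of "poly p" p 0 x] by (simp add: continuous_intros)

lemma cfc_norm_le:
  assumes "continuous_on {0..1} f" "\<And>y. y \<in> {0..1} \<Longrightarrow> \<bar>f y\<bar> \<le> c"
  shows "norm (cfc f x) \<le> c * norm x"
  using cfc_approx[OF assms(1), of 0 c x] assms(2) by simp

text \<open>With \<open>J\<close> a complex scalar multiplication this later gives complex
  linearity; with \<open>J\<close> = \<open>G\<close> it moves \<open>G\<close> through the
  calculus.\<close>

lemma cfc_commute:
  assumes f: "continuous_on {0..1} f" and J: "bounded_linear J" "\<And>x. G (J x) = J (G x)"
  shows "cfc f (J x) = J (cfc f x)"
proof -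
  obtain p where p: "\<And>x. (\<lambda>n. op_poly G (p n) x) \<longlonglongrightarrow> cfc f x" using cfc_approx_sequence[OF f] by blast
  have "(\<lambda>n. J (op_poly G (p n) x)) \<longlonglongrightarrow> J (cfc f x)" by (rule bounded_linear.tendsto[OF J(1) p])
  moreover have "J (op_poly G (p n) x) = op_poly G (p n) (J x)" for n using op_poly_commute[OF J] by simp
  ultimately show ?thesis using p[of "J x"] by (simp add: LIMSEQ_unique)
qed

lemma cfc_symmetric:
  assumes f: "continuous_on {0..1} f"
  shows "inner (cfc f x) y = inner x (cfc f y)"
proof -
  obtain p where p: "\<And>x. (\<lambda>n. op_poly G (p n) x) \<longlonglongrightarrow> cfc f x" using cfc_approx_sequence[OF f] by blast
  have "(\<lambda>n. inner (op_poly G (p n) x) y) \<longlonglongrightarrow> inner (cfc f x) y"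
    "(\<lambda>n. inner (op_poly G (p n) x) y) \<longlonglongrightarrow> inner x (cfc f y)"
    using tendsto_inner[OF p tendsto_const] tendsto_inner[OF tendsto_const p] by (simp_all add: op_poly_symmetric)
  then show ?thesis by (rule LIMSEQ_unique)
qed

lemma cfc_bounded_linear:
  assumes f: "continuous_on {0..1} f"
  shows "bounded_linear (cfc f)"
proof -
  obtain p where p: "\<And>x. (\<lambda>n. op_poly G (p n) x) \<longlonglongrightarrow> cfc f x" using cfc_approx_sequence[OF f] by blast
  obtain c where c: "\<And>y. y \<in> {0..1} \<Longrightarrow> \<bar>f y\<bar> \<le> c"
    using continuous_on_unit_interval_bounded[OF f] by blast
  interpret P: bounded_linear "op_poly G (p n)" for n by (rule op_poly_linear)
  show ?thesis
  proof (rule bounded_linear_intro)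
    fix x y r
    show "cfc f (x + y) = cfc f x + cfc f y"
      using tendsto_add[OF p[of x] p[of y]] p[of "x + y"] by (simp add: P.add LIMSEQ_unique)
    show "cfc f (r *\<^sub>R x) = r *\<^sub>R cfc f x"
      using tendsto_scaleR[OF tendsto_const p[of x], of r] p[of "r *\<^sub>R x"] by (simp add: P.scaleR LIMSEQ_unique)
    show "norm (cfc f x) \<le> norm x * c"
      using cfc_norm_le[OF f c] by (simp add: mult.commute)
  qed
qed

lemma cfc_combine:
  assumes f: "continuous_on {0..1} f" and g: "continuous_on {0..1} g"
  shows "cfc (\<lambda>y. a * f y + b * g y) x = a *\<^sub>R cfc f x + b *\<^sub>R cfc g x"
proof -
  obtain p where p: "\<And>n y. y \<in> {0..1} \<Longrightarrow> \<bar>f y - poly (p n) y\<bar> \<le> 1 / real (Suc n)"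
    "\<And>x. (\<lambda>n. op_poly G (p n) x) \<longlonglongrightarrow> cfc f x" using cfc_approx_sequence[OF f] by blast
  obtain q where q: "\<And>n y. y \<in> {0..1} \<Longrightarrow> \<bar>g y - poly (q n) y\<bar> \<le> 1 / real (Suc n)"
    "\<And>x. (\<lambda>n. op_poly G (q n) x) \<longlonglongrightarrow> cfc g x" using cfc_approx_sequence[OF g] by blast
  have "(\<lambda>n. op_poly G (smult a (p n) + smult b (q n)) x) \<longlonglongrightarrow> cfc (\<lambda>y. a * f y + b * g y) x"
  proof (rule cfc_tendsto)
    show "continuous_on {0..1} (\<lambda>y. a * f y + b * g y)" by (intro continuous_intros f g)
    fix n y assume y: "y \<in> {0..1::real}"
    have "\<bar>a * f y + b * g y - poly (smult a (p n) + smult b (q n)) y\<bar>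
      = \<bar>a * (f y - poly (p n) y) + b * (g y - poly (q n) y)\<bar>" by (simp add: algebra_simps)
    also have "\<dots> \<le> \<bar>a\<bar> * (1 / real (Suc n)) + \<bar>b\<bar> * (1 / real (Suc n))"
      using p(1)[OF y, of n] q(1)[OF y, of n]
      by (intro order_trans[OF abs_triangle_ineq] add_mono) (auto simp only: abs_mult intro!: mult_left_mono)
    finally show "\<bar>a * f y + b * g y - poly (smult a (p n) + smult b (q n)) y\<bar>
      \<le> \<bar>a\<bar> * (1 / real (Suc n)) + \<bar>b\<bar> * (1 / real (Suc n))" .
  next
    have "(\<lambda>n. \<bar>a\<bar> * (1 / real (Suc n)) + \<bar>b\<bar> * (1 / real (Suc n))) \<longlonglongrightarrow> \<bar>a\<bar> * 0 + \<bar>b\<bar> * 0"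
      using LIMSEQ_inverse_real_of_nat by (intro tendsto_intros) (simp_all add: inverse_eq_divide)
    then show "(\<lambda>n. \<bar>a\<bar> * (1 / real (Suc n)) + \<bar>b\<bar> * (1 / real (Suc n))) \<longlonglongrightarrow> 0" by simp
  qed
  moreover have "(\<lambda>n. op_poly G (smult a (p n) + smult b (q n)) x) \<longlonglongrightarrow> a *\<^sub>R cfc f x + b *\<^sub>R cfc g x"
    unfolding op_poly_add op_poly_smult by (intro tendsto_intros p q)
  ultimately show ?thesis by (rule LIMSEQ_unique)
qed

lemma cfc_diff:
  assumes "continuous_on {0..1} f" "continuous_on {0..1} g"
  shows "cfc (\<lambda>y. f y - g y) x = cfc f x - cfc g x"
  using cfc_combine[OF assms, of 1 "-1" x] by simp

lemma cfc_cong: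
  assumes "continuous_on {0..1} f" "\<And>y. y \<in> {0..1} \<Longrightarrow> f y = g y"
  shows "cfc f x = cfc g x"
proof -
  have g: "continuous_on {0..1} g" using assms continuous_on_cong[of "{0..1}" "{0..1}" f g] by blast
  have "norm (cfc (\<lambda>y. f y - g y) x) \<le> 0 * norm x"
    using assms g by (intro cfc_norm_le continuous_intros) auto
  then show ?thesis by (simp add: cfc_diff[OF assms(1) g])
qed

text \<open>The factors are approximated one at a time: \<open>f\<close> while the other factor is a
  fixed polynomial, then \<open>g\<close> while the operator of \<open>f\<close> is a fixed bounded
  operator. In each stage the fixed factor is bounded on [0, 1].\<close>

lemma cfc_mult:
  assumes f: "continuous_on {0..1} f" and g: "continuous_on {0..1} g"
  shows "cfc (\<lambda>y. f y * g y) x = cfc f (cfc g x)"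
proof -
  interpret F: bounded_linear "cfc f" by (rule cfc_bounded_linear[OF f])
  obtain c where c: "\<And>y. y \<in> {0..1} \<Longrightarrow> \<bar>f y\<bar> \<le> c"
    using continuous_on_unit_interval_bounded[OF f] by blast
  have c0: "0 \<le> c" using order_trans[OF abs_ge_zero c[of 0]] by simp
  have inv0: "(\<lambda>n. 1 / real (Suc n)) \<longlonglongrightarrow> 0"
    using LIMSEQ_inverse_real_of_nat by (simp add: inverse_eq_divide)
  have poly: "cfc (\<lambda>y. f y * poly q y) x = cfc f (op_poly G q x)" for q
  proof -
    obtain p where p: "\<And>n y. y \<in> {0..1} \<Longrightarrow> \<bar>f y - poly (p n) y\<bar> \<le> 1 / real (Suc n)"
      "\<And>x. (\<lambda>n. op_poly G (p n) x) \<longlonglongrightarrow> cfc f x" using cfc_approx_sequence[OF f] by blast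
    have "continuous_on {0..1} (poly q)" by (intro continuous_intros)
    then obtain d where d: "\<And>y. y \<in> {0..1} \<Longrightarrow> \<bar>poly q y\<bar> \<le> d"
      using continuous_on_unit_interval_bounded by blast
    have "(\<lambda>n. op_poly G (p n * q) x) \<longlonglongrightarrow> cfc (\<lambda>y. f y * poly q y) x"
    proof (rule cfc_tendsto)
      show "continuous_on {0..1} (\<lambda>y. f y * poly q y)" by (intro continuous_intros f)
      show "(\<lambda>n. 1 / real (Suc n) * d) \<longlonglongrightarrow> 0" using tendsto_mult[OF inv0 tendsto_const[of d]] by simp
      fix n y assume y: "y \<in> {0..1::real}"
      have "\<bar>f y * poly q y - poly (p n * q) y\<bar> = \<bar>f y - poly (p n) y\<bar> * \<bar>poly q y\<bar>"
        by (simp add: left_diff_distrib flip: abs_mult)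
      also have "\<dots> \<le> 1 / real (Suc n) * d" using p(1)[OF y] d[OF y] by (intro mult_mono) auto
      finally show "\<bar>f y * poly q y - poly (p n * q) y\<bar> \<le> 1 / real (Suc n) * d" .
    qed
    moreover have "(\<lambda>n. op_poly G (p n * q) x) \<longlonglongrightarrow> cfc f (op_poly G q x)"
      unfolding op_poly_mult by (rule p)
    ultimately show ?thesis by (rule LIMSEQ_unique)
  qed
  obtain q where q: "\<And>n y. y \<in> {0..1} \<Longrightarrow> \<bar>g y - poly (q n) y\<bar> \<le> 1 / real (Suc n)"
    "\<And>x. (\<lambda>n. op_poly G (q n) x) \<longlonglongrightarrow> cfc g x" using cfc_approx_sequence[OF g] by blast
  have "(\<lambda>n. cfc (\<lambda>y. f y * poly (q n) y) x) \<longlonglongrightarrow> cfc f (cfc g x)"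
    unfolding poly by (rule F.tendsto[OF q(2)])
  moreover have "(\<lambda>n. cfc (\<lambda>y. f y * poly (q n) y) x) \<longlonglongrightarrow> cfc (\<lambda>y. f y * g y) x"
  proof -
    have "norm (cfc (\<lambda>y. f y * g y) x - cfc (\<lambda>y. f y * poly (q n) y) x) \<le> c * (1 / real (Suc n)) * norm x" for n
    proof -
      have "cfc (\<lambda>y. f y * g y) x - cfc (\<lambda>y. f y * poly (q n) y) x = cfc (\<lambda>y. f y * g y - f y * poly (q n) y) x"
        by (rule cfc_diff[symmetric]) (intro continuous_intros f g)+
      also have "norm \<dots> \<le> c * (1 / real (Suc n)) * norm x"
      proof (rule cfc_norm_le)
        show "continuous_on {0..1} (\<lambda>y. f y * g y - f y * poly (q n) y)" by (intro continuous_intros f g)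
        fix y assume y: "y \<in> {0..1::real}"
        have "\<bar>f y * g y - f y * poly (q n) y\<bar> = \<bar>f y\<bar> * \<bar>g y - poly (q n) y\<bar>"
          by (simp add: right_diff_distrib flip: abs_mult)
        also have "\<dots> \<le> c * (1 / real (Suc n))" using q(1)[OF y] c[OF y] c0 by (intro mult_mono) auto
        finally show "\<bar>f y * g y - f y * poly (q n) y\<bar> \<le> c * (1 / real (Suc n))" .
      qed
      finally show ?thesis .
    qed
    moreover have "(\<lambda>n. c * (1 / real (Suc n)) * norm x) \<longlonglongrightarrow> 0"
      using tendsto_mult_left_zero[OF tendsto_mult_right_zero[OF inv0]] .
    ultimately have "(\<lambda>n. cfc (\<lambda>y. f y * g y) x - cfc (\<lambda>y. f y * poly (q n) y) x) \<longlonglongrightarrow> 0"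
      by (rule Lim_null_comparison[OF always_eventually[OF allI]])
    from tendsto_diff[OF tendsto_const[of "cfc (\<lambda>y. f y * g y) x"] this] show ?thesis by simp
  qed
  ultimately show ?thesis using LIMSEQ_unique by blast
qed

lemma cfc_closed_subspace:
  assumes f: "continuous_on {0..1} f" and W: "subspace W" "closed W" "\<And>x. x \<in> W \<Longrightarrow> G x \<in> W" and x: "x \<in> W"
  shows "cfc f x \<in> W"
proof -
  obtain p where p: "\<And>x. (\<lambda>n. op_poly G (p n) x) \<longlonglongrightarrow> cfc f x" using cfc_approx_sequence[OF f] by blast
  have "op_poly G q x \<in> W" for q
    by (induction q) (auto simp: subspace_0[OF W(1)] intro!: subspace_add subspace_mul W x)
  then show ?thesis using closed_sequentially[OF W(2) _ p] by blast
qed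

end

section \<open>The semigroup generated by the inverse of a positive contraction\<close>

text \<open>Symbol of exp (- t / G). The value 0 at y = 0 is the limit from the right when t >
  0.\<close>

definition heat_symbol :: "real \<Rightarrow> real \<Rightarrow> real"
  where "heat_symbol t y = (if y \<le> 0 then 0 else exp (- (t / y)))"

text \<open>Minus the time derivative of \<open>heat_symbol\<close>, the symbol of exp (- t / G) /
  G.\<close>

definition heat_rate_symbol :: "real \<Rightarrow> real \<Rightarrow> real"
  where "heat_rate_symbol t y = (if y \<le> 0 then 0 else exp (- (t / y)) / y)"

lemma subspace_closure:
  fixes S :: "'a::real_normed_vector set"
  assumes S: "subspace S"
  shows "subspace (closure S)"
proof (rule subspaceI)
  show "0 \<in> closure S" using subspace_0[OF S] closure_subset by blast
next
  fix x y assume "x \<in> closure S" "y \<in> closure S"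
  then obtain X Y where X: "\<forall>n. X n \<in> S" "X \<longlonglongrightarrow> x" and Y: "\<forall>n. Y n \<in> S" "Y \<longlonglongrightarrow> y"
    unfolding closure_sequential by blast
  have "\<forall>n. X n + Y n \<in> S" using X(1) Y(1) subspace_add[OF S] by blast
  with tendsto_add[OF X(2) Y(2)] show "x + y \<in> closure S"
    unfolding closure_sequential by (intro exI[of _ "\<lambda>n. X n + Y n"]) auto
next
  fix c :: real and x assume "x \<in> closure S"
  then obtain X where X: "\<forall>n. X n \<in> S" "X \<longlonglongrightarrow> x" unfolding closure_sequential by blast
  have "\<forall>n. c *\<^sub>R X n \<in> S" using X(1) subspace_mul[OF S] by blast
  with tendsto_scaleR[OF tendsto_const X(2)] show "c *\<^sub>R x \<in> closure S"
    unfolding closure_sequential by (intro exI[of _ "\<lambda>n. c *\<^sub>R X n"]) auto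
qed

text \<open>With z proportional to t / y this produces a factor y^2, which absorbs the negative
  powers of y in the derivatives of the symbols.\<close>

lemma exp_minus_le_inverse_square:
  fixes z :: real
  assumes "0 < z"
  shows "exp (- z) \<le> 2 / z\<^sup>2"
proof -
  have "z\<^sup>2 / 2 \<le> exp z" using exp_lower_Taylor_quadratic[of z] assms by simp
  then show ?thesis using assms by (simp add: exp_minus field_simps)
qed

text \<open>Taylor remainders of first and second order for either sign of \<open>a\<close>, since
  time increments may be negative. They rest on 1 + a \<le> exp a, used for a and for - a.\<close>

lemma exp_minus_remainder_bounds:
  fixes a :: real
  shows "\<bar>exp (- a) - 1\<bar> \<le> \<bar>a\<bar> * exp \<bar>a\<bar>" "\<bar>exp (- a) - 1 + a\<bar> \<le> a\<^sup>2 * exp \<bar>a\<bar>"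
proof -
  have lower: "1 - a \<le> exp (- a)" using exp_ge_add_one_self[of "- a"] by simp
  have "(1 + a) * exp (- a) \<le> exp a * exp (- a)" by (intro mult_right_mono exp_ge_add_one_self) simp
  then have upper: "exp (- a) - 1 \<le> - a * exp (- a)" by (simp add: exp_minus algebra_simps)
  have e1: "1 \<le> exp \<bar>a\<bar>" by simp
  show 1: "\<bar>exp (- a) - 1\<bar> \<le> \<bar>a\<bar> * exp \<bar>a\<bar>"
  proof (cases "0 \<le> a")
    case True
    have "a * 1 \<le> a * exp a" using True by (intro mult_left_mono) auto
    then show ?thesis using True lower by (simp add: abs_if)
  next
    case False
    then show ?thesis using upper by (simp add: abs_if)
  qed
  have "exp (- a) - 1 + a \<le> a * (1 - exp (- a))" using upper by (simp add: algebra_simps)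
  also have "\<dots> \<le> \<bar>a\<bar> * \<bar>exp (- a) - 1\<bar>" by (metis abs_ge_self abs_minus_commute abs_mult)
  also have "\<dots> \<le> \<bar>a\<bar> * (\<bar>a\<bar> * exp \<bar>a\<bar>)" by (intro mult_left_mono 1) auto
  finally have "exp (- a) - 1 + a \<le> a\<^sup>2 * exp \<bar>a\<bar>" by (simp add: power2_eq_square flip: mult.assoc abs_mult)
  then show "\<bar>exp (- a) - 1 + a\<bar> \<le> a\<^sup>2 * exp \<bar>a\<bar>" using lower by simp
qed

text \<open>Only the point 0 needs an argument, and there the linear bound squeezes \<open>f\<close>
  to 0.\<close>

lemma continuous_on_unit_interval_linear_at_0:
  fixes f :: "real \<Rightarrow> real"
  assumes cont: "continuous_on {0<..} f" and bound: "\<And>y. 0 < y \<Longrightarrow> \<bar>f y\<bar> \<le> c * y" and "f 0 = 0"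
  shows "continuous_on {0..1} f"
  unfolding continuous_on_eq_continuous_within
proof
  fix y :: real assume y: "y \<in> {0..1}"
  show "continuous (at y within {0..1}) f"
  proof (cases "y = 0")
    case True
    have "((\<lambda>y. c * y) \<longlongrightarrow> c * 0) (at 0 within {0..1})" by (rule tendsto_mult[OF tendsto_const tendsto_ident_at])
    then have "((\<lambda>y. c * y) \<longlongrightarrow> 0) (at 0 within {0..1})" by simp
    moreover have "eventually (\<lambda>y. norm (f y) \<le> c * y) (at 0 within {0..1})"
      using bound by (auto simp: eventually_at intro!: exI[of _ 1])
    ultimately have "(f \<longlongrightarrow> 0) (at 0 within {0..1})" using Lim_null_comparison by blast
    then show ?thesis using True assms(3) by (simp add: continuous_within)
  next
    case False
    then have "isCont f y" using y cont by (simp add: continuous_on_eq_continuous_at)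
    then show ?thesis by (rule continuous_at_imp_continuous_at_within)
  qed
qed

lemma heat_symbol_continuous:
  assumes t: "0 < t"
  shows "continuous_on {0..1} (heat_symbol t)" "continuous_on {0..1} (heat_rate_symbol t)"
proof -
  have c: "continuous_on {0<..} (\<lambda>y::real. exp (- (t / y)))"
    "continuous_on {0<..} (\<lambda>y::real. exp (- (t / y)) / y)"
    by (auto intro!: continuous_intros)
  have b: "exp (- (t / y)) \<le> y / t" "exp (- (t / y)) / y \<le> (2 / t\<^sup>2) * y" if "0 < y" for y
  proof -
    have "t / y \<le> exp (t / y)" using exp_ge_add_one_self[of "t / y"] by linarith
    then show "exp (- (t / y)) \<le> y / t" using that t by (simp add: exp_minus field_simps)
    show "exp (- (t / y)) / y \<le> (2 / t\<^sup>2) * y"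
      using exp_minus_le_inverse_square[of "t / y"] that t by (simp add: field_simps power2_eq_square)
  qed
  show "continuous_on {0..1} (heat_symbol t)"
  proof (rule continuous_on_unit_interval_linear_at_0)
    show "continuous_on {0<..} (heat_symbol t)"
      using c(1) by (rule continuous_on_eq) (simp add: heat_symbol_def)
    show "\<bar>heat_symbol t y\<bar> \<le> (1 / t) * y" if "0 < y" for y
      using b(1)[OF that] that by (simp add: heat_symbol_def)
  qed (simp add: heat_symbol_def)
  show "continuous_on {0..1} (heat_rate_symbol t)"
  proof (rule continuous_on_unit_interval_linear_at_0)
    show "continuous_on {0<..} (heat_rate_symbol t)"
      using c(2) by (rule continuous_on_eq) (simp add: heat_rate_symbol_def)
    show "\<bar>heat_rate_symbol t y\<bar> \<le> (2 / t\<^sup>2) * y" if "0 < y" for y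
      using b(2)[OF that] that by (simp add: heat_rate_symbol_def)
  qed (simp add: heat_rate_symbol_def)
qed

text \<open>The bounds must be uniform in y although h / y is not. Keeping |h| within t / 2 leaves
  half of the exponent: exp (- t / y) exp (|h| / y) \<le> exp (- t / (2 y)) \<le> 8 y^2 / t^2, and
  this y^2 cancels the singular factors.\<close>

lemma heat_symbol_increments:
  assumes t: "0 < t" and h: "\<bar>h\<bar> \<le> t / 2"
  shows "\<bar>heat_symbol (t + h) y - heat_symbol t y + h * heat_rate_symbol t y\<bar> \<le> 8 * h\<^sup>2 / t\<^sup>2"
    and "\<bar>heat_rate_symbol (t + h) y - heat_rate_symbol t y\<bar> \<le> 8 * \<bar>h\<bar> / t\<^sup>2"
proof -
  have "\<bar>heat_symbol (t + h) y - heat_symbol t y + h * heat_rate_symbol t y\<bar> \<le> 8 * h\<^sup>2 / t\<^sup>2 \<and>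
    \<bar>heat_rate_symbol (t + h) y - heat_rate_symbol t y\<bar> \<le> 8 * \<bar>h\<bar> / t\<^sup>2"
  proof (cases "0 < y")
    case False
    then show ?thesis by (simp add: heat_symbol_def heat_rate_symbol_def)
  next
    case y: True
    define a where "a = h / y"
    define E where "E = exp (- (t / y))"
    have th: "exp (- ((t + h) / y)) = E * exp (- a)" unfolding E_def a_def
      by (simp add: add_divide_distrib flip: exp_add)
    have "E * exp \<bar>a\<bar> = exp (- ((t - \<bar>h\<bar>) / y))" unfolding E_def a_def
      using y by (simp add: diff_divide_distrib flip: exp_add)
    also have "\<dots> \<le> exp (- ((t / 2) / y))"
    proof -
      have "(t / 2) / y \<le> (t - \<bar>h\<bar>) / y" using y h by (intro divide_right_mono) auto
      then show ?thesis by (simp only: exp_le_cancel_iff neg_le_iff_le)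
    qed
    also have "\<dots> \<le> 2 / ((t / 2) / y)\<^sup>2" using y t by (intro exp_minus_le_inverse_square) simp
    also have "\<dots> = 8 / t\<^sup>2 * y\<^sup>2" by (simp add: power2_eq_square)
    finally have Ea: "E * exp \<bar>a\<bar> \<le> 8 / t\<^sup>2 * y\<^sup>2" .
    have E0: "0 \<le> E" unfolding E_def by simp
    have symb: "heat_symbol (t + h) y = E * exp (- a)" "heat_symbol t y = E"
      "heat_rate_symbol (t + h) y = E * exp (- a) / y" "heat_rate_symbol t y = E / y"
      unfolding heat_symbol_def heat_rate_symbol_def th E_def[symmetric] using y by auto
    have "heat_symbol (t + h) y - heat_symbol t y + h * heat_rate_symbol t y = E * (exp (- a) - 1 + a)"
      unfolding symb a_def by (simp add: algebra_simps)
    also have "\<bar>\<dots>\<bar> = E * \<bar>exp (- a) - 1 + a\<bar>" using E0 by (simp add: abs_mult)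
    also have "\<dots> \<le> E * (a\<^sup>2 * exp \<bar>a\<bar>)" using E0 by (intro mult_left_mono exp_minus_remainder_bounds)
    also have "\<dots> = (E * exp \<bar>a\<bar>) * a\<^sup>2" by simp
    also have "\<dots> \<le> (8 / t\<^sup>2 * y\<^sup>2) * a\<^sup>2" by (intro mult_right_mono Ea) simp
    also have "\<dots> = 8 * h\<^sup>2 / t\<^sup>2" unfolding a_def using y by (simp add: power_divide)
    finally have 1: "\<bar>heat_symbol (t + h) y - heat_symbol t y + h * heat_rate_symbol t y\<bar> \<le> 8 * h\<^sup>2 / t\<^sup>2" .
    have "heat_rate_symbol (t + h) y - heat_rate_symbol t y = E * (exp (- a) - 1) / y"
      unfolding symb by (simp add: diff_divide_distrib algebra_simps)
    also have "\<bar>\<dots>\<bar> = E * \<bar>exp (- a) - 1\<bar> / y" using E0 y by (simp add: abs_mult)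
    also have "\<dots> \<le> E * (\<bar>a\<bar> * exp \<bar>a\<bar>) / y"
      using E0 y by (intro divide_right_mono mult_left_mono exp_minus_remainder_bounds) auto
    also have "\<dots> = (E * exp \<bar>a\<bar>) * (\<bar>a\<bar> / y)" by simp
    also have "\<dots> \<le> (8 / t\<^sup>2 * y\<^sup>2) * (\<bar>a\<bar> / y)" using y by (intro mult_right_mono Ea) auto
    also have "\<dots> = 8 * \<bar>h\<bar> / t\<^sup>2" unfolding a_def using y by (simp add: power2_eq_square)
    finally show ?thesis using 1 by blast
  qed
  then show "\<bar>heat_symbol (t + h) y - heat_symbol t y + h * heat_rate_symbol t y\<bar> \<le> 8 * h\<^sup>2 / t\<^sup>2"
    and "\<bar>heat_rate_symbol (t + h) y - heat_rate_symbol t y\<bar> \<le> 8 * \<bar>h\<bar> / t\<^sup>2" by blast+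
qed

section \<open>The semigroup: smoothing, strong continuity and contraction\<close>

context positive_contraction
begin

text \<open>At t = 0 the symbol jumps at y = 0 and lies outside the continuous calculus, so the
  identity is put in by hand; negative times are set to the identity as well.\<close>

definition heat :: "real \<Rightarrow> 'a \<Rightarrow> 'a"
  where "heat t x = (if t \<le> 0 then x else cfc (heat_symbol t) x)"

definition heat_rate :: "real \<Rightarrow> 'a \<Rightarrow> 'a"
  where "heat_rate t x = cfc (heat_rate_symbol t) x"

lemma heat_0 [simp]: "heat 0 x = x"
  by (simp add: heat_def)

lemma heat_add:
  assumes "0 \<le> s" "0 \<le> t"
  shows "heat (s + t) x = heat s (heat t x)"
proof (cases "s = 0 \<or> t = 0")
  case False
  then have pos: "0 < s" "0 < t" using assms by auto
  have "cfc (heat_symbol (s + t)) x = cfc (\<lambda>y. heat_symbol s y * heat_symbol t y) x"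
    using pos by (intro cfc_cong heat_symbol_continuous) (auto simp: heat_symbol_def add_divide_distrib simp flip: exp_add)
  also have "\<dots> = cfc (heat_symbol s) (cfc (heat_symbol t) x)"
    using pos by (intro cfc_mult heat_symbol_continuous)
  finally show ?thesis using pos by (simp add: heat_def)
qed auto

lemma heat_bounded_linear: "bounded_linear (heat t)"
proof (cases "t \<le> 0")
  case True
  then have "heat t = (\<lambda>x. x)" by (auto simp: heat_def)
  then show ?thesis by (simp add: bounded_linear_ident)
next
  case False
  then have "heat t = cfc (heat_symbol t)" by (auto simp: heat_def)
  then show ?thesis using False by (simp add: cfc_bounded_linear heat_symbol_continuous)
qed

lemma heat_norm_le: "norm (heat t x) \<le> norm x"
proof (cases "t \<le> 0")
  case False
  then have "norm (cfc (heat_symbol t) x) \<le> 1 * norm x"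
    by (intro cfc_norm_le heat_symbol_continuous) (auto simp: heat_symbol_def)
  then show ?thesis using False by (simp add: heat_def)
qed (simp add: heat_def)

lemma heat_commute:
  assumes "bounded_linear J" "\<And>x. G (J x) = J (G x)"
  shows "heat t (J x) = J (heat t x)"
  using assms by (simp add: heat_def cfc_commute heat_symbol_continuous)

lemma heat_closed_subspace:
  assumes "subspace W" "closed W" "\<And>x. x \<in> W \<Longrightarrow> G x \<in> W" "x \<in> W"
  shows "heat t x \<in> W"
  using assms by (simp add: heat_def cfc_closed_subspace heat_symbol_continuous)

lemma heat_rate_closed_subspace:
  assumes "subspace W" "closed W" "\<And>x. x \<in> W \<Longrightarrow> G x \<in> W" "x \<in> W" "0 < t"
  shows "heat_rate t x \<in> W"
  using assms by (simp add: heat_rate_def cfc_closed_subspace heat_symbol_continuous)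

lemma G_eq_cfc: "G x = cfc (\<lambda>y. y) x"
proof -
  have "poly [:0, 1:] = (\<lambda>y::real. y)" by auto
  then show ?thesis using cfc_poly[of "[:0, 1:]" x] by (simp add: G.zero)
qed

lemma G_heat_rate:
  assumes "0 < t"
  shows "G (heat_rate t x) = heat t x"
proof -
  have "G (heat_rate t x) = cfc (\<lambda>y. y * heat_rate_symbol t y) x"
    unfolding heat_rate_def G_eq_cfc[of "cfc _ x"]
    by (rule cfc_mult[OF continuous_on_id heat_symbol_continuous(2)[OF assms], symmetric])
  also have "\<dots> = cfc (heat_symbol t) x"
  proof (rule cfc_cong)
    show "continuous_on {0..1} (\<lambda>y. y * heat_rate_symbol t y)"
      by (intro continuous_intros heat_symbol_continuous assms)
  qed (auto simp: heat_rate_symbol_def heat_symbol_def)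
  finally show ?thesis using assms by (simp add: heat_def)
qed

text \<open>The second-order remainder of the symbol is uniform in y, so the calculus turns it into
  a norm estimate. Thus the orbit is differentiable for t > 0 for every initial vector, with no
  domain condition.\<close>

lemma heat_has_vector_derivative:
  assumes t: "0 < t"
  shows "((\<lambda>t. heat t x) has_vector_derivative - heat_rate t x) (at t)"
  unfolding has_vector_derivative_def has_derivative_at
proof
  show "bounded_linear (\<lambda>h. h *\<^sub>R - heat_rate t x)" by (rule bounded_linear_scaleR_left)
  have bound: "norm (heat (t + h) x - heat t x - h *\<^sub>R - heat_rate t x) / norm h \<le> (8 / t\<^sup>2 * norm x) * \<bar>h\<bar>"
    if h: "\<bar>h\<bar> < t / 2" "h \<noteq> 0" for h
  proof -
    have th: "0 < t + h" using h by (simp add: abs_less_iff)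
    note c = heat_symbol_continuous[OF th] heat_symbol_continuous[OF t]
    have "heat (t + h) x - heat t x - h *\<^sub>R - heat_rate t x
      = cfc (\<lambda>y. heat_symbol (t + h) y - heat_symbol t y) x + h *\<^sub>R cfc (heat_rate_symbol t) x"
      using t th c by (simp add: heat_def heat_rate_def cfc_diff)
    also have "\<dots> = cfc (\<lambda>y. 1 * (heat_symbol (t + h) y - heat_symbol t y) + h * heat_rate_symbol t y) x"
      using c by (subst cfc_combine) (auto intro!: continuous_intros)
    also have "norm \<dots> \<le> (8 * h\<^sup>2 / t\<^sup>2) * norm x"
      using h heat_symbol_increments(1)[OF t, of h] by (intro cfc_norm_le continuous_intros c) auto
    finally show ?thesis using h by (simp add: field_simps power2_eq_square)
  qed
  have "eventually (\<lambda>h. norm (norm (heat (t + h) x - heat t x - h *\<^sub>R - heat_rate t x) / norm h) \<le> (8 / t\<^sup>2 * norm x) * \<bar>h\<bar>) (at 0)"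
    unfolding eventually_at using bound t by (intro exI[of _ "t / 2"]) (auto simp: dist_norm)
  then show "(\<lambda>h. norm (heat (t + h) x - heat t x - h *\<^sub>R - heat_rate t x) / norm h) \<midarrow>0\<rightarrow> 0"
    by (rule Lim_null_comparison) (use t in \<open>auto intro!: tendsto_eq_intros\<close>)
qed

lemma heat_rate_isCont:
  assumes t: "0 < t"
  shows "isCont (\<lambda>t. heat_rate t x) t"
proof -
  have bound: "norm (heat_rate (t + h) x - heat_rate t x) \<le> (8 / t\<^sup>2 * norm x) * \<bar>h\<bar>"
    if h: "\<bar>h\<bar> < t / 2" for h
  proof -
    have th: "0 < t + h" using h by (simp add: abs_less_iff)
    note c = heat_symbol_continuous[OF th] heat_symbol_continuous[OF t]
    have "heat_rate (t + h) x - heat_rate t x = cfc (\<lambda>y. heat_rate_symbol (t + h) y - heat_rate_symbol t y) x"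
      using c by (simp add: heat_rate_def cfc_diff)
    also have "norm \<dots> \<le> (8 * \<bar>h\<bar> / t\<^sup>2) * norm x"
      using h heat_symbol_increments(2)[OF t, of h] by (intro cfc_norm_le continuous_intros c) auto
    finally show ?thesis by (simp add: mult_ac)
  qed
  have "eventually (\<lambda>h. norm (heat_rate (t + h) x - heat_rate t x) \<le> (8 / t\<^sup>2 * norm x) * \<bar>h\<bar>) (at 0)"
    unfolding eventually_at using bound t by (intro exI[of _ "t / 2"]) (auto simp: dist_norm)
  then have "(\<lambda>h. heat_rate (t + h) x - heat_rate t x) \<midarrow>0\<rightarrow> 0"
    by (rule Lim_null_comparison) (use t in \<open>auto intro!: tendsto_eq_intros\<close>)
  then show ?thesis unfolding isCont_iff using LIM_zero_iff by blast
qed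

text \<open>Let w be the projection of x onto the closed range. By symmetry |G (x - w)|^2 = (x - w,
  G (G (x - w))) = 0, so x - w lies in the kernel and the hypothesis makes it orthogonal to
  x.\<close>

lemma closure_range_G_I:
  assumes x: "\<And>z. G z = 0 \<Longrightarrow> inner x z = 0"
  shows "x \<in> closure (range G)"
proof -
  have S: "subspace (closure (range G))"
    by (intro subspace_closure linear_subspace_image G.linear_axioms subspace_UNIV)
  obtain w where w: "w \<in> closure (range G)" "\<And>v. v \<in> closure (range G) \<Longrightarrow> inner w v = inner x v"
    using riesz_subspace[OF bounded_linear_inner_right S closed_closure, of x] by blast
  have orth: "inner (x - w) v = 0" if "v \<in> closure (range G)" for v
    using w(2)[OF that] by (simp add: inner_diff_left)
  have "inner (G (x - w)) (G (x - w)) = 0"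
  proof -
    have "G (G (x - w)) \<in> closure (range G)" by (intro subsetD[OF closure_subset] rangeI)
    then show ?thesis unfolding symmetric[of "x - w"] by (rule orth)
  qed
  then have "inner x (x - w) = 0" by (intro x) (simp only: inner_eq_zero_iff)
  moreover have "inner w (x - w) = 0" using orth[OF w(1)] by (simp add: inner_commute)
  ultimately have "inner (x - w) (x - w) = 0" by (simp add: inner_diff_left)
  then show ?thesis using w(1) by simp
qed

text \<open>On vectors G z the symbol error is y |exp (- t / y) - 1| \<le> t, uniformly in y;
  contractivity extends the convergence to the closure of the range. On the kernel of
  \<open>G\<close> it would fail, because the symbol vanishes at 0.\<close>

lemma heat_near_0:
  assumes x: "x \<in> closure (range G)" and e: "0 < e"
  shows "\<exists>d>0. \<forall>t. 0 \<le> t \<and> t < d \<longrightarrow> norm (heat t x - x) < e"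
proof -
  obtain z where z: "dist (G z) x < e / 3"
    using x e unfolding closure_approachable by (metis divide_pos_pos rangeE zero_less_numeral)
  have lin: "norm (heat t (G z) - G z) \<le> t * norm z" if t: "0 < t" for t
  proof -
    note c = heat_symbol_continuous(1)[OF t]
    have "heat t (G z) - G z = cfc (\<lambda>y. heat_symbol t y * y - y) z"
      using t c by (simp add: heat_def G_eq_cfc cfc_diff cfc_mult continuous_intros)
    also have "norm \<dots> \<le> t * norm z"
    proof (rule cfc_norm_le)
      show "continuous_on {0..1} (\<lambda>y. heat_symbol t y * y - y)" by (intro continuous_intros c)
      fix y :: real assume "y \<in> {0..1}"
      then consider "y = 0" | "0 < y" by force
      then show "\<bar>heat_symbol t y * y - y\<bar> \<le> t"
      proof cases
        case 2
        have "1 - t / y \<le> exp (- (t / y))" using exp_ge_add_one_self[of "- (t / y)"] by simp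
        then have "y - t \<le> exp (- (t / y)) * y" using 2 by (simp add: field_simps)
        moreover have "exp (- (t / y)) * y \<le> 1 * y" using 2 t by (intro mult_right_mono) auto
        ultimately show ?thesis using 2 by (simp add: heat_symbol_def abs_le_iff)
      qed (use t in simp)
    qed
    finally show ?thesis .
  qed
  define d where "d = e / (3 * (norm z + 1))"
  have d: "0 < d" unfolding d_def using e by (simp add: add_nonneg_pos)
  have "norm (heat t x - x) < e" if t: "0 \<le> t" "t < d" for t
  proof (cases "t = 0")
    case False
    interpret H: bounded_linear "heat t" by (rule heat_bounded_linear)
    have "norm (heat t x - x) = norm (heat t (x - G z) + (heat t (G z) - G z) + (G z - x))"
      by (simp add: H.diff)
    also have "\<dots> \<le> norm (heat t (x - G z)) + norm (heat t (G z) - G z) + norm (G z - x)"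
      by (meson add_mono norm_triangle_ineq order_refl order_trans)
    also have "\<dots> < e / 3 + e / 3 + e / 3"
    proof -
      have "norm (heat t (x - G z)) < e / 3" using heat_norm_le[of t "x - G z"] z
        by (simp add: dist_norm norm_minus_commute)
      moreover have "norm (heat t (G z) - G z) \<le> e / 3"
      proof -
        have "norm (heat t (G z) - G z) \<le> t * norm z" using False t by (intro lin) simp
        also have "\<dots> \<le> d * (norm z + 1)" using t by (intro mult_mono) auto
        also have "\<dots> = e / 3" unfolding d_def by (simp add: add_nonneg_pos nonzero_divide_eq_eq less_imp_neq[symmetric])
        finally show ?thesis .
      qed
      ultimately show ?thesis using z by (simp add: dist_norm)
    qed
    finally show ?thesis by simp
  qed (use e in simp)
  then show ?thesis using d by blast
qed

text \<open>The semigroup law and contractivity reduce continuity at any time, from both sides, to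
  continuity at 0 with the same radius.\<close>

lemma heat_continuous:
  assumes x: "x \<in> closure (range G)"
  shows "continuous_on {0..} (\<lambda>t. heat t x)"
  unfolding continuous_on_iff
proof (intro ballI allI impI)
  fix t e :: real assume t: "t \<in> {0..}" and e: "0 < e"
  obtain d where d: "0 < d" "\<And>t. 0 \<le> t \<Longrightarrow> t < d \<Longrightarrow> norm (heat t x - x) < e"
    using heat_near_0[OF x e] by blast
  have step: "norm (heat v x - heat u x) < e" if "0 \<le> u" "u \<le> v" "v - u < d" for u v
  proof -
    interpret H: bounded_linear "heat u" by (rule heat_bounded_linear)
    have "heat v x - heat u x = heat u (heat (v - u) x - x)"
      using heat_add[of u "v - u" x] that by (simp add: H.diff)
    then show ?thesis using heat_norm_le[of u "heat (v - u) x - x"] d(2)[of "v - u"] that by simp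
  qed
  have "dist (heat s x) (heat t x) < e" if "s \<in> {0..}" "dist s t < d" for s
    using step[of s t] step[of t s] t that
    by (cases "s \<le> t") (auto simp: dist_norm norm_minus_commute)
  then show "\<exists>d>0. \<forall>x'\<in>{0..}. dist x' t < d \<longrightarrow> dist (heat x' x) (heat t x) < e"
    using d(1) by blast
qed

text \<open>With f the symbol and g = sqrt (1 - f^2), the calculus gives x - f(G)^2 x = g(G)^2 x.
  The difference of the two sides is therefore (G g(G) x, g(G) x), which is nonnegative. On W this
  quadratic form is a multiple of the squared norm of H.\<close>

lemma heat_G_contraction:
  assumes t: "0 \<le> t"
  shows "inner (G (heat t x)) (heat t x) \<le> inner (G x) x"
proof (cases "t = 0")
  case False
  then have t: "0 < t" using t by simp
  define f where "f = heat_symbol t"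
  define g where "g y = sqrt (1 - f y * f y)" for y
  have f: "continuous_on {0..1} f" unfolding f_def by (rule heat_symbol_continuous[OF t])
  have f01: "0 \<le> f y" "f y \<le> 1" if "y \<in> {0..1}" for y
    unfolding f_def heat_symbol_def using that t by auto
  have g: "continuous_on {0..1} g" unfolding g_def by (intro continuous_intros f)
  have "x - cfc f (cfc f x) = cfc (poly 1) x - cfc (\<lambda>y. f y * f y) x"
    by (simp only: cfc_poly op_poly_1 cfc_mult[OF f f])
  also have "\<dots> = cfc (\<lambda>y. poly 1 y - f y * f y) x"
    by (intro cfc_diff[symmetric] continuous_intros f)
  also have "\<dots> = cfc (\<lambda>y. g y * g y) x"
    using f01 by (intro cfc_cong continuous_intros f) (simp add: g_def mult_le_one)
  also have "\<dots> = cfc g (cfc g x)" by (rule cfc_mult[OF g g])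
  finally have eq: "x - cfc f (cfc f x) = cfc g (cfc g x)" .
  have comm: "cfc h (G x) = G (cfc h x)" if "continuous_on {0..1} h" for h x
    using cfc_commute[OF that bounded] by simp
  have "inner (G (cfc f x)) (cfc f x) = inner (G x) (cfc f (cfc f x))"
    by (simp add: comm[OF f, symmetric] cfc_symmetric[OF f])
  moreover have "0 \<le> inner (G (cfc g x)) (cfc g x)" by (rule nonneg)
  moreover have "inner (G (cfc g x)) (cfc g x) = inner (G x) (x - cfc f (cfc f x))"
    by (simp add: comm[OF g, symmetric] cfc_symmetric[OF g] eq)
  ultimately show ?thesis using t by (simp add: heat_def f_def inner_diff_right)
qed simp

end

section \<open>Linear evolution equations with bounded operators\<close>

lemma integral_has_vector_derivative_atLeast:
  fixes g :: "real \<Rightarrow> 'a::banach"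
  assumes g: "continuous_on UNIV g" and t: "s \<le> t"
  shows "((\<lambda>t. integral {s..t} g) has_vector_derivative g t) (at t within {s..})"
proof -
  have "((\<lambda>t. integral {s..t} g) has_vector_derivative g t) (at t within {s..t + 1})"
    using t by (intro integral_has_vector_derivative continuous_on_subset[OF g]) auto
  moreover have "at t within {s..t + 1} = at t within {s..}"
    by (rule at_within_nhd[where S = "{..<t + 1}"]) auto
  ultimately show ?thesis by simp
qed

text \<open>Integrating K exp (2 K (t - s)) gives half of the exponential, minus a constant. The
  weight 2 K thus turns the integral operator into one of norm at most 1/2 on an interval of any
  length.\<close>

lemma integral_exponential_weight_bound:
  fixes g :: "real \<Rightarrow> 'a::banach"
  assumes g: "continuous_on UNIV g" and K: "0 < K" and s: "s \<le> r"
    and bound: "\<And>t. norm (g t) \<le> K * (exp (2 * K * (t - s)) * d)" and d: "0 \<le> d"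
  shows "exp (- (2 * K * (r - s))) * norm (integral {s..r} g) \<le> d / 2"
proof -
  have I: "((\<lambda>t. K * (exp (2 * K * (t - s)) * d)) has_integral
    exp (2 * K * (r - s)) * d / 2 - exp (2 * K * (s - s)) * d / 2) {s..r}"
    using s K by (intro fundamental_theorem_of_calculus)
      (auto intro!: derivative_eq_intros simp: has_real_derivative_iff_has_vector_derivative[symmetric])
  have "norm (integral {s..r} g) \<le> integral {s..r} (\<lambda>t. K * (exp (2 * K * (t - s)) * d))"
  proof (rule integral_norm_bound_integral)
    show "g integrable_on {s..r}"
      by (intro integrable_continuous_interval continuous_on_subset[OF g]) auto
  qed (use bound I in \<open>auto simp: integrable_on_def\<close>)
  also have "\<dots> = exp (2 * K * (r - s)) * d / 2 - d / 2" using integral_unique[OF I] by simp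
  also have "\<dots> \<le> exp (2 * K * (r - s)) * (d / 2)" using d by simp
  finally have "exp (- (2 * K * (r - s))) * norm (integral {s..r} g)
    \<le> exp (- (2 * K * (r - s))) * (exp (2 * K * (r - s)) * (d / 2))" by (intro mult_left_mono) auto
  also have "\<dots> = d / 2" by (simp add: exp_minus)
  finally show ?thesis .
qed

locale linear_ode =
  fixes L :: "real \<Rightarrow> 'a::{real_inner, banach} \<Rightarrow> 'a" and K :: real
  assumes L_linear: "bounded_linear (L t)"
    and L_bound: "norm (L t x) \<le> K * norm x"
    and L_continuous: "continuous_on UNIV (\<lambda>t. L t x)"
    and K_pos: "0 < K"
begin

sublocale L: bounded_linear "L t" for t by (rule L_linear)

definition is_solution :: "real \<Rightarrow> 'a \<Rightarrow> (real \<Rightarrow> 'a) \<Rightarrow> bool"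
  where "is_solution s x u \<longleftrightarrow> u s = x \<and>
    (\<forall>t\<ge>s. (u has_vector_derivative L t (u t)) (at t within {s..}))"

text \<open>Strong continuity of \<open>L\<close> suffices here: the bound \<open>K\<close> is
  uniform in time and controls the change of the argument.\<close>

lemma continuous_on_L_apply:
  assumes u: "continuous_on S u"
  shows "continuous_on S (\<lambda>t. L t (u t))"
  unfolding continuous_on_def
proof
  fix t assume t: "t \<in> S"
  have "((\<lambda>r. L r (u t)) \<longlongrightarrow> L t (u t)) (at t within S)"
    using continuous_on_subset[OF L_continuous subset_UNIV] t by (auto simp: continuous_on_def)
  moreover have "((\<lambda>r. L r (u r - u t)) \<longlongrightarrow> 0) (at t within S)"
  proof (rule Lim_null_comparison)
    show "eventually (\<lambda>r. norm (L r (u r - u t)) \<le> K * norm (u r - u t)) (at t within S)"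
      using L_bound by simp
    have "((\<lambda>r. K * norm (u r - u t)) \<longlongrightarrow> K * norm (u t - u t)) (at t within S)"
      using u t by (intro tendsto_intros) (auto simp: continuous_on_def)
    then show "((\<lambda>r. K * norm (u r - u t)) \<longlongrightarrow> 0) (at t within S)" by simp
  qed
  ultimately have "((\<lambda>r. L r (u t) + L r (u r - u t)) \<longlongrightarrow> L t (u t) + 0) (at t within S)"
    by (rule tendsto_add)
  then show "((\<lambda>r. L r (u r)) \<longlongrightarrow> L t (u t)) (at t within S)" by (simp flip: L.add)
qed

lemma solution_derivative:
  assumes "is_solution s x u" "s < t"
  shows "(u has_vector_derivative L t (u t)) (at t)"
proof -
  have "(u has_vector_derivative L t (u t)) (at t within {s..})"
    using assms unfolding is_solution_def by simp
  moreover have "at t within {s..} = at t"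
    using assms(2) by (intro at_within_interior) simp
  ultimately show ?thesis by simp
qed

lemma solution_exists: "\<exists>u. is_solution s x u"
proof -
  \<comment> \<open>The exponential weight makes the Picard map \<open>\<Phi>\<close> contractive on the whole half-line.\<close>
  define w where "w t = exp (2 * K * (t - s))" for t
  define g where "g y t = L t (w t *\<^sub>R y t)" for y t
  define \<Phi> where "\<Phi> y t = exp (- (2 * K * (max s t - s))) *\<^sub>R (x + integral {s..max s t} (g y))" for y t
  have w: "continuous_on UNIV w" unfolding w_def by (intro continuous_intros)
  have g: "continuous_on UNIV (g y)" if "continuous_on UNIV y" for y
    unfolding g_def using that w by (intro continuous_on_L_apply continuous_intros)
  have g_bound: "norm (g y t) \<le> K * (exp (2 * K * (t - s)) * d)" if "norm (y t) \<le> d" for y t d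
  proof -
    have "norm (g y t) \<le> K * norm (w t *\<^sub>R y t)" unfolding g_def by (rule L_bound)
    also have "\<dots> \<le> K * (exp (2 * K * (t - s)) * d)" unfolding w_def using that K_pos
      by (intro mult_left_mono) auto
    finally show ?thesis .
  qed
  have int_cont: "continuous_on {s..} (\<lambda>t. integral {s..t} (g y))" if "continuous_on UNIV y" for y
    using has_vector_derivative_continuous[OF integral_has_vector_derivative_atLeast[OF g[OF that]]]
    by (auto simp: continuous_on_eq_continuous_within)
  have \<Phi>_cont: "continuous_on UNIV (\<Phi> y)" if y: "continuous_on UNIV y" for y
  proof -
    have "continuous_on UNIV (\<lambda>t. integral {s..max s t} (g y))"
      by (rule continuous_on_compose2[OF int_cont[OF y]]) (auto intro!: continuous_intros)
    then show ?thesis unfolding \<Phi>_def by (intro continuous_intros)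
  qed
  have \<Phi>_bdd: "\<Phi> y \<in> bcontfun" if "y \<in> bcontfun" for y
  proof -
    have y: "continuous_on UNIV y" and "bounded (range y)" using that unfolding bcontfun_def by auto
    then obtain d where d: "\<And>t. norm (y t) \<le> d" unfolding bounded_iff by blast
    have d0: "0 \<le> d" using d[of 0] norm_ge_zero order_trans by blast
    have "norm (\<Phi> y t) \<le> norm x + d / 2" for t
    proof -
      have "norm (\<Phi> y t) \<le> exp (- (2 * K * (max s t - s))) * (norm x + norm (integral {s..max s t} (g y)))"
        unfolding \<Phi>_def by (simp add: mult_left_mono norm_triangle_ineq)
      also have "\<dots> = exp (- (2 * K * (max s t - s))) * norm x + exp (- (2 * K * (max s t - s))) * norm (integral {s..max s t} (g y))"
        by (rule distrib_left)
      also have "\<dots> \<le> 1 * norm x + d / 2"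
        using K_pos d0 g_bound[OF d]
        by (intro add_mono mult_right_mono integral_exponential_weight_bound g y) auto
      finally show ?thesis by simp
    qed
    then show ?thesis using \<Phi>_cont[OF y] by (intro bcontfun_normI)
  qed
  \<comment> \<open>The fixed point is sought in the complete space of bounded continuous functions
    on the whole line; \<open>max s t\<close> continues the image constantly to the left of
    s.\<close>
  define F where "F Y = Bcontfun (\<Phi> (apply_bcontfun Y))" for Y :: "real \<Rightarrow>\<^sub>C 'a"
  have F: "apply_bcontfun (F Y) = \<Phi> (apply_bcontfun Y)" for Y
    unfolding F_def by (intro Bcontfun_inverse \<Phi>_bdd apply_bcontfun)
  have "dist (F Y) (F Z) \<le> 1 / 2 * dist Y Z" for Y Z
  proof (rule dist_bound)
    fix t
    let ?y = "apply_bcontfun Y" and ?z = "apply_bcontfun Z"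
    have y: "continuous_on UNIV ?y" and z: "continuous_on UNIV ?z" by simp_all
    have int: "g y integrable_on {s..max s t}" if "continuous_on UNIV y" for y
      by (intro integrable_continuous_interval continuous_on_subset[OF g[OF that]] subset_UNIV)
    have "g (\<lambda>t. ?y t - ?z t) = (\<lambda>t. g ?y t - g ?z t)"
      unfolding g_def by (simp add: scaleR_diff_right L.diff)
    then have eq: "\<Phi> ?y t - \<Phi> ?z t
      = exp (- (2 * K * (max s t - s))) *\<^sub>R integral {s..max s t} (g (\<lambda>t. ?y t - ?z t))"
      unfolding \<Phi>_def using int[OF y] int[OF z]
      by (simp add: Henstock_Kurzweil_Integration.integral_diff scaleR_diff_right[symmetric])
    have "dist (\<Phi> ?y t) (\<Phi> ?z t)
      = exp (- (2 * K * (max s t - s))) * norm (integral {s..max s t} (g (\<lambda>t. ?y t - ?z t)))"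
      unfolding dist_norm eq by simp
    also have "\<dots> \<le> dist Y Z / 2"
    proof (rule integral_exponential_weight_bound)
      show "continuous_on UNIV (g (\<lambda>t. ?y t - ?z t))" by (intro g continuous_intros y z)
      show "norm (g (\<lambda>t. ?y t - ?z t) r) \<le> K * (exp (2 * K * (r - s)) * dist Y Z)" for r
        using dist_bounded[of Y r Z] by (intro g_bound) (simp add: dist_norm)
    qed (use K_pos in auto)
    finally show "dist (apply_bcontfun (F Y) t) (apply_bcontfun (F Z) t) \<le> 1 / 2 * dist Y Z"
      by (simp add: F)
  qed
  then have "\<exists>!Y. F Y = Y" by (intro banach_fix_type[of "1 / 2"]) auto
  then obtain Y where Y: "F Y = Y" by blast
  define y where "y = apply_bcontfun Y"
  have y: "continuous_on UNIV y" unfolding y_def by simp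
  have fix_y: "y t = \<Phi> y t" for t using F[of Y] Y unfolding y_def by simp
  \<comment> \<open>Removing the weight turns the fixed point equation into the integral equation of
    the initial value problem.\<close>
  define u where "u t = w t *\<^sub>R y t" for t
  have u_eq: "u t = x + integral {s..t} (g y)" if "s \<le> t" for t
  proof -
    have "w t * exp (- (2 * K * (t - s))) = 1" unfolding w_def by (simp add: exp_minus)
    then show ?thesis unfolding u_def fix_y[of t] \<Phi>_def using that by (simp add: max_absorb2)
  qed
  have "(u has_vector_derivative L t (u t)) (at t within {s..})" if t: "s \<le> t" for t
  proof -
    have "((\<lambda>t. x + integral {s..t} (g y)) has_vector_derivative 0 + g y t) (at t within {s..})"
      by (intro has_vector_derivative_add has_vector_derivative_const
          integral_has_vector_derivative_atLeast g y t)
    then have "(u has_vector_derivative 0 + g y t) (at t within {s..})"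
      by (rule has_vector_derivative_transform[rotated 2]) (use t u_eq in auto)
    then show ?thesis by (simp add: g_def u_def)
  qed
  moreover have "u s = x" using u_eq[of s] by simp
  ultimately show ?thesis unfolding is_solution_def by blast
qed

section \<open>Solution operators and their continuity\<close>

definition flow :: "real \<Rightarrow> real \<Rightarrow> 'a \<Rightarrow> 'a"
  where "flow t s x = (SOME u. is_solution s x u) t"

lemma flow_solution: "is_solution s x (\<lambda>t. flow t s x)"
  unfolding flow_def using someI_ex[OF solution_exists] by simp

lemma flow_self [simp]: "flow s s x = x"
  using flow_solution unfolding is_solution_def by blast

lemma flow_derivative_within:
  "s \<le> t \<Longrightarrow> ((\<lambda>t. flow t s x) has_vector_derivative L t (flow t s x)) (at t within {s..})"
  using flow_solution unfolding is_solution_def by blast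

lemma flow_derivative:
  assumes "s < t"
  shows "((\<lambda>t. flow t s x) has_vector_derivative L t (flow t s x)) (at t)"
  by (rule solution_derivative[OF flow_solution assms])

lemma solution_continuous:
  assumes "is_solution s x u"
  shows "continuous_on {s..} u"
  using assms unfolding is_solution_def
  by (auto simp: continuous_on_eq_continuous_within intro: has_vector_derivative_continuous)

text \<open>Gronwall in differential form: exp (- 2 K (r - s)) |u|^2 does not increase, because (u,
  L u) \<le> K |u|^2. Applied to differences it also gives uniqueness.\<close>

lemma solution_growth:
  assumes u: "is_solution s x u" and t: "s \<le> t"
  shows "norm (u t) \<le> exp (K * (t - s)) * norm x"
proof -
  define f where "f r = exp (- (2 * K * (r - s))) * inner (u r) (u r)" for r
  have "f t \<le> f s"
  proof (rule DERIV_nonpos_imp_decreasing_open[OF t])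
    fix r assume r: "s < r" "r < t"
    have "(u has_vector_derivative L r (u r)) (at r)"
      by (rule solution_derivative[OF u r(1)])
    then have du: "(u has_derivative (\<lambda>h. h *\<^sub>R L r (u r))) (at r)" by (simp add: has_vector_derivative_def)
    have "((\<lambda>r. inner (u r) (u r)) has_derivative (\<lambda>h. inner (u r) (h *\<^sub>R L r (u r)) + inner (h *\<^sub>R L r (u r)) (u r))) (at r)"
      by (rule has_derivative_inner[OF du du])
    then have "((\<lambda>r. inner (u r) (u r)) has_real_derivative 2 * inner (u r) (L r (u r))) (at r)"
      unfolding has_field_derivative_def by (rule has_derivative_eq_rhs) (auto simp: inner_commute algebra_simps)
    then have "(f has_real_derivative
      exp (- (2 * K * (r - s))) * (- (2 * K)) * inner (u r) (u r)
      + 2 * inner (u r) (L r (u r)) * exp (- (2 * K * (r - s)))) (at r)"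
      unfolding f_def by (intro DERIV_mult) (auto intro!: derivative_eq_intros)
    moreover have "inner (u r) (L r (u r)) \<le> K * inner (u r) (u r)"
    proof -
      have "inner (u r) (L r (u r)) \<le> norm (u r) * norm (L r (u r))" by (rule norm_cauchy_schwarz)
      also have "\<dots> \<le> norm (u r) * (K * norm (u r))" by (intro mult_left_mono L_bound) auto
      finally show ?thesis by (simp add: power2_norm_eq_inner[symmetric] power2_eq_square mult_ac)
    qed
    then have "exp (- (2 * K * (r - s))) * (- (2 * K)) * inner (u r) (u r)
      + 2 * inner (u r) (L r (u r)) * exp (- (2 * K * (r - s))) \<le> 0"
      by (simp add: mult.commute[of _ "exp _"] mult.assoc flip: distrib_left)
    ultimately show "\<exists>y. DERIV f r :> y \<and> y \<le> 0" by blast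
  next
    show "continuous_on {s..t} f" unfolding f_def
      by (intro continuous_intros continuous_on_subset[OF solution_continuous[OF u]]) auto
  qed
  then have "exp (- (2 * K * (t - s))) * (norm (u t))\<^sup>2 \<le> (norm x)\<^sup>2"
    using u unfolding f_def is_solution_def by (simp add: power2_norm_eq_inner)
  then have "exp (2 * K * (t - s)) * (exp (- (2 * K * (t - s))) * (norm (u t))\<^sup>2) \<le> exp (2 * K * (t - s)) * (norm x)\<^sup>2"
    by (intro mult_left_mono) auto
  then have "(norm (u t))\<^sup>2 \<le> exp (2 * K * (t - s)) * (norm x)\<^sup>2"
    by (simp only: mult.assoc[symmetric] exp_add[symmetric]) simp
  also have "\<dots> = (exp (K * (t - s)) * norm x)\<^sup>2"
    by (simp add: power_mult_distrib power2_eq_square flip: exp_add)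
  finally show ?thesis by (rule power2_le_imp_le) simp
qed

lemma solution_unique:
  assumes u: "is_solution s x u" and t: "s \<le> t"
  shows "u t = flow t s x"
proof -
  have "is_solution s 0 (\<lambda>t. u t - flow t s x)"
    using u flow_solution[of s x] unfolding is_solution_def
    by (auto intro!: derivative_eq_intros simp: L.diff)
  from solution_growth[OF this t] show ?thesis by simp
qed

lemma flow_norm_le:
  assumes "s \<le> t"
  shows "norm (flow t s x) \<le> exp (K * (t - s)) * norm x"
  using solution_growth[OF flow_solution assms] .

text \<open>The image of a solution under \<open>J\<close> is again a solution, so uniqueness
  applies. Real and complex scalars and the Galerkin projection are the maps of interest.\<close>

lemma flow_commute:
  assumes J: "bounded_linear J" "\<And>t x. L t (J x) = J (L t x)" and t: "s \<le> t"
  shows "flow t s (J x) = J (flow t s x)"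
proof -
  have "is_solution s (J x) (\<lambda>t. J (flow t s x))"
    unfolding is_solution_def using bounded_linear.has_vector_derivative[OF J(1) flow_derivative_within]
    by (auto simp: J(2))
  from solution_unique[OF this t] show ?thesis by simp
qed

lemma flow_linear:
  assumes t: "s \<le> t"
  shows "bounded_linear (flow t s)"
proof (rule bounded_linear_intro)
  fix x y :: 'a and c :: real
  have "is_solution s (x + y) (\<lambda>t. flow t s x + flow t s y)"
    unfolding is_solution_def by (auto intro!: derivative_eq_intros flow_derivative_within simp: L.add)
  from solution_unique[OF this t] show "flow t s (x + y) = flow t s x + flow t s y" by simp
  show "flow t s (c *\<^sub>R x) = c *\<^sub>R flow t s x"
    using flow_commute[OF bounded_linear_scaleR_right _ t] by (simp add: L.scaleR)
  show "norm (flow t s x) \<le> norm x * exp (K * (t - s))" using flow_norm_le[OF t, of x] by (simp add: mult.commute)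
qed

lemma flow_cocycle:
  assumes "s \<le> r" "r \<le> t"
  shows "flow t r (flow r s x) = flow t s x"
proof -
  have "is_solution r (flow r s x) (\<lambda>t. flow t s x)"
    unfolding is_solution_def using assms(1)
    by (auto intro: has_vector_derivative_within_subset[OF flow_derivative_within])
  from solution_unique[OF this assms(2)] show ?thesis by simp
qed

lemma flow_increment:
  assumes "s \<le> t"
  shows "norm (flow t s x - x) \<le> K * exp (K * (t - s)) * (t - s) * norm x"
proof (cases "s = t")
  case False
  have "norm (flow t s x - flow s s x) \<le> (K * (exp (K * (t - s)) * norm x)) * t - (K * (exp (K * (t - s)) * norm x)) * s"
  proof (rule differentiable_bound_general[where f = "\<lambda>t. flow t s x" and \<phi> = "\<lambda>r. (K * (exp (K * (t - s)) * norm x)) * r"])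
    show "s < t" using assms False by simp
    show "continuous_on {s..t} (\<lambda>t. flow t s x)"
      by (rule continuous_on_subset[OF solution_continuous[OF flow_solution]]) auto
    show "continuous_on {s..t} (\<lambda>r. (K * (exp (K * (t - s)) * norm x)) * r)" by (intro continuous_intros)
    fix r assume r: "s < r" "r < t"
    show "((\<lambda>t. flow t s x) has_vector_derivative L r (flow r s x)) (at r)" by (rule flow_derivative[OF r(1)])
    show "((\<lambda>r. (K * (exp (K * (t - s)) * norm x)) * r) has_vector_derivative K * (exp (K * (t - s)) * norm x)) (at r)"
      by (auto intro!: derivative_eq_intros)
    have "norm (L r (flow r s x)) \<le> K * norm (flow r s x)" by (rule L_bound)
    also have "\<dots> \<le> K * (exp (K * (r - s)) * norm x)" using K_pos r by (intro mult_left_mono flow_norm_le) auto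
    also have "\<dots> \<le> K * (exp (K * (t - s)) * norm x)" using K_pos r by (intro mult_left_mono mult_right_mono) auto
    finally show "norm (L r (flow r s x)) \<le> K * (exp (K * (t - s)) * norm x)" .
  qed
  then show ?thesis by (simp add: algebra_simps)
qed simp

lemma flow_Lipschitz_t:
  assumes "s \<le> t" "t \<le> t'"
  shows "norm (flow t' s x - flow t s x) \<le> K * exp (K * (t' - s)) * (t' - t) * norm x"
proof -
  have "flow t' s x - flow t s x = flow t' t (flow t s x) - flow t s x" using assms by (simp add: flow_cocycle)
  also have "norm \<dots> \<le> K * exp (K * (t' - t)) * (t' - t) * norm (flow t s x)" by (rule flow_increment[OF assms(2)])
  also have "\<dots> \<le> K * exp (K * (t' - t)) * (t' - t) * (exp (K * (t - s)) * norm x)"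
    using assms K_pos by (intro mult_left_mono flow_norm_le) auto
  also have "\<dots> = K * (exp (K * (t' - t)) * exp (K * (t - s))) * (t' - t) * norm x" by simp
  also have "exp (K * (t' - t)) * exp (K * (t - s)) = exp (K * (t' - s))" by (simp add: algebra_simps flip: exp_add)
  finally show ?thesis .
qed

text \<open>The cocycle law converts a change of the initial time into a short-time increment
  transported by the flow.\<close>

lemma flow_Lipschitz_s:
  assumes "s \<le> s'" "s' \<le> t"
  shows "norm (flow t s x - flow t s' x) \<le> K * exp (K * (t - s)) * (s' - s) * norm x"
proof -
  interpret F: bounded_linear "flow t s'" by (rule flow_linear[OF assms(2)])
  have "flow t s x - flow t s' x = flow t s' (flow s' s x - x)" using assms by (simp add: F.diff flow_cocycle)
  also have "norm \<dots> \<le> exp (K * (t - s')) * norm (flow s' s x - x)" by (rule flow_norm_le[OF assms(2)])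
  also have "\<dots> \<le> exp (K * (t - s')) * (K * exp (K * (s' - s)) * (s' - s) * norm x)"
    by (intro mult_left_mono flow_increment assms) auto
  also have "\<dots> = K * (exp (K * (t - s')) * exp (K * (s' - s))) * (s' - s) * norm x" by simp
  also have "exp (K * (t - s')) * exp (K * (s' - s)) = exp (K * (t - s))" by (simp add: algebra_simps flip: exp_add)
  finally show ?thesis .
qed

lemma flow_jointly_continuous:
  "continuous_on {(t, s). 0 \<le> s \<and> s \<le> t \<and> t \<le> T} (\<lambda>(t, s). flow t s x)"
proof (cases "0 \<le> T")
  case T: True
  define C where "C = K * exp (K * T) * norm x"
  have C: "0 \<le> C" unfolding C_def using K_pos by simp
  have Lt: "norm (flow t' s x - flow t s x) \<le> C * \<bar>t' - t\<bar>" if "0 \<le> s" "s \<le> t" "s \<le> t'" "t \<le> T" "t' \<le> T" for s t t'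
  proof -
    have *: "norm (flow t' s x - flow t s x) \<le> C * \<bar>t' - t\<bar>" if "0 \<le> s" "s \<le> t" "t \<le> t'" "t' \<le> T" for s t t'
    proof -
      have "norm (flow t' s x - flow t s x) \<le> K * exp (K * (t' - s)) * (t' - t) * norm x"
        using that by (intro flow_Lipschitz_t) auto
      also have "\<dots> \<le> K * exp (K * T) * (t' - t) * norm x"
        using that K_pos by (intro mult_right_mono mult_left_mono) auto
      finally show ?thesis using that by (simp add: C_def mult_ac)
    qed
    show ?thesis using *[of s t t'] *[of s t' t] that by (cases "t \<le> t'") (auto simp: norm_minus_commute abs_minus_commute)
  qed
  have Ls: "norm (flow t s x - flow t s' x) \<le> C * \<bar>s' - s\<bar>" if "0 \<le> s" "s \<le> s'" "s' \<le> t" "t \<le> T" for s s' t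
  proof -
    have "norm (flow t s x - flow t s' x) \<le> K * exp (K * (t - s)) * (s' - s) * norm x"
      using that by (intro flow_Lipschitz_s) auto
    also have "\<dots> \<le> K * exp (K * T) * (s' - s) * norm x"
      using that K_pos by (intro mult_right_mono mult_left_mono) auto
    finally show ?thesis using that by (simp add: C_def mult_ac)
  qed
  have main: "norm (flow t' s' x - flow t s x) \<le> C * \<bar>t' - t\<bar> + C * \<bar>s' - s\<bar>"
    if "0 \<le> s" "s \<le> t" "t \<le> T" "0 \<le> s'" "s' \<le> t'" "t' \<le> T" for t s t' s'
  proof -
    \<comment> \<open>For s \<le> s' the corner (t', s) stays in the triangle and serves as
      intermediate point; the other case exchanges the two points.\<close>
    have *: "norm (flow t' s' x - flow t s x) \<le> C * \<bar>t' - t\<bar> + C * \<bar>s' - s\<bar>"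
      if "0 \<le> s" "s \<le> t" "t \<le> T" "s' \<le> t'" "t' \<le> T" "s \<le> s'" for t s t' s'
    proof -
      have "norm (flow t' s' x - flow t s x) \<le> norm (flow t' s x - flow t s x) + norm (flow t' s x - flow t' s' x)"
        using norm_triangle_ineq4[of "flow t' s x - flow t s x" "flow t' s x - flow t' s' x"] by simp
      then show ?thesis using Lt[of s t t'] Ls[of s s' t'] that by linarith
    qed
    show ?thesis using *[of s t s' t'] *[of s' t' s t] that
      by (cases "s \<le> s'") (auto simp: norm_minus_commute abs_minus_commute)
  qed
  show ?thesis unfolding continuous_on_iff
  proof (clarify)
    fix t s e :: real assume p: "0 \<le> s" "s \<le> t" "t \<le> T" and e: "0 < e"
    define d where "d = e / (2 * C + 1)"
    have d: "0 < d" unfolding d_def using C e by simp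
    have "dist (flow t' s' x) (flow t s x) < e"
      if q: "0 \<le> s'" "s' \<le> t'" "t' \<le> T" and close: "dist (t', s') (t, s) < d" for t' s'
    proof -
      have "\<bar>t' - t\<bar> < d" "\<bar>s' - s\<bar> < d"
        using close dist_fst_le[of "(t', s')" "(t, s)"] dist_snd_le[of "(t', s')" "(t, s)"] by (auto simp: dist_real_def)
      then have "C * \<bar>t' - t\<bar> + C * \<bar>s' - s\<bar> \<le> C * d + C * d" using C by (intro add_mono mult_left_mono) auto
      also have "\<dots> < e"
      proof -
        have "d * (2 * C + 1) = e" unfolding d_def using C by simp
        then show ?thesis using d by (simp add: algebra_simps)
      qed
      finally show ?thesis using main[OF p q] by (simp add: dist_norm)
    qed
    then show "\<exists>d>0. \<forall>x'\<in>{(t, s). 0 \<le> s \<and> s \<le> t \<and> t \<le> T}. dist x' (t, s) < d \<longrightarrow>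
      dist (case x' of (t, s) \<Rightarrow> flow t s x) (flow t s x) < e"
      using d by (intro exI[of _ d]) auto
  qed
next
  case False
  then have "{(t, s). 0 \<le> s \<and> s \<le> t \<and> t \<le> T} = {}" by auto
  then show ?thesis by (simp only: continuous_on_empty)
qed

end

section \<open>Weak derivatives on an interval\<close>

lemma finite_measure_lebesgue_Icc: "finite_measure (lebesgue_on {p..q::real})"
  by (rule finite_measure_lebesgue_on) simp

lemma in_L2_integrable:
  assumes "in_L2 p q f"
  shows "integrable (lebesgue_on {p..q}) f"
proof -
  interpret finite_measure "lebesgue_on {p..q}" by (rule finite_measure_lebesgue_Icc)
  have f: "f \<in> borel_measurable (lebesgue_on {p..q})" "integrable (lebesgue_on {p..q}) (\<lambda>t. (norm (f t))\<^sup>2)"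
    using assms unfolding in_L2_def by auto
  have "integrable (lebesgue_on {p..q}) (\<lambda>t. 1 + (norm (f t))\<^sup>2)" using f(2) by simp
  then show ?thesis
  proof (rule Bochner_Integration.integrable_bound[OF _ f(1)])
    have "norm (f t) \<le> norm (1 + (norm (f t))\<^sup>2)" for t
    proof -
      have "0 \<le> (norm (f t) - 1)\<^sup>2" by simp
      then have "2 * norm (f t) \<le> 1 + (norm (f t))\<^sup>2" by (simp add: power2_diff)
      moreover have "0 \<le> norm (f t)" by simp
      ultimately have "norm (f t) \<le> 1 + (norm (f t))\<^sup>2" by linarith
      then show ?thesis by simp
    qed
    then show "AE t in lebesgue_on {p..q}. norm (f t) \<le> norm (1 + (norm (f t))\<^sup>2)" by simp
  qed
qed

lemma norm_add_square_le:
  fixes x y :: "'a::real_normed_vector"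
  shows "(norm (x + y))\<^sup>2 \<le> 2 * (norm x)\<^sup>2 + 2 * (norm y)\<^sup>2"
proof -
  have "(norm (x + y))\<^sup>2 \<le> (norm x + norm y)\<^sup>2" by (intro power_mono norm_triangle_ineq) auto
  moreover have "0 \<le> (norm x - norm y)\<^sup>2" by simp
  ultimately show ?thesis by (simp add: power2_diff power2_sum)
qed

lemma in_L2_add:
  assumes "in_L2 p q f" "in_L2 p q g"
  shows "in_L2 p q (\<lambda>t. f t + g t)"
proof -
  have f: "f \<in> borel_measurable (lebesgue_on {p..q})" "integrable (lebesgue_on {p..q}) (\<lambda>t. (norm (f t))\<^sup>2)"
    and g: "g \<in> borel_measurable (lebesgue_on {p..q})" "integrable (lebesgue_on {p..q}) (\<lambda>t. (norm (g t))\<^sup>2)"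
    using assms unfolding in_L2_def by auto
  have "integrable (lebesgue_on {p..q}) (\<lambda>t. 2 * (norm (f t))\<^sup>2 + 2 * (norm (g t))\<^sup>2)"
    using f(2) g(2) by simp
  then have "integrable (lebesgue_on {p..q}) (\<lambda>t. (norm (f t + g t))\<^sup>2)"
  proof (rule Bochner_Integration.integrable_bound)
    show "(\<lambda>t. (norm (f t + g t))\<^sup>2) \<in> borel_measurable (lebesgue_on {p..q})" using f(1) g(1) by simp
    show "AE t in lebesgue_on {p..q}. norm ((norm (f t + g t))\<^sup>2) \<le> norm (2 * (norm (f t))\<^sup>2 + 2 * (norm (g t))\<^sup>2)"
      by (simp add: norm_add_square_le)
  qed
  then show ?thesis using f(1) g(1) unfolding in_L2_def by simp
qed

lemma in_L2_uminus: "in_L2 p q f \<Longrightarrow> in_L2 p q (\<lambda>t. - f t)"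
  unfolding in_L2_def by simp

lemma integrable_bounded_scaleR:
  fixes f :: "'a \<Rightarrow> 'b::{banach, second_countable_topology}" and \<psi> :: "'a \<Rightarrow> real"
  assumes f: "integrable M f" and \<psi>: "\<psi> \<in> borel_measurable M" "\<And>t. \<bar>\<psi> t\<bar> \<le> B"
  shows "integrable M (\<lambda>t. \<psi> t *\<^sub>R f t)"
proof (rule Bochner_Integration.integrable_bound)
  show "integrable M (\<lambda>t. B *\<^sub>R f t)" using f by simp
  show "(\<lambda>t. \<psi> t *\<^sub>R f t) \<in> borel_measurable M" using f \<psi>(1) by simp
  have "0 \<le> B" using order_trans[OF abs_ge_zero \<psi>(2)] .
  then show "AE t in M. norm (\<psi> t *\<^sub>R f t) \<le> norm (B *\<^sub>R f t)" using \<psi>(2) by (simp add: mult_right_mono)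
qed

lemma borel_measurable_continuous_Icc:
  assumes "continuous_on UNIV (f :: real \<Rightarrow> 'b::metric_space)"
  shows "f \<in> borel_measurable (lebesgue_on {p..q})"
  using assms by (simp add: borel_measurable_continuous_onI measurable_completion measurable_restrict_space1)

section \<open>Test functions\<close>

lemma test_function_support:
  assumes "test_function p q \<psi>" "p < q"
  obtains c d where "p < c" "c < d" "d < q" "\<And>t. t \<notin> {c..d} \<Longrightarrow> \<psi> t = 0"
proof -
  obtain K where K: "compact K" "K \<subseteq> {p<..<q}" "\<And>t. t \<notin> K \<Longrightarrow> \<psi> t = 0"
    using assms(1) unfolding test_function_def by blast
  define m where "m = (p + q) / 2"
  \<comment> \<open>Adding the midpoint makes the set nonempty, so that its minimum and maximum
    exist.\<close>
  define K' where "K' = insert m K"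
  have K': "compact K'" "K' \<subseteq> {p<..<q}" "K' \<noteq> {}" using K(1,2) assms(2) unfolding K'_def m_def by auto
  obtain c where c: "c \<in> K'" "\<And>t. t \<in> K' \<Longrightarrow> c \<le> t" using compact_attains_inf[OF K'(1,3)] by blast
  obtain d where d: "d \<in> K'" "\<And>t. t \<in> K' \<Longrightarrow> t \<le> d" using compact_attains_sup[OF K'(1,3)] by blast
  have "p < c" "d < q" "c \<le> d" using c d K'(2) by auto
  \<comment> \<open>Moving the right end outwards gives a nondegenerate interval even if the support
    is a single point.\<close>
  define d' where "d' = (d + q) / 2"
  have "d < d'" "d' < q" using \<open>d < q\<close> unfolding d'_def by auto
  have "\<psi> t = 0" if "t \<notin> {c..d'}" for t
    using that c(2) d(2) \<open>d < d'\<close> by (intro K(3)) (force simp: K'_def)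
  with \<open>p < c\<close> \<open>c \<le> d\<close> \<open>d < d'\<close> \<open>d' < q\<close> show ?thesis by (intro that[of c d']) auto
qed

lemma test_function_derivative:
  assumes "test_function p q \<psi>"
  shows "(\<psi> has_real_derivative deriv \<psi> t) (at t)" "continuous_on UNIV (deriv \<psi>)" "continuous_on UNIV \<psi>"
proof -
  obtain D where D: "\<And>t. (\<psi> has_vector_derivative D t) (at t)" "continuous_on UNIV D"
    using assms unfolding test_function_def C1_differentiable_on_def by auto
  have D': "(\<psi> has_real_derivative D t) (at t)" for t
    using D(1) by (simp add: has_real_derivative_iff_has_vector_derivative)
  have eq: "deriv \<psi> = D" using DERIV_imp_deriv[OF D'] by auto
  show "(\<psi> has_real_derivative deriv \<psi> t) (at t)" "continuous_on UNIV (deriv \<psi>)"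
    unfolding eq using D' D(2) by auto
  show "continuous_on UNIV \<psi>" using D'
    by (auto simp: continuous_on_eq_continuous_at intro: DERIV_isCont)
qed

lemma test_function_derivative_support:
  assumes \<psi>: "test_function p q \<psi>" and supp: "\<And>t. t \<notin> {c..d} \<Longrightarrow> \<psi> t = 0" and t: "t \<notin> {c..d}"
  shows "deriv \<psi> t = 0"
proof -
  have "((\<lambda>t. 0) has_real_derivative deriv \<psi> t) (at t)"
    using t supp
    by (intro has_field_derivative_transform_within_open[OF test_function_derivative(1)[OF \<psi>], of "- {c..d}"]) auto
  then show ?thesis using DERIV_unique DERIV_const by blast
qed

lemma test_functionI:
  assumes D: "\<And>t. (\<psi> has_real_derivative D t) (at t)" "continuous_on UNIV D"
    and supp: "\<And>t. t \<notin> {c..d} \<Longrightarrow> \<psi> t = 0" "p < c" "d < q"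
  shows "test_function p q \<psi>" "deriv \<psi> = D"
proof -
  show "test_function p q \<psi>"
    unfolding test_function_def C1_differentiable_on_def
    using D supp by (auto simp: has_real_derivative_iff_has_vector_derivative intro!: exI[of _ "{c..d}"])
  show "deriv \<psi> = D" using DERIV_imp_deriv[OF D(1)] by auto
qed

lemma continuous_compact_support_bounded:
  fixes \<psi> :: "real \<Rightarrow> real"
  assumes "continuous_on UNIV \<psi>" "\<And>t. t \<notin> {c..d} \<Longrightarrow> \<psi> t = 0"
  shows "\<exists>B. \<forall>t. \<bar>\<psi> t\<bar> \<le> B"
proof -
  have "bounded (\<psi> ` {c..d})"
    by (intro compact_imp_bounded compact_continuous_image continuous_on_subset[OF assms(1)]) auto
  then obtain B where "\<forall>t\<in>{c..d}. \<bar>\<psi> t\<bar> \<le> B" by (auto simp: bounded_iff)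
  then have "\<bar>\<psi> t\<bar> \<le> max B 0" for t using assms(2)[of t] by (cases "t \<in> {c..d}") (auto simp: le_max_iff_disj)
  then show ?thesis by blast
qed

lemma test_function_scaleR_integrable:
  fixes f :: "real \<Rightarrow> 'b::{banach, second_countable_topology}"
  assumes \<psi>: "test_function p q \<psi>" and pq: "p < q" and f: "integrable (lebesgue_on {p..q}) f"
  shows "integrable (lebesgue_on {p..q}) (\<lambda>t. \<psi> t *\<^sub>R f t)"
    "integrable (lebesgue_on {p..q}) (\<lambda>t. deriv \<psi> t *\<^sub>R f t)"
proof -
  obtain c d where supp: "\<And>t. t \<notin> {c..d} \<Longrightarrow> \<psi> t = 0" "p < c" "d < q"
    using test_function_support[OF \<psi> pq] by metis
  have dsupp: "deriv \<psi> t = 0" if "t \<notin> {c..d}" for t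
    by (rule test_function_derivative_support[OF \<psi> supp(1) that])
  obtain B where B: "\<And>t. \<bar>\<psi> t\<bar> \<le> B"
    using continuous_compact_support_bounded[OF test_function_derivative(3)[OF \<psi>] supp(1)] by blast
  obtain B' where B': "\<And>t. \<bar>deriv \<psi> t\<bar> \<le> B'"
    using continuous_compact_support_bounded[OF test_function_derivative(2)[OF \<psi>] dsupp] by blast
  show "integrable (lebesgue_on {p..q}) (\<lambda>t. \<psi> t *\<^sub>R f t)"
    by (intro integrable_bounded_scaleR[OF f _ B] borel_measurable_continuous_Icc test_function_derivative(3)[OF \<psi>])
  show "integrable (lebesgue_on {p..q}) (\<lambda>t. deriv \<psi> t *\<^sub>R f t)"
    by (intro integrable_bounded_scaleR[OF f _ B'] borel_measurable_continuous_Icc test_function_derivative(2)[OF \<psi>])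
qed

text \<open>Squaring removes the corner of the positive part; this is the C1 building block of the
  bump functions.\<close>

lemma positive_part_square_derivative:
  "((\<lambda>x::real. (max 0 x)\<^sup>2) has_real_derivative 2 * max 0 x) (at x)"
proof -
  consider "0 < x" | "x < 0" | "x = 0" by linarith
  then show ?thesis
  proof cases
    case 1
    have "((\<lambda>x::real. x\<^sup>2) has_real_derivative 2 * x) (at x)" by (auto intro!: derivative_eq_intros)
    then have "((\<lambda>x::real. (max 0 x)\<^sup>2) has_real_derivative 2 * x) (at x)"
      by (rule has_field_derivative_transform_within_open[of _ _ _ "{0<..}"]) (use 1 in auto)
    then show ?thesis using 1 by simp
  next
    case 2
    have "((\<lambda>x::real. (max 0 x)\<^sup>2) has_real_derivative 0) (at x)"
      by (rule has_field_derivative_transform_within_open[OF DERIV_const, of "{..<0}"]) (use 2 in auto)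
    then show ?thesis using 2 by simp
  next
    case 3
    have "((\<lambda>h. (max 0 h)\<^sup>2 / h) \<longlongrightarrow> 0) (at (0::real))"
    proof (rule Lim_null_comparison)
      have "norm ((max 0 h)\<^sup>2 / h) \<le> \<bar>h\<bar>" for h :: real
        by (cases "0 \<le> h") (simp_all add: max_def power2_eq_square)
      then show "\<forall>\<^sub>F h in at (0::real). norm ((max 0 h)\<^sup>2 / h) \<le> \<bar>h\<bar>" by simp
      show "((\<lambda>h. \<bar>h\<bar>) \<longlongrightarrow> 0) (at (0::real))" by (auto intro!: tendsto_eq_intros)
    qed
    then show ?thesis using 3 by (simp add: DERIV_def)
  qed
qed

section \<open>Bump functions and the fundamental lemma of the calculus of variations\<close>

text \<open>For n > 0 the product of squares is C1 and positive exactly on (c + 1/n, d - 1/n); the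
  map k to 1 - 1 / (1 + k) brings its values into [0, 1). As n grows, the bumps tend to the
  indicator of (c, d).\<close>

definition bump :: "real \<Rightarrow> real \<Rightarrow> nat \<Rightarrow> real \<Rightarrow> real"
  where "bump c d n t = 1 - 1 / (1 + (max 0 (real n * (t - c) - 1))\<^sup>2 * (max 0 (real n * (d - t) - 1))\<^sup>2)"

lemma bump_bounds: "0 \<le> bump c d n t" "bump c d n t \<le> 1"
  unfolding bump_def by (simp_all add: divide_le_eq_1 add_pos_nonneg)

lemma test_function_bump:
  assumes n: "0 < n" and cd: "p \<le> c" "d \<le> q"
  shows "test_function p q (bump c d n)"
proof -
  define k where "k t = (max 0 (real n * (t - c) - 1))\<^sup>2 * (max 0 (real n * (d - t) - 1))\<^sup>2" for t
  define k' where "k' t = (2 * max 0 (real n * (t - c) - 1) * real n) * (max 0 (real n * (d - t) - 1))\<^sup>2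
    + (2 * max 0 (real n * (d - t) - 1) * - real n) * (max 0 (real n * (t - c) - 1))\<^sup>2" for t
  have k: "(k has_real_derivative k' t) (at t)" for t
  proof -
    have 1: "((\<lambda>t. real n * (t - c) - 1) has_real_derivative real n) (at t)"
      and 2: "((\<lambda>t. real n * (d - t) - 1) has_real_derivative - real n) (at t)"
      by (auto intro!: derivative_eq_intros)
    show ?thesis unfolding k_def k'_def
      by (rule DERIV_mult[OF DERIV_chain2[OF positive_part_square_derivative 1] DERIV_chain2[OF positive_part_square_derivative 2]])
  qed
  have pos: "0 < 1 + k t" for t unfolding k_def by (simp add: add_pos_nonneg)
  have "((\<lambda>t. 1 - 1 / (1 + k t)) has_real_derivative k' t / (1 + k t)\<^sup>2) (at t)" for t
    using pos[of t] by (auto intro!: derivative_eq_intros k simp: power2_eq_square)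
  then have D: "(bump c d n has_real_derivative k' t / (1 + k t)\<^sup>2) (at t)" for t
    by (simp add: bump_def[abs_def] k_def)
  have cont: "continuous_on UNIV (\<lambda>t. k' t / (1 + k t)\<^sup>2)"
  proof -
    have "continuous_on UNIV k" "continuous_on UNIV k'" unfolding k_def k'_def by (intro continuous_intros)+
    then show ?thesis using pos by (intro continuous_intros) (auto simp: less_imp_neq[symmetric])
  qed
  have "0 < 1 / real n" using n by simp
  show ?thesis
  proof (rule test_functionI(1)[OF D cont])
    fix t assume "t \<notin> {c + 1 / real n..d - 1 / real n}"
    then have "real n * (t - c) - 1 \<le> 0 \<or> real n * (d - t) - 1 \<le> 0"
      using n by (auto simp: field_simps not_le)
    then show "bump c d n t = 0" unfolding bump_def by (auto simp: max_def)
  qed (use \<open>0 < 1 / real n\<close> cd in linarith)+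
qed

lemma bump_tendsto: "(\<lambda>n. bump c d (Suc n) t) \<longlonglongrightarrow> indicator {c<..<d} t"
proof (cases "c < t \<and> t < d")
  case True
  define m where "m = min (t - c) (d - t)"
  have m: "0 < m" using True unfolding m_def by auto
  have "\<forall>\<^sub>F n in sequentially. norm (bump c d (Suc n) t - 1) \<le> 1 / (m * real (Suc n))"
  proof -
    \<comment> \<open>This makes s = m (n + 1) exceed 2, so that s - 1 \<ge> 1 and (s - 1)^4 \<ge> s
      - 1; the defect of the bump is then at most 1 / s.\<close>
    obtain N where N: "2 / m < real N" using reals_Archimedean2 by blast
    have "norm (bump c d (Suc n) t - 1) \<le> 1 / (m * real (Suc n))" if "n \<ge> N" for n
    proof -
      define s where "s = m * real (Suc n)"
      have "2 < m * real N" using N m by (simp add: field_simps)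
      also have "\<dots> \<le> s" unfolding s_def using m that by (intro mult_left_mono) auto
      finally have s: "2 < s" .
      have "s \<le> real (Suc n) * (t - c)" "s \<le> real (Suc n) * (d - t)"
        unfolding s_def m_def by (subst mult.commute, intro mult_left_mono, simp_all)+
      then have "s - 1 \<le> max 0 (real (Suc n) * (t - c) - 1)" "s - 1 \<le> max 0 (real (Suc n) * (d - t) - 1)" by auto
      then have "(s - 1)\<^sup>2 * (s - 1)\<^sup>2 \<le> (max 0 (real (Suc n) * (t - c) - 1))\<^sup>2 * (max 0 (real (Suc n) * (d - t) - 1))\<^sup>2"
        using s by (intro mult_mono power_mono) auto
      moreover have "s - 1 \<le> (s - 1)\<^sup>2 * (s - 1)\<^sup>2"
      proof -
        have "1 \<le> s - 1" using s by simp
        then have "(s - 1) ^ 1 \<le> (s - 1) ^ 4" by (intro power_increasing) auto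
        then show ?thesis by (simp add: power2_eq_square power4_eq_xxxx mult.assoc)
      qed
      ultimately have "s - 1 \<le> (max 0 (real (Suc n) * (t - c) - 1))\<^sup>2 * (max 0 (real (Suc n) * (d - t) - 1))\<^sup>2"
        by (rule order_trans[rotated])
      then have "s \<le> 1 + (max 0 (real (Suc n) * (t - c) - 1))\<^sup>2 * (max 0 (real (Suc n) * (d - t) - 1))\<^sup>2" by simp
      then show ?thesis using s unfolding bump_def s_def[symmetric] by (simp add: frac_le)
    qed
    then show ?thesis by (auto simp: eventually_sequentially)
  qed
  moreover have "(\<lambda>n. 1 / (m * real (Suc n))) \<longlonglongrightarrow> 0"
  proof -
    have "(\<lambda>n. (1 / m) * inverse (real (Suc n))) \<longlonglongrightarrow> (1 / m) * 0"
      by (intro tendsto_mult_left LIMSEQ_inverse_real_of_nat)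
    then show ?thesis by (simp add: inverse_eq_divide mult.commute)
  qed
  ultimately have "(\<lambda>n. bump c d (Suc n) t - 1) \<longlonglongrightarrow> 0" by (rule Lim_null_comparison)
  then show ?thesis using True by (simp add: LIM_zero_iff indicator_def)
next
  case False
  have "bump c d (Suc n) t = 0" for n
  proof -
    have "real (Suc n) * (t - c) - 1 \<le> 0 \<or> real (Suc n) * (d - t) - 1 \<le> 0"
      using False mult_nonneg_nonpos[of "real (Suc n)" "t - c"] mult_nonneg_nonpos[of "real (Suc n)" "d - t"] by force
    then show ?thesis unfolding bump_def by (auto simp: max_def)
  qed
  then show ?thesis using False by (auto simp: indicator_def)
qed

lemma AE_lebesgue_on_neq: "AE t in lebesgue_on {p..q}. t \<noteq> (c::real)"
proof -
  have "AE t in lebesgue. t \<noteq> c" by (rule AE_completion[OF AE_lborel_singleton])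
  then have "AE t in lebesgue. t \<in> {p..q} \<longrightarrow> t \<noteq> c" by (rule eventually_mono) simp
  then show ?thesis by (simp add: AE_restrict_space_iff)
qed

lemma AE_lebesgue_on_witness:
  assumes "AE t in lebesgue_on {p..q}. P t" "p \<le> a" "a < b" "b \<le> (q::real)"
  shows "\<exists>t. a < t \<and> t < b \<and> P t"
proof (rule ccontr)
  assume no: "\<not> ?thesis"
  have ae: "AE t in lebesgue. t \<in> {p..q} \<longrightarrow> P t" using assms(1) by (simp add: AE_restrict_space_iff)
  have "AE t\<in>{a<..<b} in lebesgue. t \<in> {}"
    using ae by (rule eventually_mono) (use no assms in auto)
  from mem_closed_if_AE_lebesgue_open[OF open_greaterThanLessThan closed_empty this, of "(a + b) / 2"] assms(3)
  show False by simp
qed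

lemma indicator_borel_measurable_lebesgue_on:
  assumes "A \<in> sets borel"
  shows "(\<lambda>t. indicator A t :: real) \<in> borel_measurable (lebesgue_on {p..q::real})"
  using assms by (intro measurable_restrict_space1 measurable_completion) simp

lemma indicator_scaleR_integrable:
  fixes g :: "real \<Rightarrow> 'b::{banach, second_countable_topology}"
  assumes "integrable (lebesgue_on {p..q}) g" "A \<in> sets borel"
  shows "integrable (lebesgue_on {p..q}) (\<lambda>t. indicator A t *\<^sub>R g t)"
  by (rule integrable_bounded_scaleR[OF assms(1) indicator_borel_measurable_lebesgue_on[OF assms(2)], of 1])
    (simp add: indicator_def)

text \<open>Dominated convergence along bumps gives vanishing integrals over intervals, induction
  over the Borel sets extends this, and a function whose integral vanishes on every measurable set
  is zero almost everywhere.\<close>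

lemma AE_zero_of_test_functions:
  fixes h :: "real \<Rightarrow> 'b::{banach, second_countable_topology}"
  assumes pq: "p < q" and h: "integrable (lebesgue_on {p..q}) h"
    and zero: "\<And>\<psi>. test_function p q \<psi> \<Longrightarrow> (LINT t|lebesgue_on {p..q}. \<psi> t *\<^sub>R h t) = 0"
  shows "AE t in lebesgue_on {p..q}. h t = 0"
proof -
  define M where "M = lebesgue_on {p..q}"
  note h = h[folded M_def] and zero = zero[folded M_def]
  have space: "space M = {p..q}" unfolding M_def by simp
  have int: "integrable M (\<lambda>t. indicator A t *\<^sub>R h t)" if "A \<in> sets borel" for A
    using indicator_scaleR_integrable[OF h[unfolded M_def] that] unfolding M_def .
  have box: "(LINT t|M. indicator {a..b} t *\<^sub>R h t) = 0" for a b
  proof -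
    \<comment> \<open>Cutting the interval down to [p, q] makes the bumps admissible test functions
      and alters the integrand only outside the space, apart from finitely many points.\<close>
    define c d where "c = max a p" and "d = min b q"
    have test: "test_function p q (bump c d (Suc n))" for n
      by (rule test_function_bump) (auto simp: c_def d_def)
    have "(\<lambda>n. LINT t|M. bump c d (Suc n) t *\<^sub>R h t) \<longlonglongrightarrow> (LINT t|M. indicator {a..b} t *\<^sub>R h t)"
    proof (rule integral_dominated_convergence)
      show "(\<lambda>t. indicator {a..b} t *\<^sub>R h t) \<in> borel_measurable M" using int[of "{a..b}"] by simp
      show "(\<lambda>t. bump c d (Suc n) t *\<^sub>R h t) \<in> borel_measurable M" for n
        using test_function_scaleR_integrable(1)[OF test pq h[unfolded M_def]] by (simp add: M_def)
      show "integrable M (\<lambda>t. norm (h t))" using h by simp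
      show "AE t in M. norm (bump c d (Suc n) t *\<^sub>R h t) \<le> norm (h t)" for n
      proof (rule AE_I2)
        fix t
        have "\<bar>bump c d (Suc n) t\<bar> * norm (h t) \<le> 1 * norm (h t)"
          using bump_bounds[of c d "Suc n" t] by (intro mult_right_mono) auto
        then show "norm (bump c d (Suc n) t *\<^sub>R h t) \<le> norm (h t)" by simp
      qed
      have "AE t in M. t \<noteq> p" "AE t in M. t \<noteq> q" "AE t in M. t \<noteq> a" "AE t in M. t \<noteq> b" unfolding M_def by (rule AE_lebesgue_on_neq)+
      then show "AE t in M. (\<lambda>n. bump c d (Suc n) t *\<^sub>R h t) \<longlonglongrightarrow> indicator {a..b} t *\<^sub>R h t"
        using AE_space
      proof eventually_elim
        case (elim t)
        then have "indicator {a..b} t = (indicator {c<..<d} t :: real)"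
          unfolding space c_def d_def by (auto simp: indicator_def)
        then show ?case using bump_tendsto[of c d t] by (auto intro!: tendsto_scaleR)
      qed
    qed
    then show ?thesis using zero[OF test] by (simp add: LIMSEQ_const_iff)
  qed
  have total: "(LINT t|M. h t) = 0"
  proof -
    have "(LINT t|M. h t) = (LINT t|M. indicator {p..q} t *\<^sub>R h t)"
      by (rule Bochner_Integration.integral_cong) (auto simp: space)
    then show ?thesis using box by simp
  qed
  have borel: "(LINT t|M. indicator A t *\<^sub>R h t) = 0" if A: "A \<in> sets borel" for A
  proof -
    have eq: "(LINT t|M. indicator C t *\<^sub>R h t) = set_lebesgue_integral M (C \<inter> {p..q}) h" for C
      unfolding set_lebesgue_integral_def
      by (rule Bochner_Integration.integral_cong) (auto simp: space indicator_def)
    show ?thesis using A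
    proof (induction rule: borel_set_induct)
      case empty then show ?case by simp
    next
      case (interval a b) then show ?case using box by simp
    next
      case (compl A)
      have "(LINT t|M. indicator (- A) t *\<^sub>R h t) = (LINT t|M. h t - indicator A t *\<^sub>R h t)"
        by (rule Bochner_Integration.integral_cong) (auto simp: indicator_def)
      then show ?case using h int[OF compl(1)] compl total by simp
    next
      case (union A)
      define B where "B i = A i \<inter> {p..q}" for i
      have B: "B i \<in> sets M" for i unfolding B_def M_def using union(2) by (auto simp: sets_restrict_space Int_commute)
      have "set_lebesgue_integral M (\<Union>i. B i) h = (\<Sum>i. set_lebesgue_integral M (B i) h)"
      proof (rule lebesgue_integral_countable_add[OF B])
        show "B i \<inter> B j = {}" if "i \<noteq> j" for i j
          using union(1) that unfolding B_def disjoint_family_on_def by blast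
        show "set_integrable M (\<Union>i. B i) h" unfolding set_integrable_def
          using h B by (intro integrable_mult_indicator) auto
      qed
      moreover have "set_lebesgue_integral M (B i) h = 0" for i
        using union(3)[of i] unfolding B_def eq .
      ultimately have "set_lebesgue_integral M (\<Union>i. B i) h = 0" by simp
      moreover have "(\<Union>i. B i) = (\<Union>i. A i) \<inter> {p..q}" unfolding B_def by auto
      ultimately show ?case unfolding eq by simp
    qed
  qed
  interpret finite_measure M unfolding M_def by (rule finite_measure_lebesgue_Icc)
  have "AE t in M. h t = 0"
  proof (rule density_zero[OF h])
    fix A assume "A \<in> sets M"
    then have "A \<in> sets lebesgue" unfolding M_def by (simp add: sets_restrict_space_iff)
    \<comment> \<open>A Lebesgue set is a Borel set up to part of a null set, so the Borel case
      determines its integral.\<close>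
    then obtain S N N' where SN: "A = S \<union> N" "N \<subseteq> N'" "N' \<in> null_sets lborel" "S \<in> sets lborel"
      by (rule sets_completionE)
    have "AE t in lebesgue. t \<notin> N'" using AE_completion[OF AE_not_in[OF SN(3)]] .
    then have "AE t in M. t \<notin> N'" unfolding M_def by (auto simp: AE_restrict_space_iff)
    then have "AE t in M. indicator A t *\<^sub>R h t = indicator S t *\<^sub>R h t"
      by (rule eventually_mono) (use SN in \<open>auto simp: indicator_def\<close>)
    moreover have "(\<lambda>t. indicator A t *\<^sub>R h t) \<in> borel_measurable M"
      using h \<open>A \<in> sets M\<close> by measurable
    ultimately have "(LINT t|M. indicator A t *\<^sub>R h t) = (LINT t|M. indicator S t *\<^sub>R h t)"
      using int[of S] SN(4) by (intro integral_cong_AE) auto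
    then show "set_lebesgue_integral M A h = 0"
      unfolding set_lebesgue_integral_def using borel SN(4) by simp
  qed
  then show ?thesis unfolding M_def .
qed

section \<open>Primitives and integration over a triangle\<close>

text \<open>The integral from p to t. The indicator keeps one measure space for all t, which suits
  dominated convergence and Fubini.\<close>

definition primitive :: "real \<Rightarrow> real \<Rightarrow> (real \<Rightarrow> 'b::{banach, second_countable_topology}) \<Rightarrow> real \<Rightarrow> 'b"
  where "primitive p q g t = (LINT r|lebesgue_on {p..q}. indicator {..t} r *\<^sub>R g r)"

lemma primitive_left: "primitive p q g p = 0"
proof -
  have "AE r in lebesgue_on {p..q}. indicator {..p} r *\<^sub>R g r = 0"
    using AE_lebesgue_on_neq[where c = p] AE_space by eventually_elim (simp add: indicator_def)
  then show ?thesis unfolding primitive_def by (rule integral_eq_zero_AE)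
qed

lemma primitive_right: "q \<le> t \<Longrightarrow> primitive p q g t = (LINT r|lebesgue_on {p..q}. g r)"
  unfolding primitive_def by (rule Bochner_Integration.integral_cong) (auto simp: indicator_def)

lemma integral_tail_eq_primitive:
  fixes g :: "real \<Rightarrow> 'b::{banach, second_countable_topology}"
  assumes g: "integrable (lebesgue_on {p..q}) g"
  shows "(LINT t|lebesgue_on {p..q}. indicator {r..} t *\<^sub>R g t) = primitive p q g q - primitive p q g r"
proof -
  have "primitive p q g q - primitive p q g r = (LINT t|lebesgue_on {p..q}. g t - indicator {..r} t *\<^sub>R g t)"
    unfolding primitive_right[OF order_refl] unfolding primitive_def
    using g by (simp add: indicator_scaleR_integrable)
  also have "\<dots> = (LINT t|lebesgue_on {p..q}. indicator {r..} t *\<^sub>R g t)"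
  proof (rule integral_cong_AE)
    show "AE t in lebesgue_on {p..q}. g t - indicator {..r} t *\<^sub>R g t = indicator {r..} t *\<^sub>R g t"
      using AE_lebesgue_on_neq[where c = r] by eventually_elim (auto simp: indicator_def)
  qed (use g indicator_scaleR_integrable[OF g, of "{..r}"] indicator_scaleR_integrable[OF g, of "{r..}"] in auto)
  finally show ?thesis by simp
qed

lemma primitive_continuous:
  fixes g :: "real \<Rightarrow> 'b::{banach, second_countable_topology}"
  assumes g: "integrable (lebesgue_on {p..q}) g"
  shows "continuous_on UNIV (primitive p q g)"
  unfolding continuous_on_sequentially
proof (intro allI ballI impI)
  fix X :: "nat \<Rightarrow> real" and t assume "(\<forall>n. X n \<in> UNIV) \<and> X \<longlonglongrightarrow> t"
  then have X: "X \<longlonglongrightarrow> t" by simp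
  have "(\<lambda>n. LINT r|lebesgue_on {p..q}. indicator {..X n} r *\<^sub>R g r) \<longlonglongrightarrow> (LINT r|lebesgue_on {p..q}. indicator {..t} r *\<^sub>R g r)"
  proof (rule integral_dominated_convergence[where w = "\<lambda>r. norm (g r)"])
    show "AE r in lebesgue_on {p..q}. (\<lambda>n. indicator {..X n} r *\<^sub>R g r) \<longlonglongrightarrow> indicator {..t} r *\<^sub>R g r"
      using AE_lebesgue_on_neq[where c = t]
    proof eventually_elim
      case (elim r)
      then consider "r < t" | "t < r" by linarith
      then have "\<forall>\<^sub>F n in sequentially. indicator {..X n} r *\<^sub>R g r = indicator {..t} r *\<^sub>R g r"
      proof cases
        case 1
        then show ?thesis by (intro eventually_mono[OF order_tendstoD(1)[OF X 1]]) (simp add: indicator_def)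
      next
        case 2
        then show ?thesis by (intro eventually_mono[OF order_tendstoD(2)[OF X 2]]) (simp add: indicator_def)
      qed
      then show ?case by (rule tendsto_eventually)
    qed
    show "AE r in lebesgue_on {p..q}. norm (indicator {..X n} r *\<^sub>R g r) \<le> norm (g r)" for n
      by (rule AE_I2) (simp add: indicator_def)
  qed (use g indicator_scaleR_integrable[OF g, of "{..t}"] indicator_scaleR_integrable[OF g, of "{..X _}"] in auto)
  then show "(primitive p q g \<circ> X) \<longlonglongrightarrow> primitive p q g t" by (simp add: primitive_def o_def)
qed

text \<open>Both sides integrate prod (f t) (g r) over the triangle r \<le> t, in the two orders.
  With scalar multiplication it serves as integration by parts against test functions, with the
  inner product it gives the energy identity.\<close>

lemma triangle_Fubini:
  fixes f :: "real \<Rightarrow> 'a::{banach, second_countable_topology}"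
    and g :: "real \<Rightarrow> 'b::{banach, second_countable_topology}"
    and prod :: "'a \<Rightarrow> 'b \<Rightarrow> 'c::{banach, second_countable_topology}"
  assumes bb: "bounded_bilinear prod"
    and f: "integrable (lebesgue_on {p..q}) f" and g: "integrable (lebesgue_on {p..q}) g"
  shows "(LINT t|lebesgue_on {p..q}. prod (f t) (primitive p q g t))
    = (LINT r|lebesgue_on {p..q}. prod (LINT t|lebesgue_on {p..q}. indicator {r..} t *\<^sub>R f t) (g r))"
proof -
  interpret bounded_bilinear prod by (rule bb)
  define M where "M = lebesgue_on {p..q}"
  note f = f[folded M_def] and g = g[folded M_def]
  interpret finite_measure M unfolding M_def by (rule finite_measure_lebesgue_Icc)
  interpret pair_sigma_finite M M ..
  define F where "F t r = indicator {..t} r *\<^sub>R prod (f t) (g r)" for t r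
  obtain K where K: "0 < K" "\<And>x y. norm (prod x y) \<le> norm x * norm y * K" using pos_bounded by blast
  have fm [measurable]: "f \<in> borel_measurable M" and gm [measurable]: "g \<in> borel_measurable M"
    using f g by auto
  have id [measurable]: "(\<lambda>t. t) \<in> borel_measurable M"
    unfolding M_def by (intro measurable_restrict_space1 measurable_completion) simp
  \<comment> \<open>A product of two integrable functions of separate variables dominates the
    integrand on the square.\<close>
  have H: "integrable (M \<Otimes>\<^sub>M M) (\<lambda>z. norm (f (fst z)) * norm (g (snd z)) * K)"
  proof (rule Fubini_integrable)
    have "(\<lambda>x. LINT y|M. norm (norm (f (fst (x, y))) * norm (g (snd (x, y))) * K))
      = (\<lambda>x. norm (f x) * (LINT y|M. norm (g y)) * K)"
      using K(1) by (simp add: abs_mult)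
    then show "integrable M (\<lambda>x. LINT y|M. norm (norm (f (fst (x, y))) * norm (g (snd (x, y))) * K))"
      using f by simp
    show "AE x in M. integrable M (\<lambda>y. norm (f (fst (x, y))) * norm (g (snd (x, y))) * K)"
      using g by simp
  qed measurable
  have "integrable (M \<Otimes>\<^sub>M M) (case_prod F)"
  proof (rule Bochner_Integration.integrable_bound[OF H])
    have "(\<lambda>z. prod (f (fst z)) (g (snd z))) \<in> borel_measurable (M \<Otimes>\<^sub>M M)"
    proof (rule borel_measurable_continuous_Pair[where H = prod])
      show "continuous_on UNIV (\<lambda>x. prod (fst x) (snd x))"
        by (intro continuous_on continuous_intros)
    qed measurable
    then have "(\<lambda>z. if snd z \<le> fst z then prod (f (fst z)) (g (snd z)) else 0) \<in> borel_measurable (M \<Otimes>\<^sub>M M)"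
      by measurable
    moreover have "case_prod F = (\<lambda>z. if snd z \<le> fst z then prod (f (fst z)) (g (snd z)) else 0)"
      by (auto simp: F_def fun_eq_iff)
    ultimately show "case_prod F \<in> borel_measurable (M \<Otimes>\<^sub>M M)" by simp
    have "norm (case_prod F z) \<le> norm (norm (f (fst z)) * norm (g (snd z)) * K)" for z
    proof -
      have "norm (case_prod F z) \<le> norm (prod (f (fst z)) (g (snd z)))"
        by (cases z) (simp add: F_def indicator_def)
      also have "\<dots> \<le> norm (f (fst z)) * norm (g (snd z)) * K" by (rule K(2))
      finally show ?thesis by simp
    qed
    then show "AE z in M \<Otimes>\<^sub>M M. norm (case_prod F z) \<le> norm (norm (f (fst z)) * norm (g (snd z)) * K)" by simp
  qed
  from Fubini_integral[OF this]
  have "(LINT r|M. LINT t|M. F t r) = (LINT t|M. LINT r|M. F t r)" .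
  moreover have "(LINT r|M. F t r) = prod (f t) (primitive p q g t)" for t
  proof -
    have "(LINT r|M. F t r) = (LINT r|M. prod (f t) (indicator {..t} r *\<^sub>R g r))"
      by (simp add: F_def scaleR_right)
    also have "\<dots> = prod (f t) (LINT r|M. indicator {..t} r *\<^sub>R g r)"
      using indicator_scaleR_integrable[OF g[unfolded M_def], of "{..t}"]
      by (intro integral_bounded_linear bounded_linear_right) (simp add: M_def)
    finally show ?thesis by (simp add: primitive_def M_def)
  qed
  moreover have "(LINT t|M. F t r) = prod (LINT t|M. indicator {r..} t *\<^sub>R f t) (g r)" for r
  proof -
    have "(LINT t|M. F t r) = (LINT t|M. prod (indicator {r..} t *\<^sub>R f t) (g r))"
      by (rule Bochner_Integration.integral_cong) (auto simp: F_def scaleR_left indicator_def zero_left)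
    also have "\<dots> = prod (LINT t|M. indicator {r..} t *\<^sub>R f t) (g r)"
      using indicator_scaleR_integrable[OF f[unfolded M_def], of "{r..}"]
      by (intro integral_bounded_linear[OF bounded_linear_left]) (simp add: M_def)
    finally show ?thesis .
  qed
  ultimately show ?thesis unfolding M_def by simp
qed

text \<open>This replaces the chain rule for \<open>(norm (u t))\<^sup>2\<close>, so that no almost everywhere differentiability is needed.\<close>

lemma primitive_norm_square:
  fixes g :: "real \<Rightarrow> 'b::{real_inner, banach, second_countable_topology}"
  assumes g: "integrable (lebesgue_on {p..q}) g" and t: "t \<le> q"
  shows "(norm (primitive p q g t))\<^sup>2
    = 2 * (LINT r|lebesgue_on {p..q}. indicator {..t} r * inner (g r) (primitive p q g r))"
proof -
  define M where "M = lebesgue_on {p..q}"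
  \<comment> \<open>Truncation at t reduces the claim to the full interval, where the total integral
    is P.\<close>
  define g' where "g' r = indicator {..t} r *\<^sub>R g r" for r
  have g': "integrable M g'" unfolding M_def g'_def by (rule indicator_scaleR_integrable[OF g]) simp
  define P where "P = (LINT r|M. g' r)"
  have P: "P = primitive p q g t" unfolding P_def g'_def primitive_def M_def ..
  have Pq: "primitive p q g' q = P" unfolding P_def M_def by (rule primitive_right) simp
  have prim: "primitive p q g' r = primitive p q g r" if "r \<le> t" for r
    unfolding primitive_def g'_def
    by (rule Bochner_Integration.integral_cong) (use that in \<open>auto simp: indicator_def\<close>)
  define X where "X = (LINT r|M. inner (g' r) (primitive p q g' r))"
  have cont: "continuous_on UNIV (primitive p q g')" using g' unfolding M_def by (rule primitive_continuous)
  have int: "integrable M (\<lambda>r. inner (g' r) (primitive p q g' r))"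
  proof -
    have "bounded (primitive p q g' ` {p..q})"
      by (intro compact_imp_bounded compact_continuous_image continuous_on_subset[OF cont]) auto
    then obtain B where B: "\<And>r. r \<in> {p..q} \<Longrightarrow> norm (primitive p q g' r) \<le> B"
      unfolding bounded_iff by blast
    have pm: "primitive p q g' \<in> borel_measurable M" unfolding M_def by (rule borel_measurable_continuous_Icc[OF cont])
    have "integrable M (\<lambda>r. norm (g' r) * B)" using g' by simp
    then show ?thesis
    proof (rule Bochner_Integration.integrable_bound)
      show "(\<lambda>r. inner (g' r) (primitive p q g' r)) \<in> borel_measurable M"
        using g' pm by (intro borel_measurable_inner) auto
      have "AE r in M. r \<in> {p..q}" unfolding M_def by (rule AE_I2) simp
      then show "AE r in M. norm (inner (g' r) (primitive p q g' r)) \<le> norm (norm (g' r) * B)"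
      proof eventually_elim
        case (elim r)
        have "\<bar>inner (g' r) (primitive p q g' r)\<bar> \<le> norm (g' r) * norm (primitive p q g' r)" by (rule Cauchy_Schwarz_ineq2)
        also have "\<dots> \<le> norm (g' r) * B" by (intro mult_left_mono B elim) auto
        finally show ?case by simp
      qed
    qed
  qed
  \<comment> \<open>After the exchange the inner integral is the tail of \<open>g'\<close> beyond r,
    which is P minus the primitive at r. This gives X = |P|^2 - X.\<close>
  have "X = (LINT r|M. inner (LINT t|M. indicator {r..} t *\<^sub>R g' t) (g' r))"
    unfolding X_def M_def by (rule triangle_Fubini[OF bounded_bilinear_inner]) (use g' in \<open>simp_all add: M_def\<close>)
  also have "\<dots> = (LINT r|M. inner P (g' r) - inner (g' r) (primitive p q g' r))"
    using integral_tail_eq_primitive[OF g'[unfolded M_def]] Pq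
    by (simp add: M_def inner_diff_left inner_commute[of "g' _"])
  also have "\<dots> = (LINT r|M. inner P (g' r)) - X"
    unfolding X_def using int g' by (intro Bochner_Integration.integral_diff) auto
  also have "(LINT r|M. inner P (g' r)) = inner P P"
    unfolding P_def using g' by (intro integral_bounded_linear bounded_linear_inner_right)
  finally have "inner P P = 2 * X" by simp
  moreover have "X = (LINT r|M. indicator {..t} r * inner (g r) (primitive p q g r))"
    unfolding X_def by (rule Bochner_Integration.integral_cong) (auto simp: g'_def indicator_def prim)
  ultimately show ?thesis unfolding P[symmetric] M_def by (simp add: power2_norm_eq_inner)
qed

lemma integral_test_function_derivative_tail:
  assumes \<psi>: "test_function p q \<psi>" and pq: "p < q" and r: "r \<in> {p..q}"
  shows "(LINT t|lebesgue_on {p..q}. indicator {r..} t *\<^sub>R deriv \<psi> t) = - \<psi> r"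
proof -
  obtain c d where "\<And>t. t \<notin> {c..d} \<Longrightarrow> \<psi> t = 0" "p < c" "d < q"
    using test_function_support[OF \<psi> pq] by metis
  then have q0: "\<psi> q = 0" by simp
  interpret finite_measure "lebesgue_on {p..q}" by (rule finite_measure_lebesgue_Icc)
  have "integrable (lebesgue_on {p..q}) (deriv \<psi>)"
    using test_function_scaleR_integrable(2)[OF \<psi> pq, of "\<lambda>_. 1 :: real"] by simp
  then have "integrable (lebesgue_on {p..q}) (\<lambda>t. indicator {r..} t *\<^sub>R deriv \<psi> t)"
    by (rule indicator_scaleR_integrable) simp
  then have "(LINT t|lebesgue_on {p..q}. indicator {r..} t *\<^sub>R deriv \<psi> t) = integral {p..q} (\<lambda>t. indicator {r..} t *\<^sub>R deriv \<psi> t)"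
    by (rule lebesgue_integral_eq_integral) simp
  also have "\<dots> = integral {p..q} (\<lambda>t. if t \<in> {r..} then deriv \<psi> t else 0)"
    by (rule integral_cong) (simp add: indicator_def)
  also have "\<dots> = integral ({r..} \<inter> {p..q}) (deriv \<psi>)"
    by (rule Henstock_Kurzweil_Integration.integral_restrict_Int)
  also have "{r..} \<inter> {p..q} = {r..q}" using r by auto
  also have "integral {r..q} (deriv \<psi>) = \<psi> q - \<psi> r"
    using r by (intro integral_unique fundamental_theorem_of_calculus)
      (auto intro!: has_field_derivative_at_within[OF test_function_derivative(1)[OF \<psi>]]
        simp: has_real_derivative_iff_has_vector_derivative[symmetric])
  finally show ?thesis using q0 by simp
qed

lemma primitive_weak_derivative:
  fixes g :: "real \<Rightarrow> 'b::{banach, second_countable_topology}"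
  assumes g: "integrable (lebesgue_on {p..q}) g" and pq: "p < q" and \<psi>: "test_function p q \<psi>"
  shows "(LINT t|lebesgue_on {p..q}. deriv \<psi> t *\<^sub>R primitive p q g t) = - (LINT t|lebesgue_on {p..q}. \<psi> t *\<^sub>R g t)"
proof -
  interpret finite_measure "lebesgue_on {p..q}" by (rule finite_measure_lebesgue_Icc)
  have d: "integrable (lebesgue_on {p..q}) (deriv \<psi>)"
    using test_function_scaleR_integrable(2)[OF \<psi> pq, of "\<lambda>_. 1 :: real"] by simp
  have "(LINT t|lebesgue_on {p..q}. deriv \<psi> t *\<^sub>R primitive p q g t)
    = (LINT r|lebesgue_on {p..q}. (LINT t|lebesgue_on {p..q}. indicator {r..} t *\<^sub>R deriv \<psi> t) *\<^sub>R g r)"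
    by (rule triangle_Fubini[OF bounded_bilinear_scaleR d g])
  also have "\<dots> = (LINT r|lebesgue_on {p..q}. - (\<psi> r *\<^sub>R g r))"
    by (rule Bochner_Integration.integral_cong)
      (use integral_test_function_derivative_tail[OF \<psi> pq] in auto)
  finally show ?thesis by simp
qed

section \<open>Recovering a function from its weak derivative\<close>

text \<open>The vanishing mean is what makes the primitive return to 0 to the right of the support,
  so that it has compact support itself.\<close>

lemma test_function_primitive:
  fixes \<zeta> :: "real \<Rightarrow> real"
  assumes cont: "continuous_on UNIV \<zeta>" and supp: "\<And>t. t \<notin> {c..d} \<Longrightarrow> \<zeta> t = 0"
    and cd: "p < c" "c < d" "d < q" and zero: "integral {p..q} \<zeta> = 0"
  shows "\<exists>\<psi>. test_function p q \<psi> \<and> deriv \<psi> = \<zeta>"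
proof -
  define \<psi> where "\<psi> t = integral {p..t} \<zeta>" for t
  have int: "\<zeta> integrable_on {a..b}" for a b
    by (intro integrable_continuous_interval continuous_on_subset[OF cont]) auto
  have left: "\<psi> t = 0" if "t < c" for t
    unfolding \<psi>_def using supp that by (intro integral_unique has_integral_is_0) auto
  have right: "\<psi> t = 0" if "d < t" for t
  proof -
    have upto: "integral {p..s} \<zeta> = integral {p..d} \<zeta>" if "d < s" for s
    proof -
      have "integral {p..s} \<zeta> = integral {p..d} \<zeta> + integral {d..s} \<zeta>"
        using cd that by (intro Henstock_Kurzweil_Integration.integral_combine[symmetric] int) auto
      moreover have "\<zeta> d = 0"
      proof -
        have "(\<lambda>n. \<zeta> (d + inverse (real (Suc n)))) \<longlonglongrightarrow> \<zeta> (d + 0)"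
          using cont by (intro isCont_tendsto_compose[of _ \<zeta>] tendsto_add tendsto_const LIMSEQ_inverse_real_of_nat)
            (simp add: continuous_on_eq_continuous_at)
        then show ?thesis using supp by (simp add: LIMSEQ_const_iff)
      qed
      then have "\<zeta> x = 0" if "x \<in> {d..s}" for x using supp[of x] that by (cases "x = d") auto
      then have "integral {d..s} \<zeta> = 0"
        by (intro integral_unique has_integral_is_0) auto
      ultimately show ?thesis by simp
    qed
    show ?thesis unfolding \<psi>_def using upto[OF that] upto[OF cd(3)] zero by simp
  qed
  have "(\<psi> has_real_derivative \<zeta> t) (at t)" for t
  proof (cases "t < c")
    case True
    have "(\<psi> has_real_derivative 0) (at t)"
      by (rule has_field_derivative_transform_within_open[OF DERIV_const, of "{..<c}" _ 0]) (use True left in auto)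
    then show ?thesis using supp True by simp
  next
    case False
    have "((\<lambda>t. integral {p..t} \<zeta>) has_vector_derivative \<zeta> t) (at t within {p..t + 1})"
      using False cd by (intro integral_has_vector_derivative continuous_on_subset[OF cont]) auto
    moreover have "at t within {p..t + 1} = at t"
      using False cd by (intro at_within_interior) (simp add: interior_atLeastAtMost_real)
    ultimately show ?thesis by (simp add: has_real_derivative_iff_has_vector_derivative \<psi>_def[abs_def])
  qed
  from test_functionI[OF this cont, of c d p q] left right cd show ?thesis
    by (metis atLeastAtMost_iff not_le)
qed

text \<open>Lemma of du Bois-Reymond: subtracting a multiple of one fixed test function gives any
  test function mean zero, hence makes it a derivative of a test function.\<close>

lemma constant_of_weak_derivative_zero:
  fixes F :: "real \<Rightarrow> 'b::{banach, second_countable_topology}"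
  assumes pq: "p < q" and F: "integrable (lebesgue_on {p..q}) F"
    and zero: "\<And>\<psi>. test_function p q \<psi> \<Longrightarrow> (LINT t|lebesgue_on {p..q}. deriv \<psi> t *\<^sub>R F t) = 0"
  shows "\<exists>c. AE t in lebesgue_on {p..q}. F t = c"
proof -
  define M where "M = lebesgue_on {p..q}"
  note F = F[folded M_def] and zero = zero[folded M_def]
  interpret finite_measure M unfolding M_def by (rule finite_measure_lebesgue_Icc)
  have test_int: "integrable M \<psi>" if "test_function p q \<psi>" for \<psi>
    using test_function_scaleR_integrable(1)[OF that pq, of "\<lambda>_. 1 :: real"] by (simp add: M_def finite_measure_lebesgue_Icc[THEN finite_measure.integrable_const])
  \<comment> \<open>If all test functions had integral zero, the constant 1 would vanish almost
    everywhere by the fundamental lemma.\<close>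
  have "\<exists>\<eta>. test_function p q \<eta> \<and> (LINT t|M. \<eta> t) \<noteq> 0"
  proof (rule ccontr)
    assume "\<not> ?thesis"
    then have "AE t in lebesgue_on {p..q}. (1::real) = 0"
      by (intro AE_zero_of_test_functions[OF pq]) (auto simp: M_def finite_measure_lebesgue_Icc[THEN finite_measure.integrable_const])
    from AE_lebesgue_on_witness[OF this order_refl pq order_refl] show False by simp
  qed
  then obtain \<eta>0 where \<eta>0: "test_function p q \<eta>0" "(LINT t|M. \<eta>0 t) \<noteq> 0" by blast
  define I where "I \<eta> = (LINT t|M. \<eta> t)" for \<eta> :: "real \<Rightarrow> real"
  \<comment> \<open>The mean of \<open>F\<close> weighted by \<eta>0; for a constant function it
    returns that constant.\<close>
  define c where "c = (1 / I \<eta>0) *\<^sub>R (LINT t|M. \<eta>0 t *\<^sub>R F t)"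
  have I0: "I \<eta>0 \<noteq> 0" using \<eta>0(2) unfolding I_def .
  have "(LINT t|M. \<eta> t *\<^sub>R (F t - c)) = 0" if \<eta>: "test_function p q \<eta>" for \<eta>
  proof -
    define \<zeta> where "\<zeta> t = \<eta> t - (I \<eta> / I \<eta>0) * \<eta>0 t" for t
    obtain c1 d1 where s1: "p < c1" "c1 < d1" "d1 < q" "\<And>t. t \<notin> {c1..d1} \<Longrightarrow> \<eta> t = 0"
      using test_function_support[OF \<eta> pq] by metis
    obtain c2 d2 where s2: "p < c2" "c2 < d2" "d2 < q" "\<And>t. t \<notin> {c2..d2} \<Longrightarrow> \<eta>0 t = 0"
      using test_function_support[OF \<eta>0(1) pq] by metis
    have \<zeta>_int: "integrable M \<zeta>" unfolding \<zeta>_def using test_int[OF \<eta>] test_int[OF \<eta>0(1)] by simp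
    have "integral {p..q} \<zeta> = (LINT t|M. \<zeta> t)"
      using \<zeta>_int unfolding M_def by (intro lebesgue_integral_eq_integral[symmetric]) auto
    also have "\<dots> = I \<eta> - (I \<eta> / I \<eta>0) * I \<eta>0"
      unfolding \<zeta>_def I_def using test_int[OF \<eta>] test_int[OF \<eta>0(1)] by simp
    finally have z: "integral {p..q} \<zeta> = 0" using I0 by simp
    have "\<exists>\<psi>. test_function p q \<psi> \<and> deriv \<psi> = \<zeta>"
    proof (rule test_function_primitive[where c = "min c1 c2" and d = "max d1 d2"])
      show "continuous_on UNIV \<zeta>" unfolding \<zeta>_def
        by (intro continuous_intros test_function_derivative(3)[OF \<eta>] test_function_derivative(3)[OF \<eta>0(1)])
      show "\<zeta> t = 0" if "t \<notin> {min c1 c2..max d1 d2}" for t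
      proof -
        have "t \<notin> {c1..d1}" "t \<notin> {c2..d2}" using that by auto
        then have "\<eta> t = 0" "\<eta>0 t = 0" using s1(4) s2(4) by blast+
        then show ?thesis unfolding \<zeta>_def by simp
      qed
    qed (use s1 s2 z in auto)
    then obtain \<psi> where "test_function p q \<psi>" "deriv \<psi> = \<zeta>" by blast
    then have \<zeta>F: "(LINT t|M. \<zeta> t *\<^sub>R F t) = 0" using zero by metis
    have \<eta>F: "integrable M (\<lambda>t. \<eta> t *\<^sub>R F t)" and \<eta>0F: "integrable M (\<lambda>t. \<eta>0 t *\<^sub>R F t)"
      using test_function_scaleR_integrable(1)[OF \<eta> pq F[unfolded M_def]]
        test_function_scaleR_integrable(1)[OF \<eta>0(1) pq F[unfolded M_def]] unfolding M_def by auto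
    have "(LINT t|M. \<zeta> t *\<^sub>R F t) = (LINT t|M. \<eta> t *\<^sub>R F t - (I \<eta> / I \<eta>0) *\<^sub>R (\<eta>0 t *\<^sub>R F t))"
      unfolding \<zeta>_def by (simp add: scaleR_diff_left)
    also have "\<dots> = (LINT t|M. \<eta> t *\<^sub>R F t) - (I \<eta> / I \<eta>0) *\<^sub>R (LINT t|M. \<eta>0 t *\<^sub>R F t)"
      using \<eta>F \<eta>0F by (simp del: scaleR_scaleR)
    also have "\<dots> = (LINT t|M. \<eta> t *\<^sub>R F t) - I \<eta> *\<^sub>R c" unfolding c_def by simp
    finally have "(LINT t|M. \<eta> t *\<^sub>R F t) = I \<eta> *\<^sub>R c" using \<zeta>F by simp
    moreover have "(LINT t|M. \<eta> t *\<^sub>R (F t - c)) = (LINT t|M. \<eta> t *\<^sub>R F t) - I \<eta> *\<^sub>R c"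
      unfolding I_def using \<eta>F test_int[OF \<eta>] by (simp add: scaleR_diff_right)
    ultimately show ?thesis by simp
  qed
  then have "AE t in lebesgue_on {p..q}. F t - c = 0"
    using F unfolding M_def
    by (intro AE_zero_of_test_functions[OF pq]) (auto simp: finite_measure_lebesgue_Icc[THEN finite_measure.integrable_const])
  then show ?thesis by auto
qed

lemma weak_derivative_unique:
  assumes pq: "p < q" and g: "has_L2_weak_deriv p q f g" and h: "has_L2_weak_deriv p q f h"
  shows "AE t in lebesgue_on {p..q}. g t = h t"
proof -
  have gi: "integrable (lebesgue_on {p..q}) g" and hi: "integrable (lebesgue_on {p..q}) h"
    using g h unfolding has_L2_weak_deriv_def by (auto intro: in_L2_integrable)
  have "AE t in lebesgue_on {p..q}. g t - h t = 0"
  proof (rule AE_zero_of_test_functions[OF pq])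
    show "integrable (lebesgue_on {p..q}) (\<lambda>t. g t - h t)" using gi hi by simp
    fix \<psi> assume \<psi>: "test_function p q \<psi>"
    have "(LINT t|lebesgue_on {p..q}. \<psi> t *\<^sub>R (g t - h t))
      = (LINT t|lebesgue_on {p..q}. \<psi> t *\<^sub>R g t) - (LINT t|lebesgue_on {p..q}. \<psi> t *\<^sub>R h t)"
      using test_function_scaleR_integrable(1)[OF \<psi> pq gi] test_function_scaleR_integrable(1)[OF \<psi> pq hi]
      by (simp add: scaleR_diff_right)
    also have "\<dots> = 0"
    proof -
      have "(LINT t|lebesgue_on {p..q}. deriv \<psi> t *\<^sub>R f t) = - (LINT t|lebesgue_on {p..q}. \<psi> t *\<^sub>R g t)"
        "(LINT t|lebesgue_on {p..q}. deriv \<psi> t *\<^sub>R f t) = - (LINT t|lebesgue_on {p..q}. \<psi> t *\<^sub>R h t)"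
        using g h \<psi> unfolding has_L2_weak_deriv_def by blast+
      then show ?thesis by simp
    qed
    finally show "(LINT t|lebesgue_on {p..q}. \<psi> t *\<^sub>R (g t - h t)) = 0" .
  qed
  then show ?thesis by simp
qed

lemma weak_deriv_AE:
  assumes "p < q" "has_L2_weak_deriv p q f g"
  shows "AE t in lebesgue_on {p..q}. weak_deriv p q f t = g t"
    and "has_L2_weak_deriv p q f (weak_deriv p q f)"
proof -
  show *: "has_L2_weak_deriv p q f (weak_deriv p q f)"
    unfolding weak_deriv_def using someI[of "has_L2_weak_deriv p q f", OF assms(2)] .
  show "AE t in lebesgue_on {p..q}. weak_deriv p q f t = g t"
    by (rule weak_derivative_unique[OF assms(1) * assms(2)])
qed

text \<open>The function minus the primitive of its weak derivative is constant almost everywhere.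
  The initial value, which refers to a continuous representative, then identifies the
  constant.\<close>

lemma weak_derivative_representation:
  assumes pq: "p < q" and f: "integrable (lebesgue_on {p..q}) f" and g: "has_L2_weak_deriv p q f g"
    and init: "has_initial_value p q f y"
  shows "AE t in lebesgue_on {p..q}. f t = y + primitive p q g t"
proof -
  have gi: "integrable (lebesgue_on {p..q}) g"
    using g unfolding has_L2_weak_deriv_def by (auto intro: in_L2_integrable)
  note prim_cont = primitive_continuous[OF gi]
  interpret finite_measure "lebesgue_on {p..q}" by (rule finite_measure_lebesgue_Icc)
  have prim_int: "integrable (lebesgue_on {p..q}) (primitive p q g)"
  proof -
    have "bounded (primitive p q g ` {p..q})"
      by (intro compact_imp_bounded compact_continuous_image continuous_on_subset[OF prim_cont]) auto
    then obtain B where B: "\<And>r. r \<in> {p..q} \<Longrightarrow> norm (primitive p q g r) \<le> B"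
      unfolding bounded_iff by blast
    show ?thesis
      using B by (intro integrable_const_bound[of _ B] AE_I2 borel_measurable_continuous_Icc[OF prim_cont]) auto
  qed
  have "\<exists>c. AE t in lebesgue_on {p..q}. f t - primitive p q g t = c"
  proof (rule constant_of_weak_derivative_zero[OF pq])
    show "integrable (lebesgue_on {p..q}) (\<lambda>t. f t - primitive p q g t)" using f prim_int by simp
    fix \<psi> assume \<psi>: "test_function p q \<psi>"
    have "(LINT t|lebesgue_on {p..q}. deriv \<psi> t *\<^sub>R (f t - primitive p q g t))
      = (LINT t|lebesgue_on {p..q}. deriv \<psi> t *\<^sub>R f t) - (LINT t|lebesgue_on {p..q}. deriv \<psi> t *\<^sub>R primitive p q g t)"
      using test_function_scaleR_integrable(2)[OF \<psi> pq f] test_function_scaleR_integrable(2)[OF \<psi> pq prim_int]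
      by (simp add: scaleR_diff_right)
    also have "\<dots> = 0"
      using g \<psi> primitive_weak_derivative[OF gi pq \<psi>] unfolding has_L2_weak_deriv_def by simp
    finally show "(LINT t|lebesgue_on {p..q}. deriv \<psi> t *\<^sub>R (f t - primitive p q g t)) = 0" .
  qed
  then obtain c where c: "AE t in lebesgue_on {p..q}. f t - primitive p q g t = c" by blast
  obtain k where k: "continuous_on {p..q} k" "AE t in lebesgue_on {p..q}. k t = f t" "k p = y"
    using init unfolding has_initial_value_def by blast
  have kc: "AE t in lebesgue_on {p..q}. k t = c + primitive p q g t"
    using k(2) c by eventually_elim (simp add: algebra_simps)
  \<comment> \<open>Equality holds only almost everywhere, possibly not at p itself, so it is used
    at points tending to p and passed to the limit by continuity.\<close>
  have "\<exists>t. p < t \<and> t < p + (q - p) / real (Suc n) \<and> k t = c + primitive p q g t" for n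
  proof (rule AE_lebesgue_on_witness[OF kc])
    have "(q - p) / real (Suc n) \<le> (q - p) / 1" using pq by (intro divide_left_mono) auto
    then show "p + (q - p) / real (Suc n) \<le> q" by simp
  qed (use pq in auto)
  then obtain X where X: "\<And>n. p < X n" "\<And>n. X n < p + (q - p) / real (Suc n)" "\<And>n. k (X n) = c + primitive p q g (X n)"
    by metis
  have Xp: "X \<longlonglongrightarrow> p"
  proof (rule tendsto_sandwich)
    show "(\<lambda>n. p) \<longlonglongrightarrow> p" by simp
    have "(\<lambda>n. p + (q - p) * inverse (real (Suc n))) \<longlonglongrightarrow> p + (q - p) * 0"
      by (intro tendsto_intros LIMSEQ_inverse_real_of_nat)
    then show "(\<lambda>n. p + (q - p) / real (Suc n)) \<longlonglongrightarrow> p" by (simp add: divide_inverse)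
  qed (use X in \<open>auto intro!: always_eventually less_imp_le\<close>)
  have Xq: "X n \<in> {p..q}" for n
  proof -
    have "(q - p) / real (Suc n) \<le> (q - p) / 1" using pq by (intro divide_left_mono) auto
    then show ?thesis using X(1)[of n] X(2)[of n] by simp
  qed
  have "(\<lambda>n. k (X n)) \<longlonglongrightarrow> k p"
    using k(1) Xp Xq pq unfolding continuous_on_sequentially by (auto simp: o_def)
  moreover have "(\<lambda>n. c + primitive p q g (X n)) \<longlonglongrightarrow> c + primitive p q g p"
    using prim_cont Xp unfolding continuous_on_sequentially by (intro tendsto_intros) (auto simp: o_def)
  ultimately have "k p = c + primitive p q g p" unfolding X(3) by (rule LIMSEQ_unique)
  then have "c = y" using k(3) by (simp add: primitive_left)
  then show ?thesis using c by (auto simp: algebra_simps elim!: eventually_mono)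
qed

section \<open>Classical derivatives and L2 estimates\<close>

text \<open>The derivative may be unbounded near the endpoints, as happens for solutions near the
  initial time. The fundamental theorem is therefore applied on a compact subinterval whose interior
  contains the support of the test function.\<close>

lemma has_L2_weak_deriv_classical:
  fixes f :: "real \<Rightarrow> 'b::{complex_hilbert, second_countable_topology}"
  assumes pq: "p < q" and f: "integrable (lebesgue_on {p..q}) f" and g: "in_L2 p q g"
    and deriv: "\<And>t. p < t \<Longrightarrow> t < q \<Longrightarrow> (f has_vector_derivative g t) (at t)"
  shows "has_L2_weak_deriv p q f g"
  unfolding has_L2_weak_deriv_def
proof (intro conjI allI impI g)
  fix \<psi> assume \<psi>: "test_function p q \<psi>"
  obtain c d where cd: "p < c" "c < d" "d < q" "\<And>t. t \<notin> {c..d} \<Longrightarrow> \<psi> t = 0"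
    using test_function_support[OF \<psi> pq] by metis
  define c' d' where "c' = (p + c) / 2" and "d' = (d + q) / 2"
  have cd': "p < c'" "c' < c" "d < d'" "d' < q" "c' < d'" unfolding c'_def d'_def using cd by auto
  have dsupp: "deriv \<psi> t = 0" if "t \<notin> {c..d}" for t
    by (rule test_function_derivative_support[OF \<psi> cd(4) that])
  have gi: "integrable (lebesgue_on {p..q}) g" by (rule in_L2_integrable[OF g])
  define u where "u t = deriv \<psi> t *\<^sub>R f t + \<psi> t *\<^sub>R g t" for t
  note int = test_function_scaleR_integrable(2)[OF \<psi> pq f] test_function_scaleR_integrable(1)[OF \<psi> pq gi]
  have ui: "integrable (lebesgue_on {p..q}) u" unfolding u_def using int by simp
  define I where "I = (LINT t|lebesgue_on {p..q}. u t)"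
  \<comment> \<open>Pairing with the vector integral I itself leaves a scalar integral; once it
    vanishes, so does I.\<close>
  have "inner I I = (LINT t|lebesgue_on {p..q}. inner (u t) I)"
    unfolding I_def using ui by simp
  also have "\<dots> = integral {p..q} (\<lambda>t. inner (u t) I)"
    using ui by (intro lebesgue_integral_eq_integral) auto
  also have "\<dots> = 0"
  proof (rule integral_unique)
    have "((\<lambda>t. inner (u t) I) has_integral \<psi> d' * inner (f d') I - \<psi> c' * inner (f c') I) {c'..d'}"
    proof (rule fundamental_theorem_of_calculus)
      fix t assume t: "t \<in> {c'..d'}"
      have "(f has_vector_derivative g t) (at t)" using t cd' by (intro deriv) auto
      then have "((\<lambda>t. inner (f t) I) has_real_derivative inner (g t) I) (at t)"
        unfolding has_real_derivative_iff_has_vector_derivative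
        by (rule bounded_linear.has_vector_derivative[OF bounded_linear_inner_left])
      from DERIV_mult[OF test_function_derivative(1)[OF \<psi>] this]
      have "((\<lambda>t. \<psi> t * inner (f t) I) has_real_derivative inner (u t) I) (at t)"
        by (rule DERIV_cong) (simp add: u_def inner_add_left)
      then show "((\<lambda>t. \<psi> t * inner (f t) I) has_vector_derivative inner (u t) I) (at t within {c'..d'})"
        unfolding has_real_derivative_iff_has_vector_derivative by (rule has_vector_derivative_at_within)
    qed (use cd' in simp)
    moreover have "\<psi> c' = 0" by (rule cd(4)) (use cd' in simp)
    moreover have "\<psi> d' = 0" by (rule cd(4)) (use cd' in simp)
    ultimately have "((\<lambda>t. inner (u t) I) has_integral 0) {c'..d'}" by simp
    then show "((\<lambda>t. inner (u t) I) has_integral 0) {p..q}"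
    proof (rule has_integral_on_superset)
      fix t assume "t \<notin> {c'..d'}"
      then have "t \<notin> {c..d}" using cd' by auto
      then show "inner (u t) I = 0" using cd(4) dsupp by (simp add: u_def)
    qed (use cd' in auto)
  qed
  finally have "I = 0" by simp
  then show "(LINT t|lebesgue_on {p..q}. deriv \<psi> t *\<^sub>R f t) = - (LINT t|lebesgue_on {p..q}. \<psi> t *\<^sub>R g t)"
    unfolding I_def u_def using int by (simp add: eq_neg_iff_add_eq_0)
qed

lemma norm_L2_cong:
  assumes "in_L2 p q f" "in_L2 p q g" "AE t in lebesgue_on {p..q}. norm (f t) = norm (g t)"
  shows "norm_L2 p q f = norm_L2 p q g"
  unfolding norm_L2_def
  using assms by (intro arg_cong[of _ _ sqrt] integral_cong_AE) (auto simp: in_L2_def elim!: eventually_mono)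

lemma norm_L2_le:
  assumes "0 \<le> B" and "(LINT t|lebesgue_on {p..q}. (norm (f t))\<^sup>2) \<le> B\<^sup>2"
  shows "norm_L2 p q f \<le> B"
  unfolding norm_L2_def using assms real_le_lsqrt real_sqrt_le_iff by (metis real_sqrt_abs abs_of_nonneg)

lemma in_L2_bounded:
  fixes f :: "real \<Rightarrow> 'b::{complex_hilbert, second_countable_topology}"
  assumes f: "f \<in> borel_measurable (lebesgue_on {p..q})" and B: "\<And>t. t \<in> {p..q} \<Longrightarrow> norm (f t) \<le> B" and pq: "p \<le> q"
  shows "in_L2 p q f" "norm_L2 p q f \<le> sqrt (q - p) * B"
proof -
  interpret finite_measure "lebesgue_on {p..q}" by (rule finite_measure_lebesgue_Icc)
  have B0: "0 \<le> B" using B[of p] norm_ge_zero[of "f p"] pq by (simp del: norm_ge_zero)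
  have sq: "(norm (f t))\<^sup>2 \<le> B\<^sup>2" if "t \<in> {p..q}" for t using B[OF that] by (intro power_mono) auto
  have int: "integrable (lebesgue_on {p..q}) (\<lambda>t. (norm (f t))\<^sup>2)"
    using f sq by (intro integrable_const_bound[of _ "B\<^sup>2"] AE_I2) auto
  then show "in_L2 p q f" using f unfolding in_L2_def by simp
  show "norm_L2 p q f \<le> sqrt (q - p) * B"
  proof (rule norm_L2_le)
    have "(LINT t|lebesgue_on {p..q}. (norm (f t))\<^sup>2) \<le> (LINT t|lebesgue_on {p..q}. B\<^sup>2)"
      using int sq by (intro integral_mono) auto
    also have "\<dots> = (q - p) * B\<^sup>2" using pq by (simp add: measure_restrict_space)
    finally show "(LINT t|lebesgue_on {p..q}. (norm (f t))\<^sup>2) \<le> (sqrt (q - p) * B)\<^sup>2"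
      using pq by (simp add: power_mult_distrib)
  qed (use pq B0 in simp)
qed

lemma integral_lebesgue_on_eq_lborel:
  fixes h :: "real \<Rightarrow> real"
  assumes h: "integrable lborel h" and supp: "\<And>t. t \<notin> {p..q} \<Longrightarrow> h t = 0"
  shows "integrable (lebesgue_on {p..q}) h" "(LINT t|lebesgue_on {p..q}. h t) = (LINT t|lborel. h t)"
proof -
  have eq: "(\<lambda>t. indicator {p..q} t *\<^sub>R h t) = h" using supp by (auto simp: fun_eq_iff indicator_def)
  have "integrable lebesgue h" using h by (simp add: integrable_completion)
  then show "integrable (lebesgue_on {p..q}) h" by (simp add: integrable_restrict_space eq del: real_scaleR_def)
  show "(LINT t|lebesgue_on {p..q}. h t) = (LINT t|lborel. h t)"
    using h by (simp add: integral_restrict_space eq integral_completion del: real_scaleR_def)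
qed

text \<open>Needed to replace \<open>AH\<close>, which is cut off at the endpoints, by the operator
  applied to the solution, whose endpoint values are not controlled.\<close>

lemma in_L2_cong_interior:
  assumes f: "in_L2 p q f" and eq: "\<And>t. p < t \<Longrightarrow> t < q \<Longrightarrow> g t = f t"
  shows "in_L2 p q g" "norm_L2 p q g = norm_L2 p q f"
proof -
  have fm: "f \<in> borel_measurable (lebesgue_on {p..q})" and fi: "integrable (lebesgue_on {p..q}) (\<lambda>t. (norm (f t))\<^sup>2)"
    using f unfolding in_L2_def by auto
  have gm: "g \<in> borel_measurable (lebesgue_on {p..q})"
  proof (rule measurable_discrete_difference[OF fm, of "{p, q} \<inter> {p..q}"])
    show "{x} \<in> sets (lebesgue_on {p..q})" if "x \<in> {p, q} \<inter> {p..q}" for x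
      using that by (simp add: sets_restrict_space_iff)
    show "f x = g x" if "x \<in> space (lebesgue_on {p..q})" "x \<notin> {p, q} \<inter> {p..q}" for x
      using that eq[of x] by (cases "x = p"; cases "x = q") auto
  qed auto
  have ae: "AE t in lebesgue_on {p..q}. (norm (g t))\<^sup>2 = (norm (f t))\<^sup>2"
    using AE_lebesgue_on_neq[where c = p] AE_lebesgue_on_neq[where c = q] AE_space
    by eventually_elim (simp add: eq)
  show "in_L2 p q g" unfolding in_L2_def
    using gm fm fi ae by (auto intro!: integrable_cong_AE_imp[OF fi] elim!: eventually_mono)
  show "norm_L2 p q g = norm_L2 p q f" unfolding norm_L2_def
    using gm fm ae by (intro arg_cong[of _ _ sqrt] integral_cong_AE) auto
qed

lemma norm_L2_nonneg: "0 \<le> norm_L2 p q f"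
  by (simp add: norm_L2_def)

lemma norm_L2_square: "(norm_L2 p q f)\<^sup>2 = (LINT t|lebesgue_on {p..q}. (norm (f t))\<^sup>2)"
  by (simp add: norm_L2_def)

text \<open>Since only the existence of a constant matters later, |x + y|^2 \<le> 2 |x|^2 + 2 |y|^2
  is enough in place of the triangle inequality.\<close>

lemma norm_L2_add_le:
  assumes f: "in_L2 p q f" and g: "in_L2 p q g"
  shows "norm_L2 p q (\<lambda>t. f t + g t) \<le> 2 * norm_L2 p q f + 2 * norm_L2 p q g"
proof (rule norm_L2_le)
  have "(LINT t|lebesgue_on {p..q}. (norm (f t + g t))\<^sup>2)
    \<le> (LINT t|lebesgue_on {p..q}. 2 * (norm (f t))\<^sup>2 + 2 * (norm (g t))\<^sup>2)"
    using in_L2_add[OF f g] f g by (intro integral_mono) (auto simp: in_L2_def norm_add_square_le)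
  also have "\<dots> = 2 * (norm_L2 p q f)\<^sup>2 + 2 * (norm_L2 p q g)\<^sup>2"
    using f g by (simp add: norm_L2_square in_L2_def)
  also have "\<dots> \<le> (2 * norm_L2 p q f + 2 * norm_L2 p q g)\<^sup>2"
    using norm_L2_nonneg[of p q f] norm_L2_nonneg[of p q g] by (simp add: power2_sum)
  finally show "(LINT t|lebesgue_on {p..q}. (norm (f t + g t))\<^sup>2) \<le> (2 * norm_L2 p q f + 2 * norm_L2 p q g)\<^sup>2" .
qed (simp add: norm_L2_nonneg)

section \<open>The Galerkin approximation\<close>

lemma cinner_add_right: "cinner x (y + z) = cinner x y + cinner x z"
  by (subst (1 2 3) cinner_commute) (simp add: cinner_add_left)

lemma cinner_scaleC_right: "cinner x (c *\<^sub>C y) = cnj c * cinner x y"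
  by (subst (1 2) cinner_commute) (simp add: cinner_scaleC_left)

lemma cinner_zero_left [simp]: "cinner 0 y = 0"
  using cinner_add_left[of 0 0 y] by simp

lemma cinner_zero_right [simp]: "cinner x 0 = 0"
  using cinner_add_right[of x 0 0] by simp

lemma scaleC_minus1: "(- 1) *\<^sub>C x = - (x :: 'a::complex_hilbert)"
  using scaleC_of_real[of "- 1" x] by simp

lemma cinner_minus_left: "cinner (- x) y = - cinner x y"
  using cinner_scaleC_left[of "- 1" x y] by (simp add: scaleC_minus1)

lemma cinner_minus_right: "cinner x (- y) = - cinner x y"
  using cinner_scaleC_right[of x "- 1" y] by (simp add: scaleC_minus1)

lemma cinner_diff_left: "cinner (x - y) z = cinner x z - cinner y z"
  using cinner_add_left[of x "- y" z] by (simp add: cinner_minus_left)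

lemma cinner_diff_right: "cinner x (y - z) = cinner x y - cinner x z"
  using cinner_add_right[of x y "- z"] by (simp add: cinner_minus_right)

lemma cinner_sum_left: "cinner (\<Sum>i\<in>I. f i) y = (\<Sum>i\<in>I. cinner (f i) y)"
  by (induction I rule: infinite_finite_induct) (simp_all add: cinner_add_left)

lemma cinner_sum_right: "cinner x (\<Sum>i\<in>I. f i) = (\<Sum>i\<in>I. cinner x (f i))"
  by (induction I rule: infinite_finite_induct) (simp_all add: cinner_add_right)

text \<open>The imaginary part is the real product with i y. A real identity valid for all test
  vectors of a complex subspace therefore implies the complex one.\<close>

lemma cinner_eq_Complex: "cinner x y = Complex (inner x y) (inner x (\<i> *\<^sub>C y))"
proof (rule complex_eqI)
  show "Re (cinner x y) = Re (Complex (inner x y) (inner x (\<i> *\<^sub>C y)))" by (simp add: Re_cinner)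
  have "inner x (\<i> *\<^sub>C y) = Im (cinner x y)"
    unfolding Re_cinner[symmetric] cinner_scaleC_right by simp
  then show "Im (cinner x y) = Im (Complex (inner x y) (inner x (\<i> *\<^sub>C y)))" by simp
qed

lemma cinner_self: "cinner x x = complex_of_real ((norm x)\<^sup>2)"
proof (rule complex_eqI)
  have "Im (cinner x x) = - Im (cinner x x)" by (subst (1) cinner_commute) simp
  then show "Im (cinner x x) = Im (complex_of_real ((norm x)\<^sup>2))" by simp
qed (simp add: Re_cinner power2_norm_eq_inner)

lemma cinner_self_eq_0_iff: "cinner x x = 0 \<longleftrightarrow> x = 0"
  by (simp add: cinner_self)

lemma norm_scaleC: "norm (c *\<^sub>C x) = cmod c * norm (x :: 'a::complex_hilbert)"
proof -
  have "complex_of_real ((norm (c *\<^sub>C x))\<^sup>2) = c * cnj c * cinner x x"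
    unfolding cinner_self[symmetric] by (simp add: cinner_scaleC_left cinner_scaleC_right)
  also have "\<dots> = complex_of_real ((cmod c * norm x)\<^sup>2)"
    by (simp add: cinner_self complex_norm_square[symmetric] power_mult_distrib)
  finally have "(norm (c *\<^sub>C x))\<^sup>2 = (cmod c * norm x)\<^sup>2" by (simp only: of_real_eq_iff)
  then show ?thesis by simp
qed

lemma scaleC_scaleR_commute: "c *\<^sub>C (r *\<^sub>R x) = r *\<^sub>R (c *\<^sub>C x)" for x :: "'a::complex_hilbert"
  using scaleC_scaleC[of c "complex_of_real r" x] scaleC_scaleC[of "complex_of_real r" c x]
  by (simp only: scaleC_of_real mult.commute)

lemma bounded_linear_scaleC_right: "bounded_linear (\<lambda>x :: 'a::complex_hilbert. c *\<^sub>C x)"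
  by (rule bounded_linear_intro[where K = "cmod c"])
    (simp_all add: scaleC_add_right scaleC_scaleR_commute norm_scaleC mult.commute)

lemma inner_scaleC_left: "inner (c *\<^sub>C x) y = inner x (cnj c *\<^sub>C y)"
  by (simp add: Re_cinner[symmetric] cinner_scaleC_left cinner_scaleC_right)

lemma bounded_linear_scaleC_left: "bounded_linear (\<lambda>c. c *\<^sub>C (x :: 'a::complex_hilbert))"
proof (rule bounded_linear_intro[where K = "norm x"])
  show "(r *\<^sub>R c) *\<^sub>C x = r *\<^sub>R (c *\<^sub>C x)" for r c
    using scaleC_scaleC[of "complex_of_real r" c x] by (simp only: scaleC_of_real scaleR_conv_of_real)
qed (simp_all add: scaleC_add_left norm_scaleC)

lemma norm_cinner_le: "cmod (cinner x y) \<le> 2 * norm x * norm y"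
proof -
  have "cmod (cinner x y) \<le> \<bar>inner x y\<bar> + \<bar>inner x (\<i> *\<^sub>C y)\<bar>"
    unfolding cinner_eq_Complex[of x y] using cmod_le[of "Complex (inner x y) (inner x (\<i> *\<^sub>C y))"] by simp
  also have "\<dots> \<le> norm x * norm y + norm x * norm (\<i> *\<^sub>C y)"
    by (intro add_mono Cauchy_Schwarz_ineq2)
  finally show ?thesis by (simp add: norm_scaleC)
qed

lemma bounded_linear_cinner_left: "bounded_linear (\<lambda>x. cinner x y)"
proof (rule bounded_linear_intro[where K = "2 * norm y"])
  show "cinner (r *\<^sub>R x) y = r *\<^sub>R cinner x y" for r x
    using cinner_scaleC_left[of "complex_of_real r" x y] by (simp add: scaleC_of_real scaleR_conv_of_real)
  show "norm (cinner x y) \<le> norm x * (2 * norm y)" for x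
    using norm_cinner_le[of x y] by (simp add: mult_ac)
qed (rule cinner_add_left)

lemma schauder_basis_unique:
  assumes "schauder_basis \<phi>" "(\<lambda>k. c k *\<^sub>C \<phi> k) sums x" "(\<lambda>k. d k *\<^sub>C \<phi> k) sums x"
  shows "c = d"
  using assms unfolding schauder_basis_def by blast

text \<open>Two representing vectors agree on the range of the embedding, which is dense; hence any
  vector found by hand is the value of the operator.\<close>

lemma form_operator_eq:
  assumes \<iota>: "continuous_dense_embedding \<iota>" and f: "\<And>v. b u v = cinner f (\<iota> v)"
  shows "u \<in> form_domain \<iota> b" "form_operator \<iota> b u = f"
proof -
  show "u \<in> form_domain \<iota> b" unfolding form_domain_def using f by blast
  show "form_operator \<iota> b u = f" unfolding form_operator_def
  proof (rule the_equality)
    show "\<forall>v. b u v = cinner f (\<iota> v)" using f by blast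
    fix g assume g: "\<forall>v. b u v = cinner g (\<iota> v)"
    have "closed {x. inner (g - f) x = 0}" by (intro closed_Collect_eq continuous_intros)
    moreover have "range \<iota> \<subseteq> {x. inner (g - f) x = 0}"
    proof clarify
      fix v
      have "cinner (g - f) (\<iota> v) = 0" using f g by (simp add: cinner_diff_left)
      then show "inner (g - f) (\<iota> v) = 0" by (simp add: Re_cinner[symmetric])
    qed
    ultimately have "closure (range \<iota>) \<subseteq> {x. inner (g - f) x = 0}" by (rule closure_minimal[rotated])
    then have "inner (g - f) (g - f) = 0" using \<iota> unfolding continuous_dense_embedding_def by blast
    then show "g = f" by simp
  qed
qed

locale galerkin =
  fixes \<iota> :: "'v::{complex_hilbert, second_countable_topology}
      \<Rightarrow> 'h::{complex_hilbert, second_countable_topology}"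
    and a :: "real \<Rightarrow> 'v \<Rightarrow> 'v \<Rightarrow> complex"
    and \<omega> :: "real \<Rightarrow> real"
    and \<phi> :: "nat \<Rightarrow> 'v"
    and T M \<alpha> :: real
    and m :: nat
  assumes embedding: "continuous_dense_embedding \<iota>"
    and T_pos: "T > 0"
    and sesq: "\<And>t. t \<in> {0..T} \<Longrightarrow> sesquilinear (a t)"
    and M_pos: "M > 0"
    and a_bound: "\<And>t u v. t \<in> {0..T} \<Longrightarrow> cmod (a t u v) \<le> M * norm u * norm v"
    and alpha_pos: "\<alpha> > 0"
    and a_coercive: "\<And>t u. t \<in> {0..T} \<Longrightarrow> Re (a t u u) \<ge> \<alpha> * (norm u)\<^sup>2"
    and omega_mono: "mono_on {0..T} \<omega>"
    and omega_integrable: "set_integrable lborel {0<..T} (\<lambda>t. (\<omega> t / t)\<^sup>2)"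
    and a_modulus: "\<And>t s u v. t \<in> {0..T} \<Longrightarrow> s \<in> {0..T} \<Longrightarrow>
      cmod (a t u v - a s u v) \<le> \<omega> \<bar>t - s\<bar> * norm u * norm v"
    and basis: "schauder_basis \<phi>"
    and orthogonal: "\<And>i j. i \<noteq> j \<Longrightarrow> cinner (\<iota> (\<phi> i)) (\<iota> (\<phi> j)) = 0"
begin

lemma \<iota>_linear: "bounded_linear \<iota>" and \<iota>_scaleC: "\<iota> (c *\<^sub>C x) = c *\<^sub>C \<iota> x" and \<iota>_inj: "inj \<iota>"
  using embedding unfolding continuous_dense_embedding_def bounded_clinear_def by auto

sublocale \<iota>: bounded_linear \<iota> by (rule \<iota>_linear)

lemma \<iota>_eq_0_iff: "\<iota> x = 0 \<longleftrightarrow> x = 0"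
  using \<iota>_inj \<iota>.zero by (metis injD)

subsection \<open>The projections\<close>

abbreviation P :: "'v \<Rightarrow> 'v" where "P \<equiv> basis_proj \<phi> m"

abbreviation Q :: "'v \<Rightarrow> 'v" where "Q v \<equiv> v - P v"

text \<open>A vanishing basis vector would give 0 two different expansions. The result allows
  division by the squared norms below.\<close>

lemma \<iota>_basis_nonzero: "\<iota> (\<phi> j) \<noteq> 0"
proof
  assume "\<iota> (\<phi> j) = 0"
  then have "\<phi> j = 0" by (simp add: \<iota>_eq_0_iff)
  then have "(\<lambda>k. (if k = j then 1 else 0) *\<^sub>C \<phi> k) = (\<lambda>k. 0)" "(\<lambda>k. 0 *\<^sub>C \<phi> k) = (\<lambda>k. 0)"
    by (auto simp: fun_eq_iff)
  then have "(\<lambda>k. (if k = j then 1 else 0) *\<^sub>C \<phi> k) sums 0" "(\<lambda>k. 0 *\<^sub>C \<phi> k) sums 0"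
    by (simp_all add: sums_zero)
  then have "(\<lambda>k. if k = j then 1 else 0) = (\<lambda>k. 0 :: complex)"
    by (rule schauder_basis_unique[OF basis])
  from fun_cong[OF this, of j] show False by simp
qed

text \<open>The expansion converges in V, hence after the embedding also in H, and pairing with one
  basis vector leaves a single term. The coefficients are thus V-continuous functionals, and
  \<open>P\<close> acts as an orthogonal projection with respect to H.\<close>

lemma basis_coeff_eq:
  "basis_coeff \<phi> v j = cinner (\<iota> v) (\<iota> (\<phi> j)) / cinner (\<iota> (\<phi> j)) (\<iota> (\<phi> j))"
proof -
  have ex1: "\<exists>!c. (\<lambda>j. c j *\<^sub>C \<phi> j) sums v" using basis unfolding schauder_basis_def by blast
  define c where "c = basis_coeff \<phi> v"
  have "(\<lambda>j. c j *\<^sub>C \<phi> j) sums v" unfolding c_def basis_coeff_def using theI'[OF ex1] .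
  then have sums: "(\<lambda>k. cinner (\<iota> (c k *\<^sub>C \<phi> k)) (\<iota> (\<phi> j))) sums cinner (\<iota> v) (\<iota> (\<phi> j))"
    by (rule bounded_linear.sums[OF bounded_linear_compose[OF bounded_linear_cinner_left \<iota>_linear]])
  have eq: "(\<lambda>k. cinner (\<iota> (c k *\<^sub>C \<phi> k)) (\<iota> (\<phi> j)))
    = (\<lambda>k. if k = j then c k * cinner (\<iota> (\<phi> k)) (\<iota> (\<phi> j)) else 0)"
    using orthogonal by (auto simp: fun_eq_iff \<iota>_scaleC cinner_scaleC_left)
  have "cinner (\<iota> v) (\<iota> (\<phi> j)) = c j * cinner (\<iota> (\<phi> j)) (\<iota> (\<phi> j))"
    using sums sums_single[of j "\<lambda>k. c k * cinner (\<iota> (\<phi> k)) (\<iota> (\<phi> j))"] unfolding eq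
    by (rule sums_unique2)
  then show ?thesis unfolding c_def using \<iota>_basis_nonzero[of j] by (simp add: cinner_self_eq_0_iff)
qed

lemma P_linear: "bounded_linear P"
proof -
  have "bounded_linear (\<lambda>v. \<Sum>j<m. (cinner (\<iota> v) (\<iota> (\<phi> j)) / cinner (\<iota> (\<phi> j)) (\<iota> (\<phi> j))) *\<^sub>C \<phi> j)"
    by (intro bounded_linear_sum bounded_linear_compose[OF bounded_linear_scaleC_left]
        bounded_linear_compose[OF bounded_linear_divide]
        bounded_linear_compose[OF bounded_linear_cinner_left \<iota>_linear])
  then show ?thesis by (simp add: basis_proj_def[abs_def] basis_coeff_eq)
qed

sublocale P: bounded_linear P by (rule P_linear)

lemma Q_linear: "bounded_linear Q"
  by (rule bounded_linear_sub[OF bounded_linear_ident P_linear])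

lemma P_scaleC: "P (c *\<^sub>C v) = c *\<^sub>C P v"
  by (simp add: basis_proj_def basis_coeff_eq \<iota>_scaleC cinner_scaleC_left complex_vector.scale_sum_right)

lemma cinner_P_basis: "j < m \<Longrightarrow> cinner (\<iota> (P v)) (\<iota> (\<phi> j)) = cinner (\<iota> v) (\<iota> (\<phi> j))"
proof -
  assume j: "j < m"
  have "cinner (\<iota> (P v)) (\<iota> (\<phi> j)) = (\<Sum>k<m. basis_coeff \<phi> v k * cinner (\<iota> (\<phi> k)) (\<iota> (\<phi> j)))"
    by (simp only: basis_proj_def \<iota>.sum \<iota>_scaleC cinner_sum_left cinner_scaleC_left)
  also have "\<dots> = (\<Sum>k<m. if k = j then basis_coeff \<phi> v j * cinner (\<iota> (\<phi> j)) (\<iota> (\<phi> j)) else 0)"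
    using orthogonal by (intro sum.cong) auto
  also have "\<dots> = cinner (\<iota> v) (\<iota> (\<phi> j))"
    using j \<iota>_basis_nonzero[of j] by (simp add: basis_coeff_eq cinner_self_eq_0_iff)
  finally show ?thesis .
qed

lemma P_idem [simp]: "P (P v) = P v"
  unfolding basis_proj_def[of \<phi> m "P v"] basis_coeff_eq
  by (simp add: cinner_P_basis) (simp add: basis_proj_def basis_coeff_eq)

lemma P_Q [simp]: "P (Q v) = 0"
  by (simp add: P.diff)

lemma cinner_P_Q:
  assumes "P v = 0"
  shows "cinner (\<iota> (P u)) (\<iota> v) = 0" "cinner (\<iota> v) (\<iota> (P u)) = 0"
proof -
  have "cinner (\<iota> v) (\<iota> (\<phi> j)) = 0" if "j < m" for j
    using cinner_P_basis[OF that, of v] assms by simp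
  then show "cinner (\<iota> v) (\<iota> (P u)) = 0"
    by (simp only: basis_proj_def \<iota>.sum \<iota>_scaleC cinner_sum_right cinner_scaleC_right) simp
  then show "cinner (\<iota> (P u)) (\<iota> v) = 0" by (subst cinner_commute) simp
qed

lemma P_in_span: "P v \<in> basis_span \<phi> m"
  unfolding basis_proj_def basis_span_def
  by (intro complex_vector.span_sum complex_vector.span_scale complex_vector.span_base) auto

lemma P_span: "x \<in> basis_span \<phi> m \<Longrightarrow> P x = x"
  unfolding basis_span_def
proof (induction rule: complex_vector.span_induct_alt)
  case (step c x y)
  then obtain j where j: "j < m" "x = \<phi> j" by auto
  have "P (\<phi> j) = (\<Sum>k<m. if k = j then \<phi> j else 0)"
    unfolding basis_proj_def
  proof (intro sum.cong)
    fix k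
    show "basis_coeff \<phi> (\<phi> j) k *\<^sub>C \<phi> k = (if k = j then \<phi> j else 0)"
      using orthogonal[of j k] \<iota>_basis_nonzero[of j]
      by (auto simp: basis_coeff_eq cinner_self_eq_0_iff)
  qed simp
  then have "P (\<phi> j) = \<phi> j" using j by simp
  then show ?case using step j by (simp add: P.add P_scaleC)
qed simp

subsection \<open>The operator on the kernel of the projection\<close>

definition W :: "'v set" where "W = {w. P w = 0}"

lemma W_subspace: "subspace W"
  unfolding W_def by (auto simp: subspace_def P.add P.scaleR)

lemma W_closed: "closed W"
  unfolding W_def by (intro closed_Collect_eq continuous_intros linear_continuous_on P_linear)

lemma Q_in_W: "Q v \<in> W"
  by (simp add: W_def P.diff)

lemma W_scaleC: "w \<in> W \<Longrightarrow> c *\<^sub>C w \<in> W"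
  by (simp add: W_def P_scaleC)

text \<open>The V-orthogonal projection onto \<open>W\<close>, in general different from
  \<open>Q\<close> because the basis is orthogonal in H only. It lets \<open>G\<close> be symmetric
  on all of V.\<close>

definition Proj :: "'v \<Rightarrow> 'v"
  where "Proj u = (SOME w. w \<in> W \<and> (\<forall>v\<in>W. inner w v = inner u v))"

lemma Proj: "Proj u \<in> W" "v \<in> W \<Longrightarrow> inner (Proj u) v = inner u v"
proof -
  have "\<exists>w. w \<in> W \<and> (\<forall>v\<in>W. inner w v = inner u v)"
    using riesz_subspace[OF bounded_linear_inner_right W_subspace W_closed, of u] by blast
  from someI_ex[OF this] show "Proj u \<in> W" "v \<in> W \<Longrightarrow> inner (Proj u) v = inner u v"
    unfolding Proj_def by auto
qed

lemma W_eqI: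
  assumes "x \<in> W" "y \<in> W" "\<And>v. v \<in> W \<Longrightarrow> inner x v = inner y v"
  shows "x = y"
proof -
  have "x - y \<in> W" using assms W_subspace by (simp add: subspace_diff)
  then have "inner (x - y) (x - y) = 0" using assms(3) by (simp only: inner_diff_left right_minus_eq)
  then show ?thesis by simp
qed

lemma Proj_add: "Proj (x + y) = Proj x + Proj y"
  by (rule W_eqI) (auto simp: Proj inner_add_left intro: subspace_add[OF W_subspace])

lemma Proj_scaleR: "Proj (r *\<^sub>R x) = r *\<^sub>R Proj x"
  by (rule W_eqI) (auto simp: Proj intro: subspace_mul[OF W_subspace])

lemma Proj_scaleC: "Proj (c *\<^sub>C x) = c *\<^sub>C Proj x"
  by (rule W_eqI) (auto simp: Proj W_scaleC inner_scaleC_left)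

lemma Proj_W: "x \<in> W \<Longrightarrow> Proj x = x"
  by (rule W_eqI) (auto simp: Proj)

lemma norm_Proj_le: "norm (Proj x) \<le> norm x"
proof (cases "Proj x = 0")
  case False
  have "norm (Proj x) * norm (Proj x) = inner (Proj x) (Proj x)"
    by (simp add: power2_norm_eq_inner flip: power2_eq_square)
  also have "\<dots> = inner x (Proj x)" by (rule Proj(2)[OF Proj(1)])
  also have "\<dots> \<le> norm x * norm (Proj x)" by (rule norm_cauchy_schwarz)
  finally show ?thesis using False by simp
qed simp

definition B :: real where "B = (SOME B. 0 < B \<and> (\<forall>x. norm (\<iota> x) \<le> B * norm x))"

lemma B: "0 < B" "norm (\<iota> x) \<le> B * norm x"
proof -
  have "\<exists>B. 0 < B \<and> (\<forall>x. norm (\<iota> x) \<le> B * norm x)"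
    using \<iota>.pos_bounded by (auto simp: mult.commute)
  from someI_ex[OF this] show "0 < B" "norm (\<iota> x) \<le> B * norm x" unfolding B_def by auto
qed

text \<open>Normalisation by the embedding constant: \<kappa> |\<iota> x|^2 \<le> |x|^2, which
  bounds \<open>G\<close> by the identity.\<close>

definition \<kappa> :: real where "\<kappa> = 1 / B\<^sup>2"

lemma \<kappa>_pos: "0 < \<kappa>"
  using B(1) by (simp add: \<kappa>_def)

lemma \<kappa>_inner_le: "\<kappa> * inner (\<iota> x) (\<iota> y) \<le> norm x * norm y"
proof -
  have "inner (\<iota> x) (\<iota> y) \<le> norm (\<iota> x) * norm (\<iota> y)" by (rule norm_cauchy_schwarz)
  also have "\<dots> \<le> (B * norm x) * (B * norm y)" using B by (intro mult_mono) auto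
  finally have "\<kappa> * inner (\<iota> x) (\<iota> y) \<le> \<kappa> * ((B * norm x) * (B * norm y))"
    using \<kappa>_pos by (intro mult_left_mono) auto
  also have "\<dots> = norm x * norm y" using B(1) by (simp add: \<kappa>_def power2_eq_square)
  finally show ?thesis .
qed

text \<open>Up to a positive factor, the inverse of the operator associated with the form
  \<open>\<alpha> \<langle>u, v\<rangle>\<^sub>V\<close> on \<^term>\<open>W\<close>; the factor makes it a contraction.\<close>

definition G :: "'v \<Rightarrow> 'v"
  where "G u = (SOME w. w \<in> W \<and> (\<forall>v\<in>W. inner w v = \<kappa> * inner (\<iota> (Proj u)) (\<iota> v)))"

lemma G: "G u \<in> W" "v \<in> W \<Longrightarrow> inner (G u) v = \<kappa> * inner (\<iota> (Proj u)) (\<iota> v)"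
proof -
  have "bounded_linear (\<lambda>v. \<kappa> * inner (\<iota> (Proj u)) (\<iota> v))"
    by (intro bounded_linear_const_mult bounded_linear_compose[OF bounded_linear_inner_right \<iota>_linear])
  then have "\<exists>w. w \<in> W \<and> (\<forall>v\<in>W. inner w v = \<kappa> * inner (\<iota> (Proj u)) (\<iota> v))"
    using riesz_subspace[OF _ W_subspace W_closed] by blast
  from someI_ex[OF this] show "G u \<in> W" "v \<in> W \<Longrightarrow> inner (G u) v = \<kappa> * inner (\<iota> (Proj u)) (\<iota> v)"
    unfolding G_def by auto
qed

text \<open>This form makes symmetry and positivity of \<open>G\<close> evident on the whole space,
  not only on \<open>W\<close>.\<close>

lemma inner_G: "inner (G u) v = \<kappa> * inner (\<iota> (Proj u)) (\<iota> (Proj v))"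
  using Proj(2)[OF G(1), of v u] G(2)[OF Proj(1), of u v] by (simp add: inner_commute)

lemma G_scaleC: "G (c *\<^sub>C x) = c *\<^sub>C G x"
  by (rule W_eqI) (auto simp: G W_scaleC Proj_scaleC inner_scaleC_left \<iota>_scaleC)

lemma G_linear: "bounded_linear G"
proof (rule bounded_linear_intro[where K = 1])
  show "G (x + y) = G x + G y" for x y
    by (rule W_eqI) (auto simp: G Proj_add \<iota>.add inner_add_left distrib_left intro: subspace_add[OF W_subspace])
  show "G (r *\<^sub>R x) = r *\<^sub>R G x" for r x
    by (rule W_eqI) (auto simp: G Proj_scaleR \<iota>.scaleR intro: subspace_mul[OF W_subspace])
  show "norm (G x) \<le> norm x * 1" for x
  proof (cases "G x = 0")
    case False
    have "norm (G x) * norm (G x) = inner (G x) (G x)"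
      by (simp add: power2_norm_eq_inner flip: power2_eq_square)
    also have "\<dots> \<le> norm (Proj x) * norm (Proj (G x))" unfolding inner_G by (rule \<kappa>_inner_le)
    also have "\<dots> \<le> norm x * norm (G x)" by (intro mult_mono norm_Proj_le) auto
    finally show ?thesis using False by simp
  qed simp
qed

sublocale positive_contraction G
proof (rule positive_contraction.intro)
  show "bounded_linear G" by (rule G_linear)
  show "inner (G x) y = inner x (G y)" for x y
    unfolding inner_commute[of x] inner_G by (simp add: inner_commute)
  show "0 \<le> inner (G x) x" for x unfolding inner_G using \<kappa>_pos by simp
  show "inner (G x) x \<le> inner x x" for x
  proof -
    have "inner (G x) x \<le> norm (Proj x) * norm (Proj x)" unfolding inner_G by (rule \<kappa>_inner_le)
    also have "\<dots> \<le> norm x * norm x" by (intro mult_mono norm_Proj_le) auto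
    finally show ?thesis by (simp add: power2_norm_eq_inner flip: power2_eq_square)
  qed
qed

text \<open>A vector in the kernel of \<open>G\<close> has projection zero, since the embedding is
  injective, and so is orthogonal to \<open>W\<close>. Hence the semigroup is strongly continuous on
  \<open>W\<close>.\<close>

lemma W_in_closure_range_G: "x \<in> W \<Longrightarrow> x \<in> closure (range G)"
proof (rule closure_range_G_I)
  fix z assume x: "x \<in> W" and "G z = 0"
  then have "\<kappa> * inner (\<iota> (Proj z)) (\<iota> (Proj z)) = 0" using inner_G[of z z] by simp
  then have "Proj z = 0" using \<kappa>_pos by (simp add: \<iota>_eq_0_iff)
  then show "inner x z = 0" using Proj(2)[OF x, of z] by (simp add: inner_commute)
qed

lemma inner_G_W: "u \<in> W \<Longrightarrow> v \<in> W \<Longrightarrow> inner (G u) v = \<kappa> * inner (\<iota> u) (\<iota> v)"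
  by (simp add: inner_G Proj_W)

lemma heat_in_W: "x \<in> W \<Longrightarrow> heat t x \<in> W"
  by (rule heat_closed_subspace[OF W_subspace W_closed G(1)])

lemma heat_rate_in_W: "x \<in> W \<Longrightarrow> 0 < t \<Longrightarrow> heat_rate t x \<in> W"
  by (rule heat_rate_closed_subspace[OF W_subspace W_closed G(1)])

text \<open>On \<open>W\<close> the operator of the form \<alpha> (u, v)_V is \<beta> times the
  inverse of \<open>G\<close>, so \<beta> is the time scale of the semigroup.\<close>

definition \<beta> :: real where "\<beta> = \<alpha> * \<kappa>"

lemma \<beta>_pos: "0 < \<beta>"
  using alpha_pos \<kappa>_pos by (simp add: \<beta>_def)

lemma heat_scaled_derivative:
  assumes "s < t"
  shows "((\<lambda>t. heat (\<beta> * (t - s)) x) has_vector_derivative \<beta> *\<^sub>R - heat_rate (\<beta> * (t - s)) x) (at t)"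
proof -
  have pos: "0 < \<beta> * (t - s)" using assms \<beta>_pos by simp
  have "((\<lambda>t. \<beta> * (t - s)) has_real_derivative \<beta>) (at t)" by (auto intro!: derivative_eq_intros)
  then have "((\<lambda>t. \<beta> * (t - s)) has_vector_derivative \<beta>) (at t)"
    by (simp add: has_real_derivative_iff_has_vector_derivative)
  from vector_diff_chain_at[OF this heat_has_vector_derivative[OF pos, of x]]
  show ?thesis by (simp add: o_def)
qed

text \<open>Since \<open>G\<close> maps the rate to the orbit, the identity between the two inner
  products on \<open>W\<close> gives the real statement; testing also with i w gives the complex
  one.\<close>

lemma heat_weak_equation:
  assumes x: "x \<in> W" and t: "0 < t" and w: "w \<in> W"
  shows "complex_of_real \<alpha> * cinner (heat t x) w = cinner (\<iota> (\<beta> *\<^sub>R heat_rate t x)) (\<iota> w)"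
proof -
  have "\<alpha> * inner (heat t x) v = inner (\<iota> (\<beta> *\<^sub>R heat_rate t x)) (\<iota> v)" if "v \<in> W" for v
    using inner_G_W[OF heat_rate_in_W[OF x t] that] by (simp add: G_heat_rate[OF t] \<beta>_def \<iota>.scaleR)
  from this[OF w] this[OF W_scaleC[OF w]] show ?thesis
    unfolding cinner_eq_Complex[of "heat t x"] cinner_eq_Complex[of "\<iota> (\<beta> *\<^sub>R heat_rate t x)"]
    by (simp add: complex_eq_iff \<iota>_scaleC)
qed

lemma heat_H_contraction:
  assumes "x \<in> W" "0 \<le> t"
  shows "norm (\<iota> (heat t x)) \<le> norm (\<iota> x)"
proof -
  have "\<kappa> * (norm (\<iota> (heat t x)))\<^sup>2 \<le> \<kappa> * (norm (\<iota> x))\<^sup>2"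
    using heat_G_contraction[OF assms(2), of x] assms(1)
    by (simp add: inner_G_W heat_in_W power2_norm_eq_inner)
  then show ?thesis using \<kappa>_pos by (simp add: abs_le_square_iff[symmetric])
qed

subsection \<open>The finite-dimensional part\<close>

text \<open>Otherwise monotonicity gives \<omega> \<ge> e on all of (0, T], and the integrand
  dominates e^2 / t^2, which is not integrable at 0.\<close>

lemma omega_small:
  assumes e: "0 < e"
  shows "\<exists>d>0. \<forall>h. 0 < h \<and> h < d \<and> h \<le> T \<longrightarrow> \<omega> h < e"
proof (rule ccontr)
  assume "\<not> ?thesis"
  then have large: "\<exists>h. 0 < h \<and> h < d \<and> h \<le> T \<and> e \<le> \<omega> h" if "0 < d" for d
    using that by (meson not_le)
  have ge: "e \<le> \<omega> t" if t: "0 < t" "t \<le> T" for t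
  proof -
    obtain h where h: "0 < h" "h < t" "h \<le> T" "e \<le> \<omega> h" using large[OF t(1)] by blast
    have "\<omega> h \<le> \<omega> t" using h t by (intro mono_onD[OF omega_mono]) auto
    then show ?thesis using h(4) by simp
  qed
  define I where "I = (LINT t|lborel. indicator {0<..T} t *\<^sub>R (\<omega> t / t)\<^sup>2)"
  have I0: "0 \<le> I" unfolding I_def by (rule integral_nonneg_AE) simp
  \<comment> \<open>On [r, 2 r] the integral is at least e^2 / (4 r); this r makes that at least 2
    (I + 1), more than the total I.\<close>
  define r where "r = min (T / 2) (e\<^sup>2 / (8 * (I + 1)))"
  have r: "0 < r" "2 * r \<le> T" "r \<le> e\<^sup>2 / (8 * (I + 1))"
    unfolding r_def using T_pos e I0 by auto
  have "(LINT t|lborel. indicator {r..2 * r} t *\<^sub>R (e / (2 * r))\<^sup>2) \<le> I"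
    unfolding I_def
  proof (rule integral_mono)
    show "integrable lborel (\<lambda>t. indicator {r..2 * r} t *\<^sub>R (e / (2 * r))\<^sup>2)"
      using r(1) by (intro integrable_scaleR_left integrable_real_indicator) auto
    show "integrable lborel (\<lambda>t. indicator {0<..T} t *\<^sub>R (\<omega> t / t)\<^sup>2)"
      using omega_integrable unfolding set_integrable_def .
    fix t
    show "indicator {r..2 * r} t *\<^sub>R (e / (2 * r))\<^sup>2 \<le> indicator {0<..T} t *\<^sub>R (\<omega> t / t)\<^sup>2"
    proof (cases "t \<in> {r..2 * r}")
      case True
      have "e / (2 * r) \<le> \<omega> t / t" using True r e ge[of t] by (intro frac_le) auto
      then have "(e / (2 * r))\<^sup>2 \<le> (\<omega> t / t)\<^sup>2" using e r by (intro power_mono) auto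
      then show ?thesis using True r by simp
    qed simp
  qed
  then have "e\<^sup>2 / (4 * r) \<le> I" using r(1) by (simp add: power2_eq_square field_simps)
  moreover have "2 * (I + 1) \<le> e\<^sup>2 / (4 * r)" using r(1,3) I0 by (simp add: field_simps)
  ultimately show False using I0 by simp
qed

text \<open>Freezing the form outside [0, T] gives coefficients on the whole line, as the linear
  equation requires.\<close>

definition clip :: "real \<Rightarrow> real" where "clip t = max 0 (min T t)"

lemma clip [simp]: "clip t \<in> {0..T}" "t \<in> {0..T} \<Longrightarrow> clip t = t"
  using T_pos by (auto simp: clip_def)

lemma a_add_left: "t \<in> {0..T} \<Longrightarrow> a t (u + u') v = a t u v + a t u' v"
  and a_add_right: "t \<in> {0..T} \<Longrightarrow> a t u (v + v') = a t u v + a t u v'"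
  and a_scaleC_left: "t \<in> {0..T} \<Longrightarrow> a t (c *\<^sub>C u) v = c * a t u v"
  and a_scaleC_right: "t \<in> {0..T} \<Longrightarrow> a t u (c *\<^sub>C v) = cnj c * a t u v"
  using sesq[of t] unfolding sesquilinear_def by auto

lemma a_sum_right:
  assumes t: "t \<in> {0..T}"
  shows "a t u (\<Sum>j\<in>J. c j *\<^sub>C v j) = (\<Sum>j\<in>J. cnj (c j) * a t u (v j))"
proof -
  have "a t u (0 *\<^sub>C 0) = cnj 0 * a t u 0" by (rule a_scaleC_right[OF t])
  then have "a t u 0 = 0" by simp
  then show ?thesis
    by (induction J rule: infinite_finite_induct) (simp_all add: a_add_right[OF t] a_scaleC_right[OF t])
qed

lemma a_linear_left:
  assumes t: "t \<in> {0..T}"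
  shows "bounded_linear (\<lambda>u. a t u v)"
proof (rule bounded_linear_intro[where K = "M * norm v"])
  show "a t (r *\<^sub>R u) v = r *\<^sub>R a t u v" for r u
    using a_scaleC_left[OF t, of "complex_of_real r" u v] by (simp add: scaleC_of_real scaleR_conv_of_real)
  show "norm (a t u v) \<le> norm u * (M * norm v)" for u
    using a_bound[OF t, of u v] by (simp add: mult_ac)
qed (rule a_add_left[OF t])

lemma a_continuous: "continuous_on UNIV (\<lambda>t. a (clip t) u v)"
  unfolding continuous_on_iff
proof (intro ballI allI impI)
  fix t e :: real assume e: "0 < e"
  define e' where "e' = e / (norm u * norm v + 1)"
  have e': "0 < e'" unfolding e'_def using e by (simp add: add_nonneg_pos)
  obtain d where d: "0 < d" "\<And>h. 0 < h \<Longrightarrow> h < d \<Longrightarrow> h \<le> T \<Longrightarrow> \<omega> h < e'"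
    using omega_small[OF e'] by blast
  have "dist (a (clip s) u v) (a (clip t) u v) < e" if s: "dist s t < d" for s
  \<comment> \<open>Nothing forces \<omega> to vanish at 0, so coinciding clipped times are treated
    without the modulus.\<close>
  proof (cases "clip s = clip t")
    case False
    define h where "h = \<bar>clip s - clip t\<bar>"
    have h: "0 < h" "h \<le> T" unfolding h_def using False clip(1)[of s] clip(1)[of t] by auto
    have "h \<le> \<bar>s - t\<bar>" unfolding h_def clip_def by (auto simp: max_def min_def)
    then have "\<omega> h < e'" using s h by (intro d(2)) (auto simp: dist_real_def)
    have "dist (a (clip s) u v) (a (clip t) u v) \<le> \<omega> h * (norm u * norm v)"
      using a_modulus[OF clip(1)[of s] clip(1)[of t], of u v] unfolding h_def dist_norm by (simp add: mult.assoc)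
    also have "\<dots> \<le> e' * (norm u * norm v)" using \<open>\<omega> h < e'\<close> by (intro mult_right_mono) auto
    also have "\<dots> < e' * (norm u * norm v + 1)" using e' by simp
    also have "\<dots> = e"
    proof -
      have "norm u * norm v + 1 \<noteq> 0" by (simp add: add_nonneg_pos less_imp_neq[symmetric])
      then show ?thesis unfolding e'_def by simp
    qed
    finally show ?thesis .
  qed (use e in simp)
  then show "\<exists>d>0. \<forall>x'\<in>UNIV. dist x' t < d \<longrightarrow> dist (a (clip x') u v) (a (clip t) u v) < e"
    using d(1) by blast
qed

text \<open>The vector of V_m that represents the form a(t, P u, P v) through the inner product of
  H, written out in the orthogonal basis. Composing with \<open>P\<close> lets the equation live on
  the whole type instead of on V_m.\<close>

definition fd :: "real \<Rightarrow> 'v \<Rightarrow> 'v"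
  where "fd t u = (\<Sum>j<m. (a (clip t) (P u) (\<phi> j) / cinner (\<iota> (\<phi> j)) (\<iota> (\<phi> j))) *\<^sub>C \<phi> j)"

lemma fd_linear: "bounded_linear (fd t)"
proof -
  have 1: "bounded_linear (\<lambda>u. a (clip t) (P u) (\<phi> j))" for j
    by (rule bounded_linear_compose[OF a_linear_left[OF clip(1)] P_linear])
  have "bounded_linear (\<lambda>u. (a (clip t) (P u) (\<phi> j) / cinner (\<iota> (\<phi> j)) (\<iota> (\<phi> j))) *\<^sub>C \<phi> j)" for j
    by (rule bounded_linear_compose[OF bounded_linear_scaleC_left bounded_linear_compose[OF bounded_linear_divide 1]])
  then show ?thesis unfolding fd_def[abs_def] by (intro bounded_linear_sum)
qed

lemma P_fd [simp]: "P (fd t u) = fd t u"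
  unfolding fd_def
  by (rule P_span, unfold basis_span_def)
    (intro complex_vector.span_sum complex_vector.span_scale complex_vector.span_base, auto)

lemma fd_P [simp]: "fd t (P u) = fd t u"
  by (simp add: fd_def)

lemma fd_scaleC: "fd t (c *\<^sub>C u) = c *\<^sub>C fd t u"
  by (simp add: fd_def P_scaleC a_scaleC_left[OF clip(1)] complex_vector.scale_sum_right)

lemma fd_bound_exists: "\<exists>K>0. \<forall>t u. norm (fd t u) \<le> K * norm u"
proof -
  obtain C where C: "0 < C" "\<And>u. norm (P u) \<le> C * norm u"
    using P.pos_bounded by (auto simp: mult.commute)
  define k where "k j = M * C * norm (\<phi> j) / cmod (cinner (\<iota> (\<phi> j)) (\<iota> (\<phi> j))) * norm (\<phi> j)" for j
  have k0: "0 \<le> k j" for j unfolding k_def using M_pos C(1) by simp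
  have "norm (fd t u) \<le> (1 + sum k {..<m}) * norm u" for t u
  proof -
    have "norm (fd t u) \<le> (\<Sum>j<m. k j * norm u)"
      unfolding fd_def
    proof (rule sum_norm_le)
      fix j
      have "cmod (a (clip t) (P u) (\<phi> j)) \<le> M * norm (P u) * norm (\<phi> j)" by (rule a_bound[OF clip(1)])
      also have "\<dots> \<le> M * (C * norm u) * norm (\<phi> j)" using M_pos C(2) by (intro mult_right_mono mult_left_mono) auto
      finally have "cmod (a (clip t) (P u) (\<phi> j)) / cmod (cinner (\<iota> (\<phi> j)) (\<iota> (\<phi> j))) * norm (\<phi> j)
        \<le> M * (C * norm u) * norm (\<phi> j) / cmod (cinner (\<iota> (\<phi> j)) (\<iota> (\<phi> j))) * norm (\<phi> j)"
        by (intro mult_right_mono divide_right_mono) auto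
      then show "norm ((a (clip t) (P u) (\<phi> j) / cinner (\<iota> (\<phi> j)) (\<iota> (\<phi> j))) *\<^sub>C \<phi> j) \<le> k j * norm u"
        by (simp add: norm_scaleC norm_divide k_def mult_ac)
    qed
    also have "\<dots> = sum k {..<m} * norm u" by (simp add: sum_distrib_right)
    also have "\<dots> \<le> (1 + sum k {..<m}) * norm u" by (intro mult_right_mono) auto
    finally show ?thesis .
  qed
  moreover have "0 < 1 + sum k {..<m}" using k0 by (simp add: add_pos_nonneg sum_nonneg)
  ultimately show ?thesis by blast
qed

definition K :: real where "K = (SOME K. 0 < K \<and> (\<forall>t u. norm (fd t u) \<le> K * norm u))"

lemma K: "0 < K" "norm (fd t u) \<le> K * norm u"
  using someI_ex[OF fd_bound_exists, folded K_def] by auto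

lemma fd_continuous: "continuous_on UNIV (\<lambda>t. fd t u)"
  unfolding fd_def
  by (intro continuous_on_sum bounded_linear.continuous_on[OF bounded_linear_scaleC_left]
      bounded_linear.continuous_on[OF bounded_linear_divide] a_continuous)

lemma fd_form:
  assumes t: "t \<in> {0..T}"
  shows "cinner (\<iota> (fd t u)) (\<iota> v) = a t (P u) (P v)"
proof -
  have coeff: "cinner (\<iota> (\<phi> j)) (\<iota> v) = cnj (basis_coeff \<phi> v j) * cinner (\<iota> (\<phi> j)) (\<iota> (\<phi> j))" for j
  proof -
    have "cinner (\<iota> v) (\<iota> (\<phi> j)) = basis_coeff \<phi> v j * cinner (\<iota> (\<phi> j)) (\<iota> (\<phi> j))"
      using \<iota>_basis_nonzero[of j] by (simp add: basis_coeff_eq cinner_self_eq_0_iff)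
    then show ?thesis
      by (subst cinner_commute) (simp add: cinner_self)
  qed
  have "cinner (\<iota> (fd t u)) (\<iota> v)
    = (\<Sum>j<m. (a t (P u) (\<phi> j) / cinner (\<iota> (\<phi> j)) (\<iota> (\<phi> j))) * cinner (\<iota> (\<phi> j)) (\<iota> v))"
    unfolding fd_def clip(2)[OF t] by (simp only: \<iota>.sum \<iota>_scaleC cinner_sum_left cinner_scaleC_left)
  also have "\<dots> = (\<Sum>j<m. cnj (basis_coeff \<phi> v j) * a t (P u) (\<phi> j))"
    unfolding coeff using \<iota>_basis_nonzero by (intro sum.cong) (auto simp: cinner_self_eq_0_iff)
  also have "\<dots> = a t (P u) (P v)"
    unfolding basis_proj_def[of \<phi> m v] by (rule a_sum_right[OF t, symmetric])
  finally show ?thesis .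
qed

sublocale ode: linear_ode "\<lambda>t u. - fd t u" K
proof (rule linear_ode.intro)
  show "bounded_linear (\<lambda>u. - fd t u)" for t by (rule bounded_linear_minus[OF fd_linear])
  show "norm (- fd t u) \<le> K * norm u" for t u using K(2) by simp
  show "continuous_on UNIV (\<lambda>t. - fd t u)" for u by (intro continuous_on_minus fd_continuous)
  show "0 < K" by (rule K(1))
qed

text \<open>Both composites of \<open>P\<close> with \<open>fd\<close> equal \<open>fd\<close>, so
  the flow commutes with \<open>P\<close> and V_m is invariant.\<close>

lemma P_flow: "s \<le> t \<Longrightarrow> P (ode.flow t s (P x)) = ode.flow t s (P x)"
  using ode.flow_commute[OF P_linear, of s t "P x"] by (simp add: P.neg)

text \<open>The squared norm in H has derivative - 2 Re a(r, P y, P y), which is nonpositive by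
  coercivity.\<close>

lemma flow_H_contraction:
  assumes st: "0 \<le> s" "s \<le> t" "t \<le> T"
  shows "norm (\<iota> (ode.flow t s (P x))) \<le> norm (\<iota> (P x))"
proof -
  define y where "y r = ode.flow r s (P x)" for r
  have y: "continuous_on {s..} y" unfolding y_def by (rule ode.solution_continuous[OF ode.flow_solution])
  have "inner (\<iota> (y t)) (\<iota> (y t)) \<le> inner (\<iota> (y s)) (\<iota> (y s))"
  proof (rule DERIV_nonpos_imp_decreasing_open[OF st(2)])
    fix r assume r: "s < r" "r < t"
    have "(y has_vector_derivative - fd r (y r)) (at r)" unfolding y_def by (rule ode.flow_derivative[OF r(1)])
    then have "((\<lambda>r. \<iota> (y r)) has_vector_derivative \<iota> (- fd r (y r))) (at r)" by (rule \<iota>.has_vector_derivative)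
    then have d: "((\<lambda>r. \<iota> (y r)) has_derivative (\<lambda>h. h *\<^sub>R \<iota> (- fd r (y r)))) (at r)"
      by (simp add: has_vector_derivative_def)
    have "((\<lambda>r. inner (\<iota> (y r)) (\<iota> (y r))) has_real_derivative - 2 * inner (\<iota> (fd r (y r))) (\<iota> (y r))) (at r)"
      unfolding has_field_derivative_def
      by (rule has_derivative_eq_rhs[OF has_derivative_inner[OF d d]]) (auto simp: \<iota>.neg inner_commute)
    moreover have "0 \<le> inner (\<iota> (fd r (y r))) (\<iota> (y r))"
    proof -
      have r': "r \<in> {0..T}" using r st by simp
      have "0 \<le> \<alpha> * (norm (P (y r)))\<^sup>2" using alpha_pos by simp
      also have "\<dots> \<le> Re (a r (P (y r)) (P (y r)))" by (rule a_coercive[OF r'])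
      finally show ?thesis by (simp add: fd_form[OF r', symmetric] Re_cinner)
    qed
    ultimately show "\<exists>D. DERIV (\<lambda>r. inner (\<iota> (y r)) (\<iota> (y r))) r :> D \<and> D \<le> 0" by force
  next
    show "continuous_on {s..t} (\<lambda>r. inner (\<iota> (y r)) (\<iota> (y r)))"
      by (intro continuous_intros \<iota>.continuous_on continuous_on_subset[OF y]) auto
  qed
  then show ?thesis unfolding y_def by (simp add: norm_le)
qed

subsection \<open>The evolution system\<close>

definition E :: "real \<Rightarrow> real \<Rightarrow> 'v \<Rightarrow> 'v"
  where "E t s x = ode.flow t s (P x) + heat (\<beta> * (t - s)) (Q x)"

text \<open>For s < t this is the element of V whose embedding is A_m(t) applied to E(t, s) x; that
  it lies in V reflects the smoothing of the semigroup.\<close>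

definition A :: "real \<Rightarrow> real \<Rightarrow> 'v \<Rightarrow> 'v"
  where "A t s x = fd t (ode.flow t s (P x)) + \<beta> *\<^sub>R heat_rate (\<beta> * (t - s)) (Q x)"

lemma P_E: "s \<le> t \<Longrightarrow> P (E t s x) = ode.flow t s (P x)"
  using heat_in_W[OF Q_in_W] by (simp add: E_def P.add P_flow W_def)

lemma Q_E: "s \<le> t \<Longrightarrow> Q (E t s x) = heat (\<beta> * (t - s)) (Q x)"
  by (simp only: P_E) (simp add: E_def)

lemma E_self: "E s s x = x"
  by (simp add: E_def)

lemma E_linear: "s \<le> t \<Longrightarrow> bounded_clinear (E t s)"
  unfolding bounded_clinear_def
proof (intro conjI allI)
  assume st: "s \<le> t"
  show "bounded_linear (E t s)" unfolding E_def[abs_def]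
    by (rule bounded_linear_add[OF bounded_linear_compose[OF ode.flow_linear[OF st] P_linear]
        bounded_linear_compose[OF heat_bounded_linear Q_linear]])
  fix c x
  have "ode.flow t s (c *\<^sub>C P x) = c *\<^sub>C ode.flow t s (P x)"
    using st by (intro ode.flow_commute bounded_linear_scaleC_right) (simp_all add: fd_scaleC)
  moreover have "heat (\<beta> * (t - s)) (c *\<^sub>C Q x) = c *\<^sub>C heat (\<beta> * (t - s)) (Q x)"
    by (intro heat_commute bounded_linear_scaleC_right G_scaleC)
  ultimately show "E t s (c *\<^sub>C x) = c *\<^sub>C E t s x"
    by (simp add: E_def P_scaleC scaleC_add_right complex_vector.scale_right_diff_distrib)
qed

lemma evolution_system_E: "evolution_system T E"
  unfolding evolution_system_def
proof (intro conjI allI impI)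
  show "bounded_clinear (E t s)" if "0 \<le> s \<and> s \<le> t \<and> t \<le> T" for s t
    using that by (intro E_linear) simp
  show "E s s x = x" for s x by (rule E_self)
  fix x
  have "continuous_on {(t, s). 0 \<le> s \<and> s \<le> t \<and> t \<le> T} (\<lambda>z. heat (\<beta> * (fst z - snd z)) (Q x))"
    using \<beta>_pos
    by (intro continuous_on_compose2[OF heat_continuous[OF W_in_closure_range_G[OF Q_in_W]]])
      (auto intro!: continuous_intros)
  moreover have "continuous_on {(t, s). 0 \<le> s \<and> s \<le> t \<and> t \<le> T} (\<lambda>z. ode.flow (fst z) (snd z) (P x))"
    using ode.flow_jointly_continuous[of T "P x"] by (simp add: case_prod_beta)
  ultimately show "continuous_on {(t, s). 0 \<le> s \<and> s \<le> t \<and> t \<le> T} (\<lambda>(t, s). E t s x)"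
    unfolding E_def case_prod_beta by (intro continuous_on_add)
next
  fix s r t x assume srt: "0 \<le> s \<and> s \<le> r \<and> r \<le> t \<and> t \<le> T"
  have "E t r (E r s x) = ode.flow t r (ode.flow r s (P x)) + heat (\<beta> * (t - r)) (heat (\<beta> * (r - s)) (Q x))"
    using srt unfolding E_def[of t r] by (subst Q_E, simp, subst P_E, simp_all)
  also have "ode.flow t r (ode.flow r s (P x)) = ode.flow t s (P x)" using srt by (simp add: ode.flow_cocycle)
  also have "heat (\<beta> * (t - r)) (heat (\<beta> * (r - s)) (Q x)) = heat (\<beta> * (t - s)) (Q x)"
    using heat_add[of "\<beta> * (t - r)" "\<beta> * (r - s)" "Q x"] srt \<beta>_pos by (simp add: algebra_simps)
  finally show "E t r (E r s x) = E t s x" by (simp add: E_def)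
qed

text \<open>The two components are orthogonal in H and each contracts, so Pythagoras combines them
  without loss.\<close>

lemma E_H_contraction:
  assumes st: "0 \<le> s" "s \<le> t" "t \<le> T"
  shows "norm (\<iota> (E t s x)) \<le> norm (\<iota> x)"
proof -
  have pyth: "(norm (\<iota> v))\<^sup>2 = (norm (\<iota> (P v)))\<^sup>2 + (norm (\<iota> (Q v)))\<^sup>2" for v
  proof -
    have "Re (cinner (\<iota> (P v)) (\<iota> (Q v))) = 0"
      unfolding cinner_P_Q(1)[OF P_Q] by simp
    then have "(norm (\<iota> (P v) + \<iota> (Q v)))\<^sup>2 = (norm (\<iota> (P v)))\<^sup>2 + (norm (\<iota> (Q v)))\<^sup>2"
      by (intro norm_add_Pythagorean) (simp add: orthogonal_def Re_cinner)
    then show ?thesis by (simp flip: \<iota>.add)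
  qed
  have "(norm (\<iota> (E t s x)))\<^sup>2 = (norm (\<iota> (ode.flow t s (P x))))\<^sup>2 + (norm (\<iota> (heat (\<beta> * (t - s)) (Q x))))\<^sup>2"
    using pyth[of "E t s x"] unfolding Q_E[OF st(2)] unfolding P_E[OF st(2)] .
  also have "\<dots> \<le> (norm (\<iota> (P x)))\<^sup>2 + (norm (\<iota> (Q x)))\<^sup>2"
    using st \<beta>_pos by (intro add_mono power_mono flow_H_contraction heat_H_contraction Q_in_W) auto
  also have "\<dots> = (norm (\<iota> x))\<^sup>2" by (rule pyth[symmetric])
  finally show ?thesis by (simp add: abs_le_square_iff[symmetric])
qed

lemma E_span:
  assumes "x \<in> basis_span \<phi> m" "s \<le> t"
  shows "E t s x \<in> basis_span \<phi> m"
proof -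
  interpret H: bounded_linear "heat (\<beta> * (t - s))" by (rule heat_bounded_linear)
  have "E t s x = ode.flow t s (P x)" using P_span[OF assms(1)] by (simp add: E_def H.zero)
  then show ?thesis using P_flow[OF assms(2)] P_in_span by metis
qed

lemma E_derivative:
  assumes "s < t"
  shows "((\<lambda>t. E t s x) has_vector_derivative - A t s x) (at t)"
  using has_vector_derivative_add[OF ode.flow_derivative[OF assms, of "P x"] heat_scaled_derivative[OF assms, of "Q x"]]
  by (simp add: E_def[abs_def] A_def)

lemma fd_flow_continuous: "continuous_on {s<..} (\<lambda>t. fd t (ode.flow t s (P x)))"
proof -
  have "continuous_on {s..} (\<lambda>t. ode.flow t s (P x))"
    by (rule ode.solution_continuous[OF ode.flow_solution])
  then have "continuous_on {s<..} (\<lambda>t. - fd t (ode.flow t s (P x)))"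
    by (intro ode.continuous_on_L_apply) (rule continuous_on_subset, auto)
  then show ?thesis using continuous_on_minus by fastforce
qed

lemma A_continuous: "continuous_on {s<..} (\<lambda>t. A t s x)"
proof -
  have "continuous_on {0<..} (\<lambda>t. heat_rate t (Q x))"
    using heat_rate_isCont by (auto simp: continuous_on_eq_continuous_at)
  then have "continuous_on {s<..} (\<lambda>t. heat_rate (\<beta> * (t - s)) (Q x))"
    by (rule continuous_on_compose2) (use \<beta>_pos in \<open>auto intro!: continuous_intros\<close>)
  then show ?thesis unfolding A_def by (intro continuous_intros fd_flow_continuous)
qed

lemma A_form:
  assumes t: "0 \<le> s" "s < t" "t \<le> T"
  shows "galerkin_form \<phi> \<alpha> a m t (E t s x) v = cinner (\<iota> (A t s x)) (\<iota> v)"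
proof -
  define h where "h = \<beta> *\<^sub>R heat_rate (\<beta> * (t - s)) (Q x)"
  have pos: "0 < \<beta> * (t - s)" using t \<beta>_pos by simp
  have h: "P h = 0" using heat_rate_in_W[OF Q_in_W pos, of x] by (simp add: h_def W_def P.scaleR)
  have "complex_of_real \<alpha> * cinner (Q (E t s x)) (Q v) = cinner (\<iota> h) (\<iota> (Q v))"
    unfolding h_def using t by (simp add: Q_E heat_weak_equation[OF Q_in_W pos Q_in_W])
  \<comment> \<open>As h lies in \<open>W\<close>, it is orthogonal in H to P v, so the test vector
    Q v may be replaced by v.\<close>
  also have "\<dots> = cinner (\<iota> h) (\<iota> v)" by (simp add: \<iota>.diff cinner_diff_right cinner_P_Q[OF h])
  finally have 1: "complex_of_real \<alpha> * cinner (Q (E t s x)) (Q v) = cinner (\<iota> h) (\<iota> v)" .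
  have "a t (P (E t s x)) (P v) = cinner (\<iota> (fd t (ode.flow t s (P x)))) (\<iota> v)"
    using t by (simp add: fd_form P_E P_flow)
  then show ?thesis
    unfolding galerkin_form_def 1 by (simp add: A_def h_def \<iota>.add cinner_add_left)
qed

lemma A_form_operator:
  assumes "0 \<le> s" "s < t" "t \<le> T"
  shows "E t s x \<in> form_domain \<iota> (galerkin_form \<phi> \<alpha> a m t)"
    and "form_operator \<iota> (galerkin_form \<phi> \<alpha> a m t) (E t s x) = \<iota> (A t s x)"
  using form_operator_eq[where b = "galerkin_form \<phi> \<alpha> a m t" and u = "E t s x" and f = "\<iota> (A t s x)",
      OF embedding A_form[OF assms]] by auto

section \<open>Square integrability of the solution and of its derivative\<close>

lemma E_bound: "\<exists>C>0. \<forall>s t x. 0 \<le> s \<and> s \<le> t \<and> t \<le> T \<longrightarrow> norm (E t s x) \<le> C * norm x"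
proof -
  obtain C where C: "0 < C" "\<And>u. norm (P u) \<le> C * norm u"
    using P.pos_bounded by (auto simp: mult.commute)
  have "norm (E t s x) \<le> (exp (K * T) * C + (1 + C)) * norm x" if st: "0 \<le> s" "s \<le> t" "t \<le> T" for s t x
  proof -
    have "norm (ode.flow t s (P x)) \<le> exp (K * (t - s)) * norm (P x)" by (rule ode.flow_norm_le[OF st(2)])
    also have "\<dots> \<le> exp (K * T) * (C * norm x)" using st K(1) C by (intro mult_mono) auto
    finally have 1: "norm (ode.flow t s (P x)) \<le> exp (K * T) * (C * norm x)" .
    have "norm (heat (\<beta> * (t - s)) (Q x)) \<le> norm (Q x)" by (rule heat_norm_le)
    also have "\<dots> \<le> norm x + norm (P x)" by (rule norm_triangle_ineq4)
    also have "\<dots> \<le> norm x + C * norm x" using C(2) by simp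
    finally show ?thesis using 1 norm_triangle_ineq[of "ode.flow t s (P x)" "heat (\<beta> * (t - s)) (Q x)"]
      unfolding E_def distrib_right by simp
  qed
  moreover have "0 < exp (K * T) * C + (1 + C)" using C(1) by (simp add: add_pos_pos)
  ultimately show ?thesis by blast
qed

lemma E_continuous:
  assumes "0 \<le> s"
  shows "continuous_on {s..T} (\<lambda>t. E t s x)"
proof -
  have "continuous_on {(t, s). 0 \<le> s \<and> s \<le> t \<and> t \<le> T} (\<lambda>(t, s). E t s x)"
    using evolution_system_E unfolding evolution_system_def by blast
  then have "continuous_on {s..T} (\<lambda>t. (\<lambda>(t, s). E t s x) (t, s))"
    by (rule continuous_on_compose2) (use assms in \<open>auto intro!: continuous_intros\<close>)
  then show ?thesis by simp
qed

text \<open>The derivative of \<open>(norm (heat t x))\<^sup>2\<close> is, up to a factor, the square of the norm in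
  \<open>H\<close> of the image of the solution under its generator.\<close>

lemma heat_dissipation:
  assumes x: "x \<in> W" and s: "s < T"
  defines "f \<equiv> \<lambda>t. (norm (\<iota> (\<beta> *\<^sub>R heat_rate (\<beta> * (t - s)) x)))\<^sup>2"
  shows "set_integrable lborel {s<..<T} f" "(LINT t:{s<..<T}|lborel. f t) \<le> \<alpha> / 2 * (norm x)\<^sup>2"
proof -
  \<comment> \<open>The factor - \<alpha> / 2 is adjusted so that the derivative is exactly f, by
    \<alpha> \<kappa> = \<beta>.\<close>
  define F where "F t = - (\<alpha> / 2) * (norm (heat (\<beta> * (t - s)) x))\<^sup>2" for t
  have D: "DERIV F t :> f t" if t: "s < t" for t
  proof -
    have pos: "0 < \<beta> * (t - s)" using t \<beta>_pos by simp
    define h where "h = heat_rate (\<beta> * (t - s)) x"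
    define y where "y r = heat (\<beta> * (r - s)) x" for r
    have "(y has_vector_derivative \<beta> *\<^sub>R - h) (at t)"
      unfolding y_def[abs_def] h_def by (rule heat_scaled_derivative[OF t])
    then have dy: "(y has_derivative (\<lambda>r. r *\<^sub>R (\<beta> *\<^sub>R - h))) (at t)" by (simp add: has_vector_derivative_def)
    have "((\<lambda>r. inner (y r) (y r)) has_real_derivative - 2 * \<beta> * inner h (y t)) (at t)"
      unfolding has_field_derivative_def
      by (rule has_derivative_eq_rhs[OF has_derivative_inner[OF dy dy]]) (auto simp: inner_commute)
    from DERIV_cmult[OF this, of "- (\<alpha> / 2)"]
    have "DERIV F t :> \<alpha> * \<beta> * inner h (y t)"
      by (simp add: F_def[abs_def] y_def power2_norm_eq_inner mult.assoc)
    moreover have "inner h (y t) = \<kappa> * inner (\<iota> h) (\<iota> h)"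
      using inner_G_W[of h h] heat_rate_in_W[OF x pos] G_heat_rate[OF pos, of x]
      by (simp add: h_def y_def inner_commute)
    moreover have "f t = \<beta> * (\<beta> * inner (\<iota> h) (\<iota> h))"
      by (simp only: f_def h_def \<iota>.scaleR power2_norm_eq_inner inner_scaleR_left inner_scaleR_right)
    moreover have "\<alpha> * \<beta> * (\<kappa> * z) = \<beta> * (\<beta> * z)" for z by (simp add: \<beta>_def)
    ultimately show ?thesis by simp
  qed
  have cont: "isCont f t" if t: "s < t" for t
  proof -
    have "isCont (\<lambda>t. heat_rate (\<beta> * (t - s)) x) t"
      using t \<beta>_pos by (intro isCont_o2[OF _ heat_rate_isCont]) (auto intro!: continuous_intros)
    then show ?thesis unfolding f_def
      by (intro continuous_intros bounded_linear.continuous[OF \<iota>_linear])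
  qed
  have Fc: "continuous_on {s..T} F"
    unfolding F_def using \<beta>_pos
    by (intro continuous_intros continuous_on_compose2[OF heat_continuous[OF W_in_closure_range_G[OF x]]]) auto
  have lim: "(F \<longlongrightarrow> F s) (at_right s)" "(F \<longlongrightarrow> F T) (at_left T)"
    using continuous_on_Icc_at_rightD[OF Fc s] continuous_on_Icc_at_leftD[OF Fc s] by auto
  have sT: "ereal s < ereal T" using s by simp
  have ei: "einterval (ereal s) (ereal T) = {s<..<T}" by (auto simp: einterval_def)
  \<comment> \<open>For a nonnegative derivative the one-sided limits of F at the endpoints already
    give integrability, although f may blow up at s.\<close>
  note FTC = interval_integral_FTC_nonneg[of "ereal s" "ereal T" F f "F s" "F T"]
  have "set_integrable lborel (einterval (ereal s) (ereal T)) f"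
    by (rule FTC(1)) (use sT D cont lim in \<open>auto simp: ereal_tendsto_simps1 f_def\<close>)
  then show "set_integrable lborel {s<..<T} f" unfolding ei .
  have "(LBINT t=ereal s..ereal T. f t) = F T - F s"
    by (rule FTC(2)) (use sT D cont lim in \<open>auto simp: ereal_tendsto_simps1 f_def\<close>)
  then have "(LINT t:{s<..<T}|lborel. f t) = F T - F s"
    using s by (simp add: interval_lebesgue_integral_le_eq ei)
  also have "\<dots> \<le> \<alpha> / 2 * (norm x)\<^sup>2" using alpha_pos by (simp add: F_def)
  finally show "(LINT t:{s<..<T}|lborel. f t) \<le> \<alpha> / 2 * (norm x)\<^sup>2" .
qed

text \<open>The cut-off removes the value at the initial time, where the heat rate is meaningless.\<close>

definition AH :: "real \<Rightarrow> 'v \<Rightarrow> real \<Rightarrow> 'h"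
  where "AH s x t = indicator {s<..<T} t *\<^sub>R \<iota> (A t s x)"

text \<open>The finite-dimensional part is bounded uniformly in time; the part in \<open>W\<close>
  is controlled by the dissipation identity, which needs the initial value in V only.\<close>

lemma AH_L2:
  assumes s: "0 \<le> s" "s < T"
  shows "\<exists>C>0. \<forall>x. in_L2 s T (AH s x) \<and> norm_L2 s T (AH s x) \<le> C * norm x"
proof -
  obtain C where C: "0 < C" "\<And>u. norm (P u) \<le> C * norm u"
    using P.pos_bounded by (auto simp: mult.commute)
  define g1 where "g1 x t = indicator {s<..<T} t *\<^sub>R \<iota> (fd t (ode.flow t s (P x)))" for x t
  define g2 where "g2 x t = indicator {s<..<T} t *\<^sub>R \<iota> (\<beta> *\<^sub>R heat_rate (\<beta> * (t - s)) (Q x))" for x t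
  have AH_eq: "AH s x = (\<lambda>t. g1 x t + g2 x t)" for x
    by (simp add: AH_def g1_def g2_def A_def \<iota>.add scaleR_add_right fun_eq_iff)
  have meas: "(\<lambda>t. indicator {s<..<T} t *\<^sub>R \<iota> (f t)) \<in> borel_measurable (lebesgue_on {s..T})"
    if "continuous_on {s<..} f" for f
  proof -
    have "(\<lambda>t. indicator {s<..<T} t *\<^sub>R \<iota> (f t)) \<in> borel_measurable borel"
      by (intro borel_measurable_continuous_on_indicator \<iota>.continuous_on continuous_on_subset[OF that]) auto
    then show ?thesis by (intro measurable_restrict_space1 measurable_completion) simp
  qed
  have rate_cont: "continuous_on {s<..} (\<lambda>t. \<beta> *\<^sub>R heat_rate (\<beta> * (t - s)) (Q x))" for x
    using continuous_on_diff[OF A_continuous[of s x] fd_flow_continuous[of s x]] by (simp add: A_def)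
  \<comment> \<open>Product of the bounds for the embedding, for \<open>fd\<close>, for the flow
    over a time at most T, and for \<open>P\<close>.\<close>
  define C1 where "C1 = B * (K * (exp (K * T) * C))"
  have C1: "0 < C1" unfolding C1_def using B(1) K(1) C(1) by simp
  have g1: "in_L2 s T (g1 x)" "norm_L2 s T (g1 x) \<le> sqrt (T - s) * (C1 * norm x)" for x
  proof -
    have bound: "norm (g1 x t) \<le> C1 * norm x" if t: "t \<in> {s..T}" for t
    proof -
      have "norm (g1 x t) \<le> norm (\<iota> (fd t (ode.flow t s (P x))))" by (simp add: g1_def indicator_def)
      also have "\<dots> \<le> B * norm (fd t (ode.flow t s (P x)))" by (rule B(2))
      also have "\<dots> \<le> B * (K * norm (ode.flow t s (P x)))" using B(1) by (intro mult_left_mono K(2)) auto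
      also have "\<dots> \<le> B * (K * (exp (K * (t - s)) * norm (P x)))"
        using B(1) K(1) t by (intro mult_left_mono ode.flow_norm_le) auto
      also have "\<dots> \<le> B * (K * (exp (K * T) * (C * norm x)))"
        using B(1) K(1) t C s by (intro mult_left_mono mult_mono) auto
      finally show ?thesis by (simp add: C1_def mult_ac)
    qed
    have m: "g1 x \<in> borel_measurable (lebesgue_on {s..T})" unfolding g1_def by (rule meas[OF fd_flow_continuous])
    show "in_L2 s T (g1 x)" "norm_L2 s T (g1 x) \<le> sqrt (T - s) * (C1 * norm x)"
      using in_L2_bounded[OF m bound] s by auto
  qed
  have g2: "in_L2 s T (g2 x)" "norm_L2 s T (g2 x) \<le> sqrt (\<alpha> / 2) * norm (Q x)" for x
  proof -
    define f where "f t = (norm (\<iota> (\<beta> *\<^sub>R heat_rate (\<beta> * (t - s)) (Q x))))\<^sup>2" for t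
    note diss = heat_dissipation[OF Q_in_W s(2), of x, folded f_def]
    have sq: "(\<lambda>t. (norm (g2 x t))\<^sup>2) = (\<lambda>t. indicator {s<..<T} t *\<^sub>R f t)"
      by (auto simp: g2_def f_def indicator_def fun_eq_iff)
    have int: "integrable (lebesgue_on {s..T}) (\<lambda>t. indicator {s<..<T} t *\<^sub>R f t)"
      "(LINT t|lebesgue_on {s..T}. indicator {s<..<T} t *\<^sub>R f t) = (LINT t|lborel. indicator {s<..<T} t *\<^sub>R f t)"
      by (rule integral_lebesgue_on_eq_lborel; use diss(1) in \<open>auto simp: set_integrable_def indicator_def\<close>)+
    have m: "g2 x \<in> borel_measurable (lebesgue_on {s..T})" unfolding g2_def by (rule meas[OF rate_cont])
    show "in_L2 s T (g2 x)" unfolding in_L2_def sq using m int by simp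
    show "norm_L2 s T (g2 x) \<le> sqrt (\<alpha> / 2) * norm (Q x)"
    proof (rule norm_L2_le)
      show "(LINT t|lebesgue_on {s..T}. (norm (g2 x t))\<^sup>2) \<le> (sqrt (\<alpha> / 2) * norm (Q x))\<^sup>2"
        unfolding sq int(2) using diss(2) alpha_pos by (simp add: set_lebesgue_integral_def power_mult_distrib)
    qed (use alpha_pos in simp)
  qed
  define D where "D = 2 * (sqrt (T - s) * C1) + 2 * (sqrt (\<alpha> / 2) * (1 + C))"
  have "norm_L2 s T (AH s x) \<le> D * norm x" for x
  proof -
    have "norm (Q x) \<le> norm x + norm (P x)" by (rule norm_triangle_ineq4)
    also have "\<dots> \<le> (1 + C) * norm x" using C(2)[of x] by (simp add: distrib_right)
    finally have "sqrt (\<alpha> / 2) * norm (Q x) \<le> sqrt (\<alpha> / 2) * ((1 + C) * norm x)"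
      using alpha_pos by (intro mult_left_mono) auto
    then have "norm_L2 s T (AH s x)
      \<le> 2 * (sqrt (T - s) * (C1 * norm x)) + 2 * (sqrt (\<alpha> / 2) * ((1 + C) * norm x))"
      using norm_L2_add_le[OF g1(1) g2(1), of x x] g1(2)[of x] g2(2)[of x] unfolding AH_eq by linarith
    also have "\<dots> = D * norm x" by (simp only: D_def distrib_right[of "2 * (sqrt (T - s) * C1)"] mult.assoc)
    finally show ?thesis .
  qed
  moreover have "0 < D" unfolding D_def using s C1 C(1) alpha_pos by (intro add_pos_pos) auto
  ultimately show ?thesis using in_L2_add[OF g1(1) g2(1)] unfolding AH_eq by blast
qed

lemma E_L2:
  assumes s: "0 \<le> s" "s < T"
  shows "\<exists>C>0. \<forall>x. in_L2 s T (\<lambda>t. E t s x) \<and> in_L2 s T (\<lambda>t. \<iota> (E t s x)) \<and>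
    norm_L2 s T (\<lambda>t. E t s x) \<le> C * norm x \<and> norm_L2 s T (\<lambda>t. \<iota> (E t s x)) \<le> C * norm x"
proof -
  obtain C where C: "0 < C" "\<And>s t x. 0 \<le> s \<Longrightarrow> s \<le> t \<Longrightarrow> t \<le> T \<Longrightarrow> norm (E t s x) \<le> C * norm x"
    using E_bound by blast
  define D where "D = sqrt (T - s) * C * (1 + B)"
  have sqrt0: "0 < sqrt (T - s)" using s by simp
  have D: "0 < D" "sqrt (T - s) * C \<le> D" "sqrt (T - s) * (B * C) \<le> D"
  proof -
    have "0 < sqrt (T - s) * C" "0 < sqrt (T - s) * C * B" using sqrt0 C(1) B(1) by simp_all
    then show "0 < D" "sqrt (T - s) * C \<le> D" "sqrt (T - s) * (B * C) \<le> D"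
      unfolding D_def distrib_left mult_1_right by (simp_all add: mult_ac)
  qed
  have "in_L2 s T (\<lambda>t. E t s x) \<and> in_L2 s T (\<lambda>t. \<iota> (E t s x)) \<and>
    norm_L2 s T (\<lambda>t. E t s x) \<le> D * norm x \<and> norm_L2 s T (\<lambda>t. \<iota> (E t s x)) \<le> D * norm x" for x
  proof -
    have m: "(\<lambda>t. E t s x) \<in> borel_measurable (lebesgue_on {s..T})"
      "(\<lambda>t. \<iota> (E t s x)) \<in> borel_measurable (lebesgue_on {s..T})"
      by (intro continuous_imp_measurable_on_sets_lebesgue \<iota>.continuous_on E_continuous s; simp)+
    have b: "norm (E t s x) \<le> C * norm x" if "t \<in> {s..T}" for t using that s by (intro C(2)) auto
    have b': "norm (\<iota> (E t s x)) \<le> B * (C * norm x)" if "t \<in> {s..T}" for t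
      using B(2)[of "E t s x"] b[OF that] B(1) by (meson mult_left_mono less_imp_le order_trans)
    have "norm_L2 s T (\<lambda>t. E t s x) \<le> sqrt (T - s) * C * norm x"
      using in_L2_bounded(2)[OF m(1) b] s by (simp add: mult.assoc)
    also have "\<dots> \<le> D * norm x" by (intro mult_right_mono D) auto
    finally have 1: "norm_L2 s T (\<lambda>t. E t s x) \<le> D * norm x" .
    have "norm_L2 s T (\<lambda>t. \<iota> (E t s x)) \<le> sqrt (T - s) * (B * C) * norm x"
      using in_L2_bounded(2)[OF m(2) b'] s by (simp add: mult.assoc)
    also have "\<dots> \<le> D * norm x" by (intro mult_right_mono D) auto
    finally show ?thesis using 1 in_L2_bounded(1)[OF m(1) b] in_L2_bounded(1)[OF m(2) b'] s by simp
  qed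
  then show ?thesis using D(1) by blast
qed

text \<open>The orbit is differentiable for t > s only; this suffices because the derivative is
  already known to be square integrable up to the initial time.\<close>

lemma E_weak_derivative:
  assumes s: "0 \<le> s" "s < T"
  shows "has_L2_weak_deriv s T (\<lambda>t. \<iota> (E t s x)) (\<lambda>t. - AH s x t)"
proof (rule has_L2_weak_deriv_classical[OF s(2)])
  show "integrable (lebesgue_on {s..T}) (\<lambda>t. \<iota> (E t s x))" using E_L2[OF s] by (intro in_L2_integrable) blast
  show "in_L2 s T (\<lambda>t. - AH s x t)" using AH_L2[OF s] by (intro in_L2_uminus) blast
  fix t assume t: "s < t" "t < T"
  have "((\<lambda>t. \<iota> (E t s x)) has_vector_derivative \<iota> (- A t s x)) (at t)"
    by (rule \<iota>.has_vector_derivative[OF E_derivative[OF t(1)]])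
  then show "((\<lambda>t. \<iota> (E t s x)) has_vector_derivative - AH s x t) (at t)"
    using t by (simp add: AH_def \<iota>.neg)
qed

lemma AH_form_operator:
  assumes "0 \<le> s" "s < t" "t < T"
  shows "form_operator \<iota> (galerkin_form \<phi> \<alpha> a m t) (E t s x) = AH s x t"
  using A_form_operator(2)[of s t x] assms by (simp add: AH_def)

lemma E_cauchy_solution:
  assumes s: "0 \<le> s" "s < T"
  shows "cauchy_solution \<iota> (galerkin_form \<phi> \<alpha> a m) s T x (\<lambda>t. E t s x)"
  unfolding cauchy_solution_def
proof (intro conjI)
  note weak = E_weak_derivative[OF s, of x]
  show "in_H1 s T (\<lambda>t. \<iota> (E t s x))" unfolding in_H1_def using E_L2[OF s] weak by blast
  show "in_L2 s T (\<lambda>t. E t s x)" using E_L2[OF s] by blast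
  show "AE t in lebesgue_on {s..T}. E t s x \<in> form_domain \<iota> (galerkin_form \<phi> \<alpha> a m t) \<and>
      weak_deriv s T (\<lambda>t. \<iota> (E t s x)) t + form_operator \<iota> (galerkin_form \<phi> \<alpha> a m t) (E t s x) = 0"
    using weak_deriv_AE(1)[OF s(2) weak] AE_lebesgue_on_neq[where c = s] AE_lebesgue_on_neq[where c = T] AE_space
  proof eventually_elim
    case (elim t)
    then have t: "s < t" "t < T" by auto
    show ?case using A_form_operator(1)[of s t x] AH_form_operator[OF s(1) t, of x] s t elim(1) by simp
  qed
  show "has_initial_value s T (\<lambda>t. \<iota> (E t s x)) (\<iota> x)"
    unfolding has_initial_value_def
    by (intro exI[of _ "\<lambda>t. \<iota> (E t s x)"]) (use s in \<open>auto intro!: \<iota>.continuous_on E_continuous simp: E_self\<close>)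
qed

section \<open>Uniqueness and the final estimate\<close>

lemma galerkin_form_diff:
  assumes "t \<in> {0..T}"
  shows "galerkin_form \<phi> \<alpha> a m t (u - w) v = galerkin_form \<phi> \<alpha> a m t u v - galerkin_form \<phi> \<alpha> a m t w v"
proof -
  have "a t (P u - P w) (P v) = a t (P u) (P v) - a t (P w) (P v)"
    by (rule linear_diff[OF bounded_linear.linear[OF a_linear_left[OF assms]]])
  moreover have "u - w - (P u - P w) = Q u - Q w" by simp
  ultimately show ?thesis unfolding galerkin_form_def P.diff
    by (simp only: cinner_diff_left) (simp add: algebra_simps)
qed

lemma galerkin_form_nonneg:
  assumes t: "t \<in> {0..T}"
  shows "0 \<le> Re (galerkin_form \<phi> \<alpha> a m t u u)"
proof -
  have "0 \<le> \<alpha> * (norm (P u))\<^sup>2" "0 \<le> \<alpha> * (norm (Q u))\<^sup>2" using alpha_pos by simp_all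
  then have "0 \<le> Re (a t (P u) (P u)) + \<alpha> * (norm (Q u))\<^sup>2"
    using a_coercive[OF t, of "P u"] by linarith
  then show ?thesis by (simp add: galerkin_form_def cinner_self)
qed

lemma form_operator_form:
  assumes "u \<in> form_domain \<iota> b"
  shows "b u v = cinner (form_operator \<iota> b u) (\<iota> v)"
proof -
  obtain f where "\<And>v. b u v = cinner f (\<iota> v)" using assms unfolding form_domain_def by blast
  then show ?thesis using form_operator_eq(2)[OF embedding, of b u f] by simp
qed

text \<open>Both solutions share the initial value, so their difference in H is the primitive of the
  difference k of the weak derivatives. Accretivity of the form makes the product of k with this
  primitive nonpositive almost everywhere.\<close>

lemma cauchy_solution_unique:
  assumes s: "0 \<le> s" "s < T"
    and u: "cauchy_solution \<iota> (galerkin_form \<phi> \<alpha> a m) s T x u"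
    and w: "cauchy_solution \<iota> (galerkin_form \<phi> \<alpha> a m) s T x w"
  shows "AE t in lebesgue_on {s..T}. w t = u t"
proof -
  define b where "b = galerkin_form \<phi> \<alpha> a m"
  define g where "g = weak_deriv s T (\<lambda>t. \<iota> (u t))"
  define h where "h = weak_deriv s T (\<lambda>t. \<iota> (w t))"
  have wd: "has_L2_weak_deriv s T (\<lambda>t. \<iota> (u t)) g" "has_L2_weak_deriv s T (\<lambda>t. \<iota> (w t)) h"
    using u w weak_deriv_AE(2)[OF s(2)] unfolding cauchy_solution_def in_H1_def g_def h_def by blast+
  then have L2: "in_L2 s T g" "in_L2 s T h" unfolding has_L2_weak_deriv_def by auto
  note int = in_L2_integrable[OF L2(1)] in_L2_integrable[OF L2(2)]
  have rep: "AE t in lebesgue_on {s..T}. \<iota> (u t) = \<iota> x + primitive s T g t"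
    "AE t in lebesgue_on {s..T}. \<iota> (w t) = \<iota> x + primitive s T h t"
  proof -
    have "in_L2 s T (\<lambda>t. \<iota> (u t))" "in_L2 s T (\<lambda>t. \<iota> (w t))"
      "has_initial_value s T (\<lambda>t. \<iota> (u t)) (\<iota> x)" "has_initial_value s T (\<lambda>t. \<iota> (w t)) (\<iota> x)"
      using u w unfolding cauchy_solution_def in_H1_def by blast+
    then show "AE t in lebesgue_on {s..T}. \<iota> (u t) = \<iota> x + primitive s T g t"
      "AE t in lebesgue_on {s..T}. \<iota> (w t) = \<iota> x + primitive s T h t"
      using wd by (simp_all add: weak_derivative_representation[OF s(2) in_L2_integrable])
  qed
  define k where "k t = h t - g t" for t
  have k: "integrable (lebesgue_on {s..T}) k" unfolding k_def using int by simp
  have prim: "primitive s T k t = primitive s T h t - primitive s T g t" for t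
    unfolding primitive_def k_def using indicator_scaleR_integrable[OF int(1), of "{..t}"]
      indicator_scaleR_integrable[OF int(2), of "{..t}"] by (simp add: scaleR_diff_right)
  have sol: "AE t in lebesgue_on {s..T}. u t \<in> form_domain \<iota> (b t) \<and> g t + form_operator \<iota> (b t) (u t) = 0"
    "AE t in lebesgue_on {s..T}. w t \<in> form_domain \<iota> (b t) \<and> h t + form_operator \<iota> (b t) (w t) = 0"
    using u w unfolding cauchy_solution_def g_def h_def b_def by blast+
  have diff: "AE t in lebesgue_on {s..T}. primitive s T k t = \<iota> (w t - u t)"
    using rep by eventually_elim (simp add: prim \<iota>.diff)
  have dissipative: "AE t in lebesgue_on {s..T}. inner (k t) (primitive s T k t) \<le> 0"
    using sol diff AE_space
  proof eventually_elim
    case (elim t)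
    then have t: "t \<in> {0..T}" using s by auto
    define d where "d = w t - u t"
    \<comment> \<open>The two equations trade the weak derivatives for the operator, and the form is
      then evaluated at the difference d, which lies in V.\<close>
    have "k t = form_operator \<iota> (b t) (u t) - form_operator \<iota> (b t) (w t)"
      using elim(1,2) unfolding k_def by (simp add: eq_neg_iff_add_eq_0[symmetric])
    then have "cinner (k t) (\<iota> d) = b t (u t) d - b t (w t) d"
      using elim(1,2) by (simp add: cinner_diff_left form_operator_form)
    also have "\<dots> = - b t d d"
      unfolding b_def d_def galerkin_form_diff[OF t] by simp
    finally have "inner (k t) (\<iota> d) = - Re (b t d d)" by (simp add: Re_cinner[symmetric])
    then show ?case using galerkin_form_nonneg[OF t, of d] elim(3) by (simp add: b_def d_def)
  qed
  \<comment> \<open>The energy identity writes the squared norm as twice an integral that is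
    nonpositive, so the primitive vanishes at every time.\<close>
  have zero: "primitive s T k t = 0" if t: "t \<le> T" for t
  proof -
    have "0 \<le> (LINT r|lebesgue_on {s..T}. - (indicator {..t} r * inner (k r) (primitive s T k r)))"
      by (rule integral_nonneg_AE) (use dissipative in \<open>auto simp: indicator_def elim!: eventually_mono\<close>)
    then have "(LINT r|lebesgue_on {s..T}. indicator {..t} r * inner (k r) (primitive s T k r)) \<le> 0" by simp
    then have "(norm (primitive s T k t))\<^sup>2 \<le> 0" unfolding primitive_norm_square[OF k t] by simp
    then show ?thesis by simp
  qed
  show ?thesis
    using diff AE_space
  proof eventually_elim
    case (elim t)
    then have "\<iota> (w t - u t) = 0" using zero[of t] by simp
    then show ?case by (simp add: \<iota>_eq_0_iff)
  qed
qed

text \<open>Almost everywhere the weak derivative is - \<open>AH\<close> and the operator applied to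
  the solution is \<open>AH\<close>, so one L2 bound on \<open>AH\<close> serves two of the
  terms.\<close>

lemma E_estimate:
  assumes s: "0 \<le> s" "s < T"
  shows "\<exists>C>0. \<forall>x.
    in_L2 s T (\<lambda>t. form_operator \<iota> (galerkin_form \<phi> \<alpha> a m t) (E t s x)) \<and>
    norm_H1 s T (\<lambda>t. \<iota> (E t s x)) + norm_L2 s T (\<lambda>t. E t s x)
      + norm_L2 s T (\<lambda>t. form_operator \<iota> (galerkin_form \<phi> \<alpha> a m t) (E t s x)) \<le> C * norm x"
proof -
  obtain C where C: "0 < C" "\<And>x. in_L2 s T (AH s x)" "\<And>x. norm_L2 s T (AH s x) \<le> C * norm x"
    using AH_L2[OF s] by blast
  obtain D where D: "0 < D" "\<And>x. norm_L2 s T (\<lambda>t. E t s x) \<le> D * norm x"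
    "\<And>x. norm_L2 s T (\<lambda>t. \<iota> (E t s x)) \<le> D * norm x" using E_L2[OF s] by blast
  have op: "in_L2 s T (\<lambda>t. form_operator \<iota> (galerkin_form \<phi> \<alpha> a m t) (E t s x))"
    "norm_L2 s T (\<lambda>t. form_operator \<iota> (galerkin_form \<phi> \<alpha> a m t) (E t s x)) = norm_L2 s T (AH s x)" for x
    using in_L2_cong_interior[OF C(2) AH_form_operator[OF s(1)]] by auto
  have H1: "norm_H1 s T (\<lambda>t. \<iota> (E t s x)) \<le> (D + C) * norm x" for x
  proof -
    note weak = E_weak_derivative[OF s, of x]
    have "norm_L2 s T (weak_deriv s T (\<lambda>t. \<iota> (E t s x))) = norm_L2 s T (AH s x)"
    proof (rule norm_L2_cong)
      show "in_L2 s T (weak_deriv s T (\<lambda>t. \<iota> (E t s x)))"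
        using weak_deriv_AE(2)[OF s(2) weak] unfolding has_L2_weak_deriv_def by blast
      show "AE t in lebesgue_on {s..T}. norm (weak_deriv s T (\<lambda>t. \<iota> (E t s x)) t) = norm (AH s x t)"
        using weak_deriv_AE(1)[OF s(2) weak] by eventually_elim simp
    qed (rule C(2))
    moreover have "norm_H1 s T (\<lambda>t. \<iota> (E t s x))
      \<le> norm_L2 s T (\<lambda>t. \<iota> (E t s x)) + norm_L2 s T (weak_deriv s T (\<lambda>t. \<iota> (E t s x)))"
      unfolding norm_H1_def by (intro sqrt_sum_squares_le_sum norm_L2_nonneg)
    ultimately show ?thesis using C(3)[of x] D(3)[of x] by (simp add: distrib_right)
  qed
  have "norm_H1 s T (\<lambda>t. \<iota> (E t s x)) + norm_L2 s T (\<lambda>t. E t s x)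
      + norm_L2 s T (\<lambda>t. form_operator \<iota> (galerkin_form \<phi> \<alpha> a m t) (E t s x)) \<le> (2 * D + 2 * C) * norm x" for x
    using H1[of x] D(2)[of x] C(3)[of x] unfolding op(2) by (simp add: distrib_right)
  then show ?thesis using op(1) C(1) D(1) by (intro exI[of _ "2 * D + 2 * C"]) auto
qed

end

theorem lemma3p3:
  fixes \<iota> :: "'v::{complex_hilbert, second_countable_topology}
      \<Rightarrow> 'h::{complex_hilbert, second_countable_topology}"
    and a :: "real \<Rightarrow> 'v \<Rightarrow> 'v \<Rightarrow> complex"
    and \<omega> :: "real \<Rightarrow> real"
    and \<phi> :: "nat \<Rightarrow> 'v"
    and T M \<alpha> :: real
  assumes embedding: "continuous_dense_embedding \<iota>"
    and T_pos: "T > 0"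
    and sesq: "\<And>t. t \<in> {0..T} \<Longrightarrow> sesquilinear (a t)"
    and H1: "\<And>u v. (\<lambda>t. a t u v) \<in> borel_measurable (lebesgue_on {0..T})"
    and M_pos: "M > 0"
    and H2: "\<And>t u v. t \<in> {0..T} \<Longrightarrow> cmod (a t u v) \<le> M * norm u * norm v"
    and alpha_pos: "\<alpha> > 0"
    and H3: "\<And>t u. t \<in> {0..T} \<Longrightarrow> Re (a t u u) \<ge> \<alpha> * (norm u)\<^sup>2"
    and omega_nonneg: "\<And>t. t \<in> {0..T} \<Longrightarrow> \<omega> t \<ge> 0"
    and omega_mono: "mono_on {0..T} \<omega>"
    and omega_int1: "set_integrable lborel {0<..T} (\<lambda>t. \<omega> t * t powr (- 3 / 2))"
    and omega_int2: "set_integrable lborel {0<..T} (\<lambda>t. (\<omega> t / t)\<^sup>2)"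
    and H4: "\<And>t s u v. t \<in> {0..T} \<Longrightarrow> s \<in> {0..T} \<Longrightarrow>
      cmod (a t u v - a s u v) \<le> \<omega> \<bar>t - s\<bar> * norm u * norm v"
    and basis_V: "schauder_basis \<phi>"
    and basis_H: "schauder_basis (\<lambda>n. \<iota> (\<phi> n))"
    and orthogonal: "\<And>i j. i \<noteq> j \<Longrightarrow> cinner (\<iota> (\<phi> i)) (\<iota> (\<phi> j)) = 0"
  shows "\<forall>m\<ge>1. \<exists>E.
    evolution_system T E \<and>
    (\<forall>s t x. 0 \<le> s \<and> s \<le> t \<and> t \<le> T \<longrightarrow> norm (\<iota> (E t s x)) \<le> norm (\<iota> x)) \<and>
    (\<forall>s\<in>{0..<T}.
      (\<forall>x. cauchy_solution \<iota> (galerkin_form \<phi> \<alpha> a m) s T x (\<lambda>t. E t s x) \<and>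
        (\<forall>w. cauchy_solution \<iota> (galerkin_form \<phi> \<alpha> a m) s T x w \<longrightarrow>
          (AE t in lebesgue_on {s..T}. w t = E t s x))) \<and>
      (\<exists>C>0. \<forall>x.
        in_L2 s T (\<lambda>t. form_operator \<iota> (galerkin_form \<phi> \<alpha> a m t) (E t s x)) \<and>
        norm_H1 s T (\<lambda>t. \<iota> (E t s x)) + norm_L2 s T (\<lambda>t. E t s x)
          + norm_L2 s T (\<lambda>t. form_operator \<iota> (galerkin_form \<phi> \<alpha> a m t) (E t s x))
          \<le> C * norm x) \<and>
      (\<forall>x\<in>basis_span \<phi> m. \<forall>t\<in>{s..T}. E t s x \<in> basis_span \<phi> m))"
proof (intro allI impI, goal_cases)
  case (1 m)
  interpret galerkin \<iota> a \<omega> \<phi> T M \<alpha> m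
    by (rule galerkin.intro) (use assms in blast)+
  show ?case
  proof (intro exI[of _ E] conjI ballI allI impI)
    show "evolution_system T E" by (rule evolution_system_E)
    show "norm (\<iota> (E t s x)) \<le> norm (\<iota> x)" if "0 \<le> s \<and> s \<le> t \<and> t \<le> T" for s t x
      using that by (intro E_H_contraction) auto
    fix s assume "s \<in> {0..<T}"
    then have s: "0 \<le> s" "s < T" by auto
    show sol: "cauchy_solution \<iota> (galerkin_form \<phi> \<alpha> a m) s T x (\<lambda>t. E t s x)" for x
      by (rule E_cauchy_solution[OF s])
    show "AE t in lebesgue_on {s..T}. w t = E t s x"
      if "cauchy_solution \<iota> (galerkin_form \<phi> \<alpha> a m) s T x w" for x w
      by (rule cauchy_solution_unique[OF s sol that])
    show "\<exists>C>0. \<forall>x.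
        in_L2 s T (\<lambda>t. form_operator \<iota> (galerkin_form \<phi> \<alpha> a m t) (E t s x)) \<and>
        norm_H1 s T (\<lambda>t. \<iota> (E t s x)) + norm_L2 s T (\<lambda>t. E t s x)
          + norm_L2 s T (\<lambda>t. form_operator \<iota> (galerkin_form \<phi> \<alpha> a m t) (E t s x))
          \<le> C * norm x"
      by (rule E_estimate[OF s])
    show "E t s x \<in> basis_span \<phi> m" if "x \<in> basis_span \<phi> m" "t \<in> {s..T}" for x t
      using that by (intro E_span) auto
  qed
qed

end
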